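(* Consider $SO(N)$ lattice gauge theory on $\mathbb{Z}^2$ in the strong coupling regime. For every $\beta$ with $0<|\beta|<\beta_0$ there exist constants $C_1,C_2>0$ depending on $\beta$ such that for all simple loops $\ell$, $$\lim_{N\to\infty}\frac{|\langle W_\ell\rangle_{\Lambda_N,N,\beta}|}{N}\ \ge\ C_1e^{-C_2\,\mathrm{area}(\ell)} .$$
   Context: Model. $E$ is the set of directed nearest-neighbour edges of $\mathbb{Z}^2$; $e^{-1}$ is the reversal of $e$; $E^+$ is the set of positively oriented edges (ending point larger than starting point in the lexicographic order). A plaquette $p=e_1e_2e_3e_4$ is a closed walk of length four around a unit square (four distinct edges), identified up to cyclic permutation; it is positively oriented if its smallest and second smallest vertices (lexicographically) occur in that order. For finite $\Lambda\subset\mathbb{Z}^2$, $E_\Lambda^+$ is the set of edges of $E^+$ with both endpoints in $\Lambda$, and $\mathcal{P}_\Lambda^+$ is the set of positively oriented plaquettes with all edges in $\Lambda$. For $N\ge 1$, $\beta\in\mathbb{R}$, the Gibbs measure $\mu_{\Lambda,N,\beta}$ is the probability measure on configurations $Q=(Q_e)_{e\in E_\Lambda^+}\in SO(N)^{E_\Lambda^+}$ whose density with respect to product Haar probability measure is $Z_{\Lambda,N,\beta}^{-1}\exp\big(N\beta\sum_{p\in\mathcal{P}_\Lambda^+}\mathrm{Tr}(Q_p)\big)$, where $Q_{e^{-1}}=Q_e^{-1}$ and $Q_p=Q_{e_1}Q_{e_2}Q_{e_3}Q_{e_4}$. Expectation is denoted $\langle\cdot\rangle_{\Lambda,N,\beta}$.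 Loops. A loop $\ell=e_1\cdots e_n$ is a non-backtracking closed walk; $W_\ell=\mathrm{Tr}(Q_{e_1}\cdots Q_{e_n})$. A loop $e_1\cdots e_n$ is simple if the endpoints of the $e_i$'s are all distinct. The area of a simple loop is the number of unit squares (plaquettes) contained in the bounded component of its complement in the plane. Strong coupling regime. Fix finite sets $\Lambda_1\subset\Lambda_2\subset\cdots$ with union $\mathbb{Z}^2$. By a theorem of Chatterjee there is $\beta_0>0$ such that for $|\beta|<\beta_0$ and every loop $\ell$ the limit $w(\ell,\beta)=\lim_N\langle W_\ell\rangle_{\Lambda_N,N,\beta}/N$ exists (independently of the choice of $(\Lambda_N)$), normalized expectations of products of Wilson loop variables factorize as $N\to\infty$, and $w(\ell,\beta)=\sum_{k\ge0}a_k(\ell)\beta^k$ is an absolutely convergent power series. $\beta_0$ denotes such a constant. *)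

theory Defs
  imports "HOL-Probability.Probability" "Jordan_Normal_Form.Determinant"
begin

section \<open>The lattice\<close>

type_synonym site = "int \<times> int"
type_synonym edge = "site \<times> site"

definition lex_less :: "site \<Rightarrow> site \<Rightarrow> bool" where
  "lex_less u v \<longleftrightarrow> fst u < fst v \<or> fst u = fst v \<and> snd u < snd v"

text \<open>An edge is the pair of its starting and ending point, so its reversal is \<^const>\<open>prod.swap\<close>.\<close>

definition lattice_edge :: "edge \<Rightarrow> bool" where
  "lattice_edge e \<longleftrightarrow>
     \<bar>fst (snd e) - fst (fst e)\<bar> + \<bar>snd (snd e) - snd (fst e)\<bar> = 1"

definition positive_edge :: "edge \<Rightarrow> bool" where
  "positive_edge e \<longleftrightarrow> lattice_edge e \<and> lex_less (fst e) (snd e)"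

definition positive_edges :: "site set \<Rightarrow> edge set" where
  "positive_edges \<Lambda> = {e. positive_edge e \<and> fst e \<in> \<Lambda> \<and> snd e \<in> \<Lambda>}"

definition closed_walk :: "edge list \<Rightarrow> bool" where
  "closed_walk es \<longleftrightarrow> es \<noteq> [] \<and> (\<forall>e\<in>set es. lattice_edge e) \<and>
     (\<forall>i<length es. snd (es ! i) = fst (es ! (Suc i mod length es)))"

definition plaquette :: "edge list \<Rightarrow> bool" where
  "plaquette p \<longleftrightarrow> closed_walk p \<and> length p = 4 \<and> distinct p \<and>
     (\<exists>x y. fst ` set p = {(x, y), (x + 1, y), (x, y + 1), (x + 1, y + 1)})"

text \<open>Positively oriented plaquettes are classes under cyclic permutation. Each class has exactly
  one member that starts at its smallest vertex; it is positively oriented iff the next vertex of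
  that member is the second smallest one. The set below consists of these members.\<close>

definition positive_plaquettes :: "site set \<Rightarrow> edge list set" where
  "positive_plaquettes \<Lambda> = {p. plaquette p \<and>
     lex_less (fst (p ! 0)) (fst (p ! 1)) \<and>
     (\<forall>i\<in>{2,3}. lex_less (fst (p ! 1)) (fst (p ! i))) \<and>
     (\<forall>e\<in>set p. fst e \<in> \<Lambda> \<and> snd e \<in> \<Lambda>)}"

text \<open>A loop is given by the list of its edges from an arbitrary base point. Since it is closed,
  the last and the first edge must not form a backtrack either.\<close>

definition lattice_loop :: "edge list \<Rightarrow> bool" where
  "lattice_loop l \<longleftrightarrow> closed_walk l \<and>
     (\<forall>i<length l. l ! (Suc i mod length l) \<noteq> prod.swap (l ! i))"

definition simple_lattice_loop :: "edge list \<Rightarrow> bool" where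
  "simple_lattice_loop l \<longleftrightarrow> lattice_loop l \<and> distinct (map snd l)"

definition site_point :: "site \<Rightarrow> complex" where
  "site_point v = Complex (real_of_int (fst v)) (real_of_int (snd v))"

definition loop_trace :: "edge list \<Rightarrow> complex set" where
  "loop_trace l = (\<Union>e\<in>set l. closed_segment (site_point (fst e)) (site_point (snd e)))"

text \<open>\<^const>\<open>inside\<close> is the union of the bounded components of the complement. The unit squares are
  taken open, because a square next to the loop has boundary points on it.\<close>

definition loop_area :: "edge list \<Rightarrow> nat" where
  "loop_area l = card {(x, y).
     box (site_point (x, y)) (site_point (x + 1, y + 1)) \<subseteq> inside (loop_trace l)}"

section \<open>Special orthogonal groups and Haar measure\<close>

definition SO :: "nat \<Rightarrow> real mat monoid" where
  "SO N = \<lparr>carrier = {A \<in> carrier_mat N N. A * transpose_mat A = 1\<^sub>m N \<and> Determinant.det A = 1},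
           mult = (*), one = 1\<^sub>m N\<rparr>"

definition mat_trace :: "real mat \<Rightarrow> real" where
  "mat_trace A = (\<Sum>i<dim_row A. A $$ (i, i))"

text \<open>The type of matrices carries no topology; the Borel sets of \<open>SO(N)\<close>, as a subspace of
  \<open>N \<times> N\<close>-dimensional Euclidean space, are pulled back along the matrix entries.\<close>

definition SO_borel :: "nat \<Rightarrow> real mat measure" where
  "SO_borel N = vimage_algebra (carrier (SO N))
     (\<lambda>A. restrict (\<lambda>ij. A $$ ij) ({..<N} \<times> {..<N})) (PiM ({..<N} \<times> {..<N}) (\<lambda>_. borel))"

definition SO_haar :: "nat \<Rightarrow> real mat measure \<Rightarrow> bool" where
  "SO_haar N M \<longleftrightarrow> prob_space M \<and> sets M = sets (SO_borel N) \<and>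
     (\<forall>A\<in>carrier (SO N). distr M M (\<lambda>X. A \<otimes>\<^bsub>SO N\<^esub> X) = M)"

section \<open>Lattice gauge theory\<close>

text \<open>From here on, \<open>H N\<close> is meant to be the Haar probability measure on \<open>SO(N)\<close>.\<close>

definition edge_matrix :: "nat \<Rightarrow> (edge \<Rightarrow> real mat) \<Rightarrow> edge \<Rightarrow> real mat" where
  "edge_matrix N Q e =
     (if positive_edge e then Q e else m_inv (SO N) (Q (prod.swap e)))"

definition path_matrix :: "nat \<Rightarrow> (edge \<Rightarrow> real mat) \<Rightarrow> edge list \<Rightarrow> real mat" where
  "path_matrix N Q es = foldr (*) (map (edge_matrix N Q) es) (1\<^sub>m N)"

definition wilson :: "nat \<Rightarrow> edge list \<Rightarrow> (edge \<Rightarrow> real mat) \<Rightarrow> real" where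
  "wilson N l Q = mat_trace (path_matrix N Q l)"

definition gibbs_weight :: "site set \<Rightarrow> nat \<Rightarrow> real \<Rightarrow> (edge \<Rightarrow> real mat) \<Rightarrow> real" where
  "gibbs_weight \<Lambda> N \<beta> Q = exp (real N * \<beta> * (\<Sum>p\<in>positive_plaquettes \<Lambda>. wilson N p Q))"

definition product_haar ::
    "(nat \<Rightarrow> real mat measure) \<Rightarrow> site set \<Rightarrow> nat \<Rightarrow> (edge \<Rightarrow> real mat) measure" where
  "product_haar H \<Lambda> N = PiM (positive_edges \<Lambda>) (\<lambda>_. H N)"

definition partition_function ::
    "(nat \<Rightarrow> real mat measure) \<Rightarrow> site set \<Rightarrow> nat \<Rightarrow> real \<Rightarrow> real" where
  "partition_function H \<Lambda> N \<beta> = (LINT Q|product_haar H \<Lambda> N. gibbs_weight \<Lambda> N \<beta> Q)"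

definition gibbs_measure ::
    "(nat \<Rightarrow> real mat measure) \<Rightarrow> site set \<Rightarrow> nat \<Rightarrow> real \<Rightarrow> (edge \<Rightarrow> real mat) measure" where
  "gibbs_measure H \<Lambda> N \<beta> = density (product_haar H \<Lambda> N)
     (\<lambda>Q. ennreal (gibbs_weight \<Lambda> N \<beta> Q / partition_function H \<Lambda> N \<beta>))"

definition gibbs_expectation ::
    "(nat \<Rightarrow> real mat measure) \<Rightarrow> site set \<Rightarrow> nat \<Rightarrow> real \<Rightarrow> ((edge \<Rightarrow> real mat) \<Rightarrow> real) \<Rightarrow> real"
  where
  "gibbs_expectation H \<Lambda> N \<beta> f = (LINT Q|gibbs_measure H \<Lambda> N \<beta>. f Q)"

section \<open>Strong coupling regime\<close>

definition exhausting :: "(nat \<Rightarrow> site set) \<Rightarrow> bool" where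
  "exhausting \<Lambda> \<longleftrightarrow> (\<forall>N\<ge>1. finite (\<Lambda> N)) \<and> (\<forall>N\<ge>1. \<Lambda> N \<subseteq> \<Lambda> (Suc N)) \<and>
     (\<Union>N\<in>{1..}. \<Lambda> N) = UNIV"

text \<open>The properties that Chatterjee's theorem provides for some \<open>\<beta>\<^sub>0\<close>. The limits \<open>w\<close> and the
  coefficients \<open>a\<close> are chosen before \<open>\<Lambda>\<close>, so they do not depend on the exhausting sequence, and
  \<open>a\<close> does not depend on \<open>\<beta>\<close>. For edges outside \<open>\<Lambda> N\<close> the value of \<^const>\<open>wilson\<close> is junk, but
  this concerns only finitely many \<open>N\<close> for any given loop.\<close>

definition strong_coupling_constant :: "(nat \<Rightarrow> real mat measure) \<Rightarrow> real \<Rightarrow> bool" where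
  "strong_coupling_constant H \<beta>\<^sub>0 \<longleftrightarrow> 0 < \<beta>\<^sub>0 \<and>
     (\<exists>(w :: edge list \<Rightarrow> real \<Rightarrow> real) (a :: edge list \<Rightarrow> nat \<Rightarrow> real).
       \<forall>\<beta>. \<bar>\<beta>\<bar> < \<beta>\<^sub>0 \<longrightarrow>
         (\<forall>\<Lambda> l. exhausting \<Lambda> \<and> lattice_loop l \<longrightarrow>
            (\<lambda>N. gibbs_expectation H (\<Lambda> N) N \<beta> (wilson N l) / real N) \<longlonglongrightarrow> w l \<beta>) \<and>
         (\<forall>\<Lambda> ls. exhausting \<Lambda> \<and> (\<forall>l\<in>set ls. lattice_loop l) \<longrightarrow>
            (\<lambda>N. gibbs_expectation H (\<Lambda> N) N \<beta> (\<lambda>Q. \<Prod>l\<leftarrow>ls. wilson N l Q)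
                   / real N ^ length ls) \<longlonglongrightarrow> (\<Prod>l\<leftarrow>ls. w l \<beta>)) \<and>
         (\<forall>l. lattice_loop l \<longrightarrow>
            summable (\<lambda>k. \<bar>a l k * \<beta> ^ k\<bar>) \<and> w l \<beta> = (\<Sum>k. a l k * \<beta> ^ k)))"

end

theory Submission
  imports Defs
begin

text \<open>In two dimensions the model on a square box is solvable at every finite \<open>N \<ge> 3\<close>. A simple
  loop \<open>l\<close> is, modulo 2, the boundary of a finite set \<open>B\<close> of unit squares. The squares outside
  \<open>B\<close> can be integrated out one at a time, each through an edge that lies neither on \<open>l\<close> nor on
  another remaining square. Then the squares of \<open>B\<close> are removed one at a time through an edge that the
  current loop passes exactly once: integrating this edge replaces it by the other three edges of its
  square and gives a factor \<open>c\<close>, the normalized expected trace of a single plaquette matrix. What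
  remains is a closed walk in a forest, whose matrix is the identity. Hence the normalized expectation
  is exactly \<open>c ^ card B\<close>, and \<open>card B\<close> is at most the area of \<open>l\<close>, since a component of the
  complement of \<open>l\<close> that meets a square of \<open>B\<close> cannot leave the union of the squares of \<open>B\<close>.

  As the limit does not depend on the exhausting sequence, boxes may be used throughout, and it remains
  to see that the limit \<open>w\<^sub>1(\<beta>)\<close> of \<open>c\<close> does not vanish for \<open>\<beta> \<noteq> 0\<close>. The Schwinger-Dyson
  equation gives \<open>w\<^sub>1(\<beta>) = \<beta> * (1 - w\<^sub>2(\<beta>))\<close>, where \<open>w\<^sub>2\<close> belongs to the plaquette traversed twice. Since
  \<open>c\<close> is increasing in \<open>\<beta>\<close>, a zero of \<open>w\<^sub>1\<close> would force \<open>w\<^sub>1 = 0\<close>, hence \<open>w\<^sub>2 = 1\<close>, all the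
  way down to \<open>\<beta> = 0\<close>; but \<open>w\<^sub>2\<close> is continuous, being a power series, and \<open>w\<^sub>2(0) = 0\<close>.\<close>

section \<open>Edges, squares and boundaries\<close>

text \<open>What shapes the proof is the order of integration: at each stage some edge must lie on
  exactly one remaining square and on no unwanted part of the loop. Planarity enters only through
  the mod 2 boundary \<open>bd\<close>, in statements of the form "a finite set of squares whose
  boundary lies in these edges is empty". Such a statement supplies the next edge to integrate, and
  the same form expresses that the edges left at the end are a forest. The bound N \<ge> 3 stems
  from the first moment of the plaquette matrix, which has to be a multiple of the identity. To
  cancel an off-diagonal entry one coordinate changes sign, and a third coordinate must change sign
  with it to keep determinant 1. The single-matrix identities hold at every coupling
  \<open>k\<close>; the choice k = N \<beta> makes both sides of the Schwinger-Dyson equation of the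
  same order in N. As the limit is an exact power of w1(\<beta>) with exponent
  \<open>card B\<close>, the first constant can be 1, and the second is - ln
  \<bar>w1(\<beta>)\<bar>, enlarged to at least 1.\<close>

definition hedge :: "site \<Rightarrow> edge" where "hedge s = (s, (fst s + 1, snd s))"
definition vedge :: "site \<Rightarrow> edge" where "vedge s = (s, (fst s, snd s + 1))"

definition pos_edge :: "edge \<Rightarrow> edge" where
  "pos_edge e = (if positive_edge e then e else prod.swap e)"

text \<open>A unit square is named by its lower left corner; \<open>side1\<close> and \<open>side2\<close> are the squares on
  the two sides of a positive edge.\<close>

definition side1 :: "edge \<Rightarrow> site" where "side1 e = fst e"
definition side2 :: "edge \<Rightarrow> site" where
  "side2 e = (if fst (fst e) = fst (snd e) then (fst (fst e) - 1, snd (fst e))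
              else (fst (fst e), snd (fst e) - 1))"

definition bd :: "site set \<Rightarrow> edge set" where
  "bd U = {e. positive_edge e \<and> (side1 e \<in> U \<longleftrightarrow> side2 e \<notin> U)}"

lemma positive_edge_cases:
  "positive_edge e \<longleftrightarrow> (\<exists>s. e = hedge s) \<or> (\<exists>s. e = vedge s)"
proof
  assume "positive_edge e"
  then have "(\<exists>s. snd e = (fst s + 1, snd s) \<and> fst e = s) \<or> (\<exists>s. snd e = (fst s, snd s + 1) \<and> fst e = s)"
    by (auto simp: positive_edge_def lattice_edge_def lex_less_def prod_eq_iff abs_if split: if_splits)
  then show "(\<exists>s. e = hedge s) \<or> (\<exists>s. e = vedge s)"
    by (metis hedge_def vedge_def prod.collapse)
qed (auto simp: positive_edge_def lattice_edge_def lex_less_def hedge_def vedge_def)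

lemma positive_hedge [simp]: "positive_edge (hedge s)" and positive_vedge [simp]: "positive_edge (vedge s)"
  by (metis positive_edge_cases)+

lemma lattice_edge_swap [simp]: "lattice_edge (prod.swap e) \<longleftrightarrow> lattice_edge e"
  unfolding lattice_edge_def fst_swap snd_swap by linarith

lemma positive_edge_swap: "lattice_edge e \<Longrightarrow> positive_edge (prod.swap e) \<longleftrightarrow> \<not> positive_edge e"
  unfolding positive_edge_def lattice_edge_def lex_less_def fst_swap snd_swap by linarith

lemma positive_imp_lattice: "positive_edge e \<Longrightarrow> lattice_edge e"
  by (simp add: positive_edge_def)

lemma positive_pos_edge: "lattice_edge e \<Longrightarrow> positive_edge (pos_edge e)"
  by (auto simp: pos_edge_def positive_edge_swap)

lemma lattice_edge_cases:
  assumes "lattice_edge e"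
  obtains s where "e = hedge s" | s where "e = vedge s"
    | s where "e = prod.swap (hedge s)" | s where "e = prod.swap (vedge s)"
  using positive_pos_edge[OF assms] unfolding positive_edge_cases pos_edge_def
  by (metis swap_swap)

lemma pos_edge_id [simp]: "positive_edge e \<Longrightarrow> pos_edge e = e"
  by (simp add: pos_edge_def)

lemma pos_edge_swap [simp]: "lattice_edge e \<Longrightarrow> pos_edge (prod.swap e) = pos_edge e"
  by (auto simp: pos_edge_def positive_edge_swap)

lemma pos_edge_eq_iff: "pos_edge d = e \<Longrightarrow> d = e \<or> d = prod.swap e"
  by (auto simp: pos_edge_def split: if_splits)

lemma edge_eqs [simp]:
  "hedge s = hedge t \<longleftrightarrow> s = t" "vedge s = vedge t \<longleftrightarrow> s = t"
  "hedge s \<noteq> vedge t" "vedge t \<noteq> hedge s"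
  "fst (hedge s) = s" "fst (vedge s) = s"
  "snd (hedge s) = (fst s + 1, snd s)" "snd (vedge s) = (fst s, snd s + 1)"
  by (auto simp: hedge_def vedge_def)

lemma lattice_hv [simp]: "lattice_edge (hedge s)" "lattice_edge (vedge s)"
  by (auto intro: positive_imp_lattice)

lemma not_positive_swap [simp]: "\<not> positive_edge (prod.swap (hedge s))" "\<not> positive_edge (prod.swap (vedge s))"
  by (simp_all add: positive_edge_swap)

lemma swap_edge_neq [simp]:
  "prod.swap (hedge s) \<noteq> hedge t" "prod.swap (vedge s) \<noteq> vedge t"
  "prod.swap (hedge s) \<noteq> vedge t" "prod.swap (vedge s) \<noteq> hedge t"
  "hedge t \<noteq> prod.swap (hedge s)" "vedge t \<noteq> prod.swap (vedge s)"
  "vedge t \<noteq> prod.swap (hedge s)" "hedge t \<noteq> prod.swap (vedge s)"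
  by (metis positive_hedge positive_vedge not_positive_swap)+

lemma pos_edge_swap_hv [simp]:
  "pos_edge (prod.swap (hedge s)) = hedge s" "pos_edge (prod.swap (vedge s)) = vedge s"
  by simp_all

lemma swap_edge_inj [simp]: "prod.swap (d::edge) = prod.swap e \<longleftrightarrow> d = e"
  by (metis swap_swap)

lemma sides [simp]:
  "side1 (hedge s) = s" "side2 (hedge s) = (fst s, snd s - 1)"
  "side1 (vedge s) = s" "side2 (vedge s) = (fst s - 1, snd s)"
  by (auto simp: side1_def side2_def)

lemma hedge_in_bd: "hedge s \<in> bd U \<longleftrightarrow> (s \<in> U \<longleftrightarrow> (fst s, snd s - 1) \<notin> U)"
  by (simp add: bd_def)

lemma vedge_in_bd: "vedge s \<in> bd U \<longleftrightarrow> (s \<in> U \<longleftrightarrow> (fst s - 1, snd s) \<notin> U)"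
  by (simp add: bd_def)

lemma bd_positive: "e \<in> bd U \<Longrightarrow> positive_edge e"
  by (simp add: bd_def)

lemma bd_empty [simp]: "bd {} = {}"
  by (simp add: bd_def)

text \<open>A square of \<open>U\<close> with maximal first coordinate has its right side on the
  boundary. Finiteness is essential: the whole plane has empty boundary.\<close>

lemma bd_nonempty:
  assumes "finite U" "U \<noteq> {}"
  shows "bd U \<noteq> {}"
proof -
  define m where "m = Max (fst ` U)"
  have "m \<in> fst ` U" unfolding m_def using assms by (intro Max_in) auto
  then obtain y where y: "(m, y) \<in> U" by auto
  have "(m + 1, y) \<notin> U"
  proof
    assume "(m + 1, y) \<in> U"
    then have "m + 1 \<le> m" unfolding m_def using assms
      by (metis Max_ge finite_imageI fst_conv image_eqI)
    then show False by simp
  qed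
  with y have "vedge (m + 1, y) \<in> bd U" by (simp add: vedge_in_bd)
  then show ?thesis by auto
qed

text \<open>\<open>bd\<close> is linear modulo 2: it maps symmetric differences to symmetric
  differences. Equal boundaries therefore leave a symmetric difference without boundary, to which
  \<open>bd_nonempty\<close> applies.\<close>

lemma bd_inj:
  assumes "finite U" "finite V" "bd U = bd V"
  shows "U = V"
proof -
  have "bd (U - V \<union> (V - U)) = {}"
    using assms(3) unfolding bd_def set_eq_iff by blast
  then show ?thesis using bd_nonempty[of "U - V \<union> (V - U)"] assms by auto
qed

section \<open>Walks, signed passages and winding numbers\<close>

fun walk :: "site \<Rightarrow> edge list \<Rightarrow> site \<Rightarrow> bool" where
  "walk u [] v \<longleftrightarrow> u = v"
| "walk u (e # es) v \<longleftrightarrow> lattice_edge e \<and> fst e = u \<and> walk (snd e) es v"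

lemma walk_append: "walk u (a @ b) v \<longleftrightarrow> (\<exists>w. walk u a w \<and> walk w b v)"
  by (induction a arbitrary: u) auto

lemma walk_lattice: "walk u es v \<Longrightarrow> e \<in> set es \<Longrightarrow> lattice_edge e"
  by (induction es arbitrary: u) auto

lemma walk_iff_nth:
  "walk u es v \<longleftrightarrow> (\<forall>e\<in>set es. lattice_edge e) \<and>
     (if es = [] then u = v else fst (es ! 0) = u \<and> snd (es ! (length es - 1)) = v \<and>
        (\<forall>i. Suc i < length es \<longrightarrow> snd (es ! i) = fst (es ! Suc i)))"
proof (induction es arbitrary: u)
  case (Cons e es)
  show ?case
  proof (cases "es = []")
    case False
    have *: "(\<forall>i. Suc i < length (e # es) \<longrightarrow> snd ((e # es) ! i) = fst ((e # es) ! Suc i)) \<longleftrightarrow>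
       snd e = fst (es ! 0) \<and> (\<forall>i. Suc i < length es \<longrightarrow> snd (es ! i) = fst (es ! Suc i))"
      (is "?L \<longleftrightarrow> ?R")
    proof
      assume ?L
      then show ?R using False by (auto dest: spec[of _ 0] spec[of _ "Suc _"])
    next
      assume ?R
      show ?L
      proof (intro allI impI)
        fix i assume "Suc i < length (e # es)"
        then show "snd ((e # es) ! i) = fst ((e # es) ! Suc i)"
          using \<open>?R\<close> by (cases i) auto
      qed
    qed
    show ?thesis unfolding * using False Cons.IH[of "snd e"] by auto
  qed auto
qed auto

lemma closed_walk_iff: "closed_walk es \<longleftrightarrow> es \<noteq> [] \<and> walk (fst (es ! 0)) es (fst (es ! 0))"
proof (cases "es = []")
  case False
  then have n: "length es > 0" by simp
  have "(\<forall>i<length es. snd (es ! i) = fst (es ! (Suc i mod length es))) \<longleftrightarrow>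
     snd (es ! (length es - 1)) = fst (es ! 0) \<and>
     (\<forall>i. Suc i < length es \<longrightarrow> snd (es ! i) = fst (es ! Suc i))" (is "?L \<longleftrightarrow> ?R")
  proof
    assume L: ?L
    have "snd (es ! (length es - 1)) = fst (es ! 0)"
      using L[rule_format, of "length es - 1"] n by simp
    moreover have "\<forall>i. Suc i < length es \<longrightarrow> snd (es ! i) = fst (es ! Suc i)"
    proof (intro allI impI)
      fix i assume "Suc i < length es"
      then show "snd (es ! i) = fst (es ! Suc i)" using L[rule_format, of i] by simp
    qed
    ultimately show ?R by blast
  next
    assume R: ?R
    show ?L
    proof (intro allI impI)
      fix i assume i: "i < length es"
      show "snd (es ! i) = fst (es ! (Suc i mod length es))"
      proof (cases "Suc i < length es")
        case False
        then have "i = length es - 1" "Suc i = length es" using i by auto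
        then show ?thesis using R by simp
      qed (use R in auto)
    qed
  qed
  then show ?thesis unfolding closed_walk_def walk_iff_nth using False by auto
qed (simp add: closed_walk_def)

definition passages :: "edge list \<Rightarrow> edge \<Rightarrow> int" where
  "passages es e = (\<Sum>d\<leftarrow>es. if d = e then 1 else if d = prod.swap e then -1 else 0)"

text \<open>Winding number around the square \<open>s\<close>: signed number of crossings of the horizontal ray from
  the square to the right.\<close>

definition winding :: "edge list \<Rightarrow> site \<Rightarrow> int" where
  "winding es s = (\<Sum>d\<leftarrow>es. if snd (pos_edge d) = (fst (fst d), snd s + 1) \<and>
       fst (pos_edge d) = (fst (fst d), snd s) \<and> fst (fst d) > fst s
     then (if positive_edge d then 1 else -1) else 0)"

lemma walk_telescope:
  fixes g :: "site \<Rightarrow> int"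
  shows "walk u es v \<Longrightarrow> (\<Sum>d\<leftarrow>es. g (snd d) - g (fst d)) = g v - g u"
  by (induction es arbitrary: u) auto

lemma sum_list_diff_add_cong:
  fixes f g h k :: "'a \<Rightarrow> int"
  shows "(\<And>d. d \<in> set es \<Longrightarrow> f d - g d + h d = k d) \<Longrightarrow>
    (\<Sum>d\<leftarrow>es. f d) - (\<Sum>d\<leftarrow>es. g d) + (\<Sum>d\<leftarrow>es. h d) = (\<Sum>d\<leftarrow>es. k d)"
proof (induction es)
  case (Cons a es)
  have "f a - g a + h a = k a" by (rule Cons.prems) simp
  moreover have "(\<Sum>d\<leftarrow>es. f d) - (\<Sum>d\<leftarrow>es. g d) + (\<Sum>d\<leftarrow>es. h d) = (\<Sum>d\<leftarrow>es. k d)"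
    by (rule Cons.IH, rule Cons.prems) simp
  ultimately show ?case unfolding list.map sum_list.Cons by linarith
next
  case Nil
  show ?case unfolding list.map sum_list.Nil by simp
qed

lemma sum_list_zero: "(\<And>d. d \<in> set es \<Longrightarrow> f d = (0::int)) \<Longrightarrow> (\<Sum>d\<leftarrow>es. f d) = 0"
  by (induction es) auto

text \<open>Moving the square one step to the left extends its ray by a single crossing, that of the
  vertical edge in between.\<close>

lemma winding_vedge:
  assumes "walk u es v"
  shows "winding es (x - 1, y) - winding es (x, y) = passages es (vedge (x, y))"
proof -
  have "winding es (x - 1, y) - winding es (x, y) + (\<Sum>d\<leftarrow>es. 0) = passages es (vedge (x, y))"
    unfolding winding_def passages_def
  proof (rule sum_list_diff_add_cong, goal_cases)
    case (1 d)
    then show ?case using walk_lattice[OF assms 1]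
      by (elim lattice_edge_cases; hypsubst_thin; (case_tac s)) (simp_all split: if_splits)
  qed
  then show ?thesis by simp
qed

lemma winding_hedge:
  assumes "walk u es u"
  shows "winding es (x, y - 1) - winding es (x, y) + passages es (hedge (x, y)) = 0"
proof -
  \<comment> \<open>Indicator of the lattice points strictly right of \<open>x\<close> on the row
    between the two rays. A walk enters or leaves this half line through the lower ray, through the
    upper ray, or through its left end along \<open>hedge (x, y)\<close>; for a closed walk the
    signed total is 0.\<close>
  define g :: "site \<Rightarrow> int" where "g = (\<lambda>v. if snd v = y \<and> fst v > x then 1 else 0)"
  have "winding es (x, y - 1) - winding es (x, y) + passages es (hedge (x, y)) =
     (\<Sum>d\<leftarrow>es. g (snd d) - g (fst d))"
    unfolding winding_def passages_def
  proof (rule sum_list_diff_add_cong, goal_cases)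
    case (1 d)
    then show ?case using walk_lattice[OF assms 1]
      by (elim lattice_edge_cases; hypsubst_thin; (case_tac s)) (simp_all add: g_def split: if_splits)
  qed
  then show ?thesis using walk_telescope[OF assms, of g] by simp
qed

lemma finite_winding_support:
  assumes "walk u es u"
  shows "finite {s. winding es s \<noteq> 0}"
proof -
  define m where "m = (\<Sum>d\<leftarrow>es. \<bar>fst (fst d)\<bar> + \<bar>fst (snd d)\<bar> + \<bar>snd (fst d)\<bar> + \<bar>snd (snd d)\<bar>)"
  have m: "\<bar>fst (fst d)\<bar> + \<bar>fst (snd d)\<bar> + \<bar>snd (fst d)\<bar> + \<bar>snd (snd d)\<bar> \<le> m" if "d \<in> set es" for d
    unfolding m_def using that by (intro member_le_sum_list) (auto simp: image_iff)
  have zero: "winding es s = 0" if s: "s \<notin> {-m-1..m} \<times> {-m-1..m}" for s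
  proof -
    consider "snd s < -m-1 \<or> snd s > m" | "fst s > m" | "fst s < -m-1" using s by (cases s) auto
    then show ?thesis
    proof cases
      case 1
      show ?thesis unfolding winding_def
      proof (rule sum_list_zero)
        fix d assume d: "d \<in> set es"
        have "fst (pos_edge d) \<noteq> (fst (fst d), snd s) \<or> snd (pos_edge d) \<noteq> (fst (fst d), snd s + 1)"
          using 1 m[OF d] by (auto simp: pos_edge_def)
        then show "(if snd (pos_edge d) = (fst (fst d), snd s + 1) \<and>
            fst (pos_edge d) = (fst (fst d), snd s) \<and> fst s < fst (fst d)
            then if positive_edge d then 1 else - 1 else 0) = (0::int)" by auto
      qed
    next
      case 2
      show ?thesis unfolding winding_def
        by (rule sum_list_zero) (use 2 m in \<open>force split: if_splits\<close>)
    next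
      case 3
      \<comment> \<open>From a square left of the whole walk the ray meets every vertical edge of
        its row. The sum then counts signed passages into the upper half plane, which cancel for a
        closed walk.\<close>
      define g :: "site \<Rightarrow> int" where "g = (\<lambda>v. if snd v > snd s then 1 else 0)"
      have "winding es s = (\<Sum>d\<leftarrow>es. g (snd d) - g (fst d))"
        unfolding winding_def
      proof (rule arg_cong[where f = sum_list], rule map_cong[OF refl])
        fix d assume d: "d \<in> set es"
        have *: "fst s < fst (fst d)" "fst s < fst (snd d)" using m[OF d] 3 by auto
        show "(if snd (pos_edge d) = (fst (fst d), snd s + 1) \<and>
            fst (pos_edge d) = (fst (fst d), snd s) \<and> fst s < fst (fst d)
            then if positive_edge d then 1 else - 1 else 0) = g (snd d) - g (fst d)"
          using walk_lattice[OF assms d] *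
          by (elim lattice_edge_cases; hypsubst_thin; (case_tac sa)) (simp_all add: g_def)
      qed
      then show ?thesis using walk_telescope[OF assms, of g] by simp
    qed
  qed
  have "finite ({-m-1..m} \<times> {-m-1..m})" by simp
  then show ?thesis by (rule rev_finite_subset) (use zero in blast)
qed

section \<open>Simple loops bound finite sets of squares\<close>

lemma closed_walkD:
  assumes "closed_walk l"
  shows "l \<noteq> []" "\<And>e. e \<in> set l \<Longrightarrow> lattice_edge e"
    "\<And>i. i < length l \<Longrightarrow> snd (l ! i) = fst (l ! (Suc i mod length l))"
  using assms by (auto simp: closed_walk_def)

lemma closed_walk_distinct_fst:
  assumes "closed_walk l" "distinct (map snd l)"
  shows "distinct (map fst l)"
proof -
  have n: "length l > 0" using closed_walkD(1)[OF assms(1)] by simp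
  have "set (map snd l) \<subseteq> set (map fst l)"
  proof
    fix v assume "v \<in> set (map snd l)"
    then obtain i where i: "i < length l" "v = snd (l ! i)" by (auto simp: in_set_conv_nth)
    then have "v = fst (l ! (Suc i mod length l))" using closed_walkD(3)[OF assms(1)] by simp
    then show "v \<in> set (map fst l)" using n by simp
  qed
  then have "card (set (map snd l)) \<le> card (set (map fst l))" by (intro card_mono) auto
  then have "length l \<le> card (set (map fst l))" using distinct_card[OF assms(2)] by simp
  then show ?thesis by (intro card_distinct) (metis card_length length_map order_antisym)
qed

text \<open>Even as unoriented edges the steps differ. If step \<open>j\<close> reverses step
  \<open>i\<close>, it starts where step \<open>i\<close> ends; since starting points are distinct,
  it is the very next step, a backtrack.\<close>

lemma simple_loop_distinct_edges:
  assumes "simple_lattice_loop l"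
  shows "distinct (map pos_edge l)"
  unfolding distinct_conv_nth
proof (intro allI impI)
  have cw: "closed_walk l" and d: "distinct (map snd l)"
    and nb: "\<And>i. i < length l \<Longrightarrow> l ! (Suc i mod length l) \<noteq> prod.swap (l ! i)"
    using assms by (auto simp: simple_lattice_loop_def lattice_loop_def)
  note df = closed_walk_distinct_fst[OF cw d]
  fix i j assume i: "i < length (map pos_edge l)" and j: "j < length (map pos_edge l)" and ij: "i \<noteq> j"
  show "map pos_edge l ! i \<noteq> map pos_edge l ! j"
  proof
    assume "map pos_edge l ! i = map pos_edge l ! j"
    then have eq: "pos_edge (l ! i) = pos_edge (l ! j)" using i j by simp
    have "l ! i = l ! j \<or> l ! j = prod.swap (l ! i)"
      using eq unfolding pos_edge_def by (auto split: if_splits)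
    then show False
    proof
      assume "l ! i = l ! j"
      then show False using d i j ij by (metis distinct_conv_nth length_map nth_map)
    next
      assume sw: "l ! j = prod.swap (l ! i)"
      then have "fst (l ! j) = fst (l ! (Suc i mod length l))"
        using closed_walkD(3)[OF cw, of i] i by simp
      moreover have "Suc i mod length l < length l" using i by (intro mod_less_divisor) auto
      ultimately have "j = Suc i mod length l" using df j
        by (metis distinct_conv_nth length_map nth_map)
      then show False using nb[of i] sw i by simp
    qed
  qed
qed

lemma odd_passages:
  assumes "\<forall>d\<in>set es. lattice_edge d" "positive_edge e"
  shows "odd (passages es e) \<longleftrightarrow> odd (count_list (map pos_edge es) e)"
  using assms(1)
proof (induction es)
  case (Cons d es)
  have "d = e \<or> d = prod.swap e \<longleftrightarrow> pos_edge d = e"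
    using Cons.prems assms(2) pos_edge_eq_iff[of d e] positive_imp_lattice[OF assms(2)] by auto
  then show ?case using Cons by (auto simp: passages_def)
qed (simp add: passages_def)

lemma count_list_distinct: "distinct xs \<Longrightarrow> count_list xs x = (if x \<in> set xs then 1 else 0)"
  by (induction xs) auto

text \<open>Across an edge the winding number changes by the signed passages through it, whose
  parity is that of the unsigned count.\<close>

lemma bd_odd_winding:
  assumes "walk u es u"
  shows "bd {s. odd (winding es s)} = {e. positive_edge e \<and> odd (count_list (map pos_edge es) e)}"
proof -
  have "e \<in> bd {s. odd (winding es s)} \<longleftrightarrow> odd (passages es e)" if e: "positive_edge e" for e
    using e unfolding positive_edge_cases
  proof (elim disjE exE)
    fix s assume "e = hedge s"
    then show ?thesis
      using winding_hedge[OF assms, of "fst s" "snd s"]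
      by (auto simp: hedge_in_bd) presburger+
  next
    fix s assume "e = vedge s"
    then show ?thesis
      using winding_vedge[OF assms, of "fst s" "snd s"]
      by (auto simp: vedge_in_bd) presburger+
  qed
  then show ?thesis
    using odd_passages[of es] walk_lattice[OF assms] bd_positive by blast
qed

lemma ex_bd_simple:
  assumes "simple_lattice_loop l"
  obtains B where "finite B" "bd B = pos_edge ` set l"
proof -
  have cw: "closed_walk l" using assms by (simp add: simple_lattice_loop_def lattice_loop_def)
  then have w: "walk (fst (l ! 0)) l (fst (l ! 0))" by (simp add: closed_walk_iff)
  define B where "B = {s. odd (winding l s)}"
  have "finite B" by (rule finite_subset[OF _ finite_winding_support[OF w]]) (auto simp: B_def)
  moreover have "bd B = pos_edge ` set l"
    using bd_odd_winding[OF w] count_list_distinct[OF simple_loop_distinct_edges[OF assms]]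
      closed_walkD(2)[OF cw] positive_pos_edge by (auto simp: B_def)
  ultimately show thesis by (rule that)
qed

section \<open>Cycles modulo 2 and walks in forests\<close>

definition incident :: "site \<Rightarrow> edge set" where
  "incident v = {hedge v, hedge (fst v - 1, snd v), vedge v, vedge (fst v, snd v - 1)}"

lemma incident_iff:
  assumes "positive_edge e"
  shows "e \<in> incident v \<longleftrightarrow> fst e = v \<or> snd e = v"
  using assms unfolding positive_edge_cases
  by (elim disjE exE; cases v) (auto simp: incident_def prod_eq_iff)

text \<open>Going once around a vertex through its four squares, one enters and leaves
  \<open>W\<close> equally often, so an even number of the four edges lies in \<open>bd W\<close>.
  If only two of them can, then both do or neither does.\<close>

lemma vertex_parity:
  assumes "a \<in> incident v" "b \<in> incident v" "a \<noteq> b"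
    and "\<And>e. e \<in> incident v \<Longrightarrow> e \<in> bd W \<Longrightarrow> e = a \<or> e = b"
  shows "a \<in> bd W \<longleftrightarrow> b \<in> bd W"
proof -
  define x y where "x = fst v" and "y = snd v"
  have v: "v = (x, y)" by (simp add: x_def y_def)
  have H: "e \<in> incident (x, y) \<longrightarrow> e \<in> bd W \<longrightarrow> e = a \<or> e = b" for e
    using assms(4) v by blast
  show ?thesis
    using assms(1-3) H[of "hedge (x, y)"] H[of "hedge (x - 1, y)"] H[of "vedge (x, y)"] H[of "vedge (x, y - 1)"]
    unfolding incident_def v
    by (elim insertE emptyE; simp add: hedge_in_bd vedge_in_bd; blast)
qed

text \<open>A simple loop is a minimal cycle. At the common vertex of two consecutive steps no other
  loop edge is incident, so \<open>vertex_parity\<close> carries membership in \<open>bd W\<close>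
  from each step to the next, and hence once around.\<close>

lemma sub_cycle_of_simple_loop:
  assumes l: "simple_lattice_loop l" and W: "bd W \<subseteq> pos_edge ` set l"
  shows "bd W = {} \<or> bd W = pos_edge ` set l"
proof -
  define n where "n = length l"
  have cw: "closed_walk l" and d: "distinct (map snd l)"
    and nb: "\<And>i. i < length l \<Longrightarrow> l ! (Suc i mod length l) \<noteq> prod.swap (l ! i)"
    using l by (auto simp: simple_lattice_loop_def lattice_loop_def)
  have n: "n > 0" using closed_walkD(1)[OF cw] by (simp add: n_def)
  note df = closed_walk_distinct_fst[OF cw d]
  have lat: "lattice_edge (l ! i)" if "i < n" for i
    using closed_walkD(2)[OF cw] that by (simp add: n_def)
  have inc: "pos_edge (l ! i) \<in> incident v \<longleftrightarrow> fst (l ! i) = v \<or> snd (l ! i) = v" if "i < n" for i v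
    using incident_iff[OF positive_pos_edge[OF lat[OF that]]] by (auto simp: pos_edge_def)
  have ex: "\<exists>k<n. e = pos_edge (l ! k)" if e: "e \<in> pos_edge ` set l" for e
  proof -
    obtain d where "d \<in> set l" "e = pos_edge d" using e by blast
    then show ?thesis unfolding in_set_conv_nth n_def by blast
  qed
  have inj_nth: "f (l ! a) = f (l ! b) \<Longrightarrow> a < n \<Longrightarrow> b < n \<Longrightarrow> a = b" if "distinct (map f l)"
    for f :: "edge \<Rightarrow> site" and a b
    using that by (metis distinct_conv_nth length_map n_def nth_map)
  define P where "P i \<longleftrightarrow> pos_edge (l ! i) \<in> bd W" for i
  have step: "P i \<longleftrightarrow> P (Suc i mod n)" if i: "i < n" for i
  proof -
    define j where "j = Suc i mod n"
    have j: "j < n" using n by (simp add: j_def)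
    have ji: "fst (l ! j) = snd (l ! i)" using closed_walkD(3)[OF cw, of i] i by (simp add: n_def j_def)
    have ne: "pos_edge (l ! i) \<noteq> pos_edge (l ! j)"
    proof
      assume eq: "pos_edge (l ! i) = pos_edge (l ! j)"
      have "i = j" using simple_loop_distinct_edges[OF l] eq i j
        by (metis distinct_conv_nth length_map n_def nth_map)
      with ji have "fst (l ! i) = snd (l ! i)" by simp
      then show False using lat[OF i] by (simp add: lattice_edge_def)
    qed
    have "pos_edge (l ! i) \<in> bd W \<longleftrightarrow> pos_edge (l ! j) \<in> bd W"
    proof (rule vertex_parity[where v = "snd (l ! i)"])
      show "pos_edge (l ! i) \<in> incident (snd (l ! i))" "pos_edge (l ! j) \<in> incident (snd (l ! i))"
        using inc i j ji by auto
      show "pos_edge (l ! i) \<noteq> pos_edge (l ! j)" by (rule ne)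
      fix e assume e: "e \<in> incident (snd (l ! i))" "e \<in> bd W"
      then obtain k where k: "k < n" "e = pos_edge (l ! k)" using W ex by blast
      then have "fst (l ! k) = fst (l ! j) \<or> snd (l ! k) = snd (l ! i)" using e inc ji by auto
      then have "k = j \<or> k = i"
        using inj_nth[OF df, of k j] inj_nth[OF d, of k i] i j k(1) by argo
      then show "e = pos_edge (l ! i) \<or> e = pos_edge (l ! j)" using k by auto
    qed
    then show ?thesis by (simp add: P_def j_def)
  qed
  have all: "i < n \<Longrightarrow> P i \<longleftrightarrow> P 0" for i
  proof (induction i)
    case (Suc i)
    then show ?case using step[of i] by simp
  qed simp
  have *: "e \<in> bd W \<longleftrightarrow> P 0" if "e \<in> pos_edge ` set l" for e
    using ex[OF that] all unfolding P_def by auto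
  show ?thesis
  proof (cases "P 0")
    case True
    then have "pos_edge ` set l \<subseteq> bd W" using * by blast
    then show ?thesis using W by auto
  next
    case False
    then have "bd W \<inter> pos_edge ` set l = {}" using * by blast
    then show ?thesis using W by auto
  qed
qed

text \<open>The boundary of \<open>U\<close> is empty or all of the loop, so \<open>U\<close> is
  empty or \<open>B\<close>. Consequently a nonempty set of squares outside \<open>B\<close> always
  has a boundary edge off the loop, through which a square can be integrated out.\<close>

lemma no_cycle_outside:
  assumes "simple_lattice_loop l" "finite B" "bd B = pos_edge ` set l"
    and "finite U" "U \<inter> B = {}" "bd U \<subseteq> pos_edge ` set l"
  shows "U = {}"
proof (rule ccontr)
  assume "U \<noteq> {}"
  then have "bd U = bd B"
    using sub_cycle_of_simple_loop[OF assms(1,6)] bd_nonempty[OF assms(4)] assms(3) by auto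
  then have "U = B" using bd_inj assms by auto
  then show False using assms(5) \<open>U \<noteq> {}\<close> by auto
qed

text \<open>The induction looks into the tail first. The subwalk thus starts at the last vertex that
  is visited again later, and all vertices after it are distinct, which makes \<open>m\<close> free
  of repetitions.\<close>

lemma walk_closed_subwalk:
  assumes "walk u es v" "\<not> distinct (u # map snd es)"
  obtains a m b z where "es = a @ m @ b" "walk u a z" "walk z m z" "walk z b v" "m \<noteq> []"
    "distinct (map snd m)"
proof -
  have "\<exists>a m b z. es = a @ m @ b \<and> walk u a z \<and> walk z m z \<and> walk z b v \<and> m \<noteq> [] \<and> distinct (map snd m)"
    using assms
  proof (induction es arbitrary: u)
    case (Cons e es)
    show ?case
    proof (cases "distinct (snd e # map snd es)")
      case False
      moreover have "walk (snd e) es v" using Cons.prems by simp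
      ultimately obtain a m b z where *: "es = a @ m @ b" "walk (snd e) a z" "walk z m z" "walk z b v" "m \<noteq> []"
        "distinct (map snd m)" using Cons.IH[of "snd e"] by blast
      have "e # es = (e # a) @ m @ b" "walk u (e # a) z" using * Cons.prems by auto
      then show ?thesis using * by blast
    next
      case True
      then have "u \<in> set (map snd (e # es))" using Cons.prems by auto
      then obtain d where d: "u = snd d" "d \<in> set (e # es)" unfolding set_map by (rule imageE)
      then obtain m' b where s: "e # es = m' @ d # b" by (meson split_list)
      then have eq: "e # es = [] @ (m' @ [d]) @ b" by simp
      obtain w where w: "walk u (m' @ [d]) w" "walk w b v"
        using Cons.prems(1) eq walk_append[of u "m' @ [d]" b v] by auto
      have "w = u" using w(1) d(1) unfolding walk_append by auto
      moreover have "distinct (map snd (m' @ [d]))" using True s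
        by (metis distinct_append eq append_Nil list.simps(9) map_append)
      ultimately show ?thesis using eq w
        by (intro exI[of _ "[]"] exI[of _ "m' @ [d]"] exI[of _ b] exI[of _ u]) simp
    qed
  qed auto
  then show thesis using that by blast
qed

text \<open>After a backtrack at step \<open>i\<close> the walk is, two steps later, again at the
  starting point of step \<open>i\<close>. Distinct starting points then force the length to divide
  2, which length at least 3 excludes.\<close>

lemma simple_lattice_loopI:
  assumes "closed_walk m" "distinct (map snd m)" "length m \<ge> 3"
  shows "simple_lattice_loop m"
proof -
  define n where "n = length m"
  have "m ! (Suc i mod n) \<noteq> prod.swap (m ! i)" if i: "i < n" for i
  proof
    define j k where "j = Suc i mod n" and "k = Suc j mod n"
    have jk: "j < n" "k < n" using assms(3)
      unfolding j_def k_def n_def by (intro mod_less_divisor; linarith)+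
    assume "m ! (Suc i mod n) = prod.swap (m ! i)"
    then have "snd (m ! j) = fst (m ! i)" by (simp add: j_def)
    then have "fst (m ! k) = fst (m ! i)"
      using closed_walkD(3)[OF assms(1), of j] jk by (simp add: k_def n_def)
    then have "k = i"
      using closed_walk_distinct_fst[OF assms(1,2)] i jk
      by (metis distinct_conv_nth length_map n_def nth_map)
    then show False using i assms(3) unfolding j_def k_def n_def[symmetric]
      by (cases "Suc i = n"; cases "Suc (Suc i) = n") auto
  qed
  then show ?thesis using assms by (simp add: simple_lattice_loop_def lattice_loop_def n_def)
qed

text \<open>Hypothesis \<open>forest\<close> says that the edges of \<open>m\<close> carry no cycle:
  from length 3 on, \<open>m\<close> would be a simple loop, and the set it bounds would contradict
  it. Length 1 fails because an edge has two different ends.\<close>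

lemma closed_subwalk_in_forest:
  assumes w: "walk z m z" and "m \<noteq> []" and d: "distinct (map snd m)"
    and forest: "\<And>U. finite U \<Longrightarrow> bd U \<subseteq> pos_edge ` set m \<Longrightarrow> U = {}"
  obtains e where "m = [e, prod.swap e]"
proof -
  have cw: "closed_walk m"
    using w \<open>m \<noteq> []\<close> unfolding closed_walk_iff by (cases m) auto
  have "length m < 3"
  proof (rule ccontr)
    assume "\<not> length m < 3"
    then have s: "simple_lattice_loop m" using cw d by (intro simple_lattice_loopI) auto
    then obtain B where B: "finite B" "bd B = pos_edge ` set m" by (rule ex_bd_simple)
    then have "B = {}" using forest by auto
    then show False using B \<open>m \<noteq> []\<close> by auto
  qed
  moreover have "length m \<noteq> 1"
    using w by (auto simp: length_Suc_conv lattice_edge_def)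
  ultimately have "length m = 2" using \<open>m \<noteq> []\<close> by (cases m; cases "tl m") auto
  then obtain e f where m: "m = [e, f]" by (auto simp: length_Suc_conv numeral_2_eq_2)
  then have "f = prod.swap e" using w by (auto simp: prod_eq_iff)
  then show thesis using m that by blast
qed

section \<open>Comparison with the area\<close>

definition square_box :: "site \<Rightarrow> complex set" where
  "square_box s = cbox (site_point s) (site_point (fst s + 1, snd s + 1))"

lemma mem_square_box:
  "z \<in> square_box s \<longleftrightarrow> of_int (fst s) \<le> Re z \<and> Re z \<le> of_int (fst s) + 1 \<and>
     of_int (snd s) \<le> Im z \<and> Im z \<le> of_int (snd s) + 1"
  by (auto simp: square_box_def site_point_def cbox_Complex_eq image_iff complex_eq_iff in_cbox_complex_iff)

lemma mem_open_square:
  "z \<in> box (site_point (x, y)) (site_point (x + 1, y + 1)) \<longleftrightarrow>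
     of_int x < Re z \<and> Re z < of_int x + 1 \<and> of_int y < Im z \<and> Im z < of_int y + 1"
  by (auto simp: site_point_def in_box_complex_iff)

lemma mem_hedge_segment:
  "z \<in> closed_segment (site_point (fst (hedge s))) (site_point (snd (hedge s))) \<longleftrightarrow>
     Im z = of_int (snd s) \<and> of_int (fst s) \<le> Re z \<and> Re z \<le> of_int (fst s) + 1"
  by (auto simp: site_point_def closed_segment_same_Im closed_segment_eq_real_ivl)

lemma mem_vedge_segment:
  "z \<in> closed_segment (site_point (fst (vedge s))) (site_point (snd (vedge s))) \<longleftrightarrow>
     Re z = of_int (fst s) \<and> of_int (snd s) \<le> Im z \<and> Im z \<le> of_int (snd s) + 1"
  by (auto simp: site_point_def closed_segment_same_Re closed_segment_eq_real_ivl)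

lemma segment_swap:
  "closed_segment (site_point (fst (prod.swap e))) (site_point (snd (prod.swap e))) =
   closed_segment (site_point (fst e)) (site_point (snd e))"
  by (simp add: closed_segment_commute)

lemma segment_subset_loop_trace:
  assumes "e \<in> pos_edge ` set l"
  shows "closed_segment (site_point (fst e)) (site_point (snd e)) \<subseteq> loop_trace l"
proof -
  obtain d where d: "d \<in> set l" "e = pos_edge d" using assms by blast
  then have "e = d \<or> e = prod.swap d" by (simp add: pos_edge_def)
  then have "closed_segment (site_point (fst e)) (site_point (snd e)) =
      closed_segment (site_point (fst d)) (site_point (snd d))"
    using segment_swap by blast
  then show ?thesis using d(1) unfolding loop_trace_def by blast
qed

lemma loop_trace_integral:
  assumes "closed_walk l" "z \<in> loop_trace l"
  shows "Re z \<in> \<int> \<or> Im z \<in> \<int>"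
proof -
  obtain e where e: "e \<in> set l" "z \<in> closed_segment (site_point (fst e)) (site_point (snd e))"
    using assms(2) by (auto simp: loop_trace_def)
  have "lattice_edge e" using e(1) closed_walkD(2)[OF assms(1)] by blast
  then show ?thesis
  proof (cases rule: lattice_edge_cases)
    case (1 s)
    then show ?thesis using e(2) mem_hedge_segment by auto
  next
    case (2 s)
    then show ?thesis using e(2) mem_vedge_segment by auto
  next
    case (3 s)
    then show ?thesis using e(2) mem_hedge_segment segment_swap by (metis Ints_of_int)
  next
    case (4 s)
    then show ?thesis using e(2) mem_vedge_segment segment_swap by (metis Ints_of_int)
  qed
qed

lemma adjacent_squares_share_boundary:
  assumes B: "bd B \<subseteq> pos_edge ` set l"
    and s: "s \<in> B" "z \<in> square_box s" and t: "t \<notin> B" "z \<in> square_box t"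
    and adj: "fst s = fst t \<or> snd s = snd t"
  shows "z \<in> loop_trace l"
proof -
  define x y x' y' where "x = fst s" and "y = snd s" and "x' = fst t" and "y' = snd t"
  have st: "s = (x, y)" "t = (x', y')" by (simp_all add: x_def y_def x'_def y'_def)
  have z: "of_int x \<le> Re z" "Re z \<le> of_int x + 1" "of_int y \<le> Im z" "Im z \<le> of_int y + 1"
    "of_int x' \<le> Re z" "Re z \<le> of_int x' + 1" "of_int y' \<le> Im z" "Im z \<le> of_int y' + 1"
    using s(2) t(2) unfolding mem_square_box st by auto
  have dx: "x' \<le> x + 1" "x \<le> x' + 1" "y' \<le> y + 1" "y \<le> y' + 1"
    using z by linarith+
  have "(x, y) \<noteq> (x', y')" using s(1) t(1) st by auto
  then consider "x' = x" "y' = y + 1" | "x' = x" "y' = y - 1" | "x' = x + 1" "y' = y" | "x' = x - 1" "y' = y"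
    using adj dx unfolding st by force
  then show ?thesis
  proof cases
    case 1
    then have "hedge (x, y + 1) \<in> bd B" using s(1) t(1) st by (simp add: hedge_in_bd)
    moreover have "z \<in> closed_segment (site_point (fst (hedge (x, y + 1)))) (site_point (snd (hedge (x, y + 1))))"
      unfolding mem_hedge_segment using z 1 by auto
    ultimately show ?thesis using B segment_subset_loop_trace by blast
  next
    case 2
    then have "hedge (x, y) \<in> bd B" using s(1) t(1) st by (simp add: hedge_in_bd)
    moreover have "z \<in> closed_segment (site_point (fst (hedge (x, y)))) (site_point (snd (hedge (x, y))))"
      unfolding mem_hedge_segment using z 2 by auto
    ultimately show ?thesis using B segment_subset_loop_trace by blast
  next
    case 3
    then have "vedge (x + 1, y) \<in> bd B" using s(1) t(1) st by (simp add: vedge_in_bd)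
    moreover have "z \<in> closed_segment (site_point (fst (vedge (x + 1, y)))) (site_point (snd (vedge (x + 1, y))))"
      unfolding mem_vedge_segment using z 3 by auto
    ultimately show ?thesis using B segment_subset_loop_trace by blast
  next
    case 4
    then have "vedge (x, y) \<in> bd B" using s(1) t(1) st by (simp add: vedge_in_bd)
    moreover have "z \<in> closed_segment (site_point (fst (vedge (x, y)))) (site_point (snd (vedge (x, y))))"
      unfolding mem_vedge_segment using z 4 by auto
    ultimately show ?thesis using B segment_subset_loop_trace by blast
  qed
qed

text \<open>The two squares may touch in a corner only. The square \<open>r\<close> in the column of
  \<open>s\<close> and the row of \<open>t\<close> contains \<open>z\<close> as well; depending on
  whether it belongs to \<open>B\<close>, the separating side is found between \<open>r\<close> and
  \<open>t\<close> or between \<open>s\<close> and \<open>r\<close>.\<close>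

lemma squares_share_boundary:
  assumes B: "bd B \<subseteq> pos_edge ` set l"
    and s: "s \<in> B" "z \<in> square_box s" and t: "t \<notin> B" "z \<in> square_box t"
  shows "z \<in> loop_trace l"
proof -
  define r where "r = (fst s, snd t)"
  have r: "z \<in> square_box r" using s(2) t(2) unfolding mem_square_box r_def by auto
  show ?thesis
  proof (cases "r \<in> B")
    case True
    then show ?thesis using adjacent_squares_share_boundary[OF B _ r t] by (simp add: r_def)
  next
    case False
    then show ?thesis using adjacent_squares_share_boundary[OF B s _ r] by (simp add: r_def)
  qed
qed

lemma closed_square_box [simp]: "closed (square_box s)"
  by (simp add: square_box_def closed_cbox)

text \<open>The union is also taken over the infinite complement of \<open>B\<close>; it is closed
  because the family is locally finite. Squares meeting the unit ball at \<open>z\<close> have their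
  corners in the finite window \<open>F\<close>.\<close>

lemma closed_Union_square_box: "closed (\<Union>s\<in>A. square_box s)"
proof -
  have "open (- (\<Union>s\<in>A. square_box s))"
  proof (subst open_subopen, rule ballI)
    fix z assume z: "z \<in> - (\<Union>s\<in>A. square_box s)"
    define F where "F = A \<inter> ({\<lfloor>Re z\<rfloor> - 2..\<lfloor>Re z\<rfloor> + 2} \<times> {\<lfloor>Im z\<rfloor> - 2..\<lfloor>Im z\<rfloor> + 2})"
    define T where "T = ball z 1 - (\<Union>s\<in>F. square_box s)"
    have "finite F" by (simp add: F_def)
    then have "open T" unfolding T_def by (intro open_Diff closed_UN) auto
    moreover have "z \<in> T" using z by (auto simp: T_def F_def)
    moreover have "T \<subseteq> - (\<Union>s\<in>A. square_box s)"
    proof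
      fix w assume w: "w \<in> T"
      have "\<bar>Re w - Re z\<bar> < 1" "\<bar>Im w - Im z\<bar> < 1"
        using w abs_Re_le_cmod[of "w - z"] abs_Im_le_cmod[of "w - z"]
        by (auto simp: T_def dist_norm norm_minus_commute)
      then have "s \<in> F" if "s \<in> A" "w \<in> square_box s" for s
        using that unfolding F_def mem_square_box by (cases s) (simp; linarith)
      then show "w \<in> - (\<Union>s\<in>A. square_box s)" using w by (auto simp: T_def)
    qed
    ultimately show "\<exists>T. open T \<and> z \<in> T \<and> T \<subseteq> - (\<Union>s\<in>A. square_box s)" by blast
  qed
  then show ?thesis by (simp add: open_closed)
qed

lemma mem_floor_square: "z \<in> square_box (\<lfloor>Re z\<rfloor>, \<lfloor>Im z\<rfloor>)"
  unfolding mem_square_box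
  using floor_correct[of "Re z"] floor_correct[of "Im z"] by (auto simp: less_imp_le)

lemma square_subset_inside:
  assumes l: "closed_walk l" and fin: "finite B" and B: "bd B \<subseteq> pos_edge ` set l" and xy: "(x, y) \<in> B"
  shows "box (site_point (x, y)) (site_point (x + 1, y + 1)) \<subseteq> inside (loop_trace l)"
proof
  fix z assume z: "z \<in> box (site_point (x, y)) (site_point (x + 1, y + 1))"
  have zs: "z \<in> square_box (x, y)" using z unfolding mem_open_square mem_square_box by auto
  have zt: "z \<notin> loop_trace l"
  proof
    assume "z \<in> loop_trace l"
    then consider "Re z \<in> \<int>" | "Im z \<in> \<int>" using loop_trace_integral[OF l] by auto
    then show False
    proof cases
      case 1
      then obtain k where "Re z = of_int k" by (auto elim: Ints_cases)
      then have "real_of_int x < of_int k" "real_of_int k < of_int (x + 1)"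
        using z unfolding mem_open_square by auto
      then show False unfolding of_int_less_iff by linarith
    next
      case 2
      then obtain k where "Im z = of_int k" by (auto elim: Ints_cases)
      then have "real_of_int y < of_int k" "real_of_int k < of_int (y + 1)"
        using z unfolding mem_open_square by auto
      then show False unfolding of_int_less_iff by linarith
    qed
  qed
  \<comment> \<open>The closed sets \<open>K\<close> and \<open>K'\<close> cover the plane and meet
    only on the loop. The component \<open>C\<close> avoids the loop and is connected, so it stays
    in the one that contains \<open>z\<close>, namely the bounded set \<open>K\<close>.\<close>
  define C where "C = connected_component_set (- loop_trace l) z"
  define K where "K = (\<Union>s\<in>B. square_box s)"
  define K' where "K' = (\<Union>s\<in>-B. square_box s)"
  have "closed K" "closed K'" unfolding K_def K'_def by (rule closed_Union_square_box)+
  moreover have "connected C" by (simp add: C_def)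
  moreover have "C \<subseteq> K \<union> K'" using mem_floor_square by (auto simp: K_def K'_def)
  moreover have "K \<inter> K' \<inter> C = {}"
  proof -
    have "w \<in> loop_trace l" if "w \<in> K" "w \<in> K'" for w
      using that squares_share_boundary[OF B] unfolding K_def K'_def by blast
    moreover have "C \<subseteq> - loop_trace l" unfolding C_def by (rule connected_component_subset)
    ultimately show ?thesis by blast
  qed
  ultimately have "K \<inter> C = {} \<or> K' \<inter> C = {}" unfolding connected_closed by blast
  moreover have "z \<in> K \<inter> C" using zs zt xy by (auto simp: K_def C_def)
  ultimately have "C \<subseteq> K" using \<open>C \<subseteq> K \<union> K'\<close> by blast
  moreover have "bounded K" using fin unfolding K_def square_box_def by (intro bounded_UN) auto
  ultimately have "bounded C" by (rule bounded_subset[rotated])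
  then show "z \<in> inside (loop_trace l)" using zt by (simp add: inside_def C_def)
qed

lemma bounded_loop_trace: "bounded (loop_trace l)"
  unfolding loop_trace_def by (auto intro!: bounded_UN compact_imp_bounded)

text \<open>Needed because \<open>card\<close> of an infinite set is 0, which would make
  \<open>loop_area\<close> useless as an upper bound. The centres of the squares lie in the bounded
  inside of the loop.\<close>

lemma finite_loop_squares:
  "finite {(x, y). box (site_point (x, y)) (site_point (x + 1, y + 1)) \<subseteq> inside (loop_trace l)}"
proof -
  have "bounded (inside (loop_trace l))" by (rule bounded_inside[OF bounded_loop_trace])
  then obtain b where b: "\<And>z. z \<in> inside (loop_trace l) \<Longrightarrow> norm z \<le> b" by (auto simp: bounded_iff)
  define m where "m = \<lceil>b\<rceil> + 1"
  have "{(x, y). box (site_point (x, y)) (site_point (x + 1, y + 1)) \<subseteq> inside (loop_trace l)}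
      \<subseteq> {-m..m} \<times> {-m..m}"
  proof clarify
    fix x y assume *: "box (site_point (x, y)) (site_point (x + 1, y + 1)) \<subseteq> inside (loop_trace l)"
    define z where "z = Complex (of_int x + 1/2) (of_int y + 1/2)"
    have "z \<in> box (site_point (x, y)) (site_point (x + 1, y + 1))"
      unfolding mem_open_square z_def by simp
    then have "norm z \<le> b" using * b by blast
    then have "\<bar>of_int x + 1/2\<bar> \<le> b" "\<bar>of_int y + 1/2\<bar> \<le> b"
      using abs_Re_le_cmod[of z] abs_Im_le_cmod[of z] by (auto simp: z_def)
    then show "x \<in> {-m..m} \<and> y \<in> {-m..m}" unfolding m_def by (auto; linarith)
  qed
  then show ?thesis by (rule finite_subset) simp
qed

lemma card_le_loop_area:
  assumes "closed_walk l" "finite B" "bd B \<subseteq> pos_edge ` set l"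
  shows "card B \<le> loop_area l"
  unfolding loop_area_def
  by (rule card_mono[OF finite_loop_squares]) (use square_subset_inside[OF assms] in auto)

section \<open>Special orthogonal matrices\<close>

abbreviation SOc :: "nat \<Rightarrow> real mat set" where "SOc N \<equiv> carrier (SO N)"

lemma mem_SO: "A \<in> SOc N \<longleftrightarrow>
    A \<in> carrier_mat N N \<and> A * transpose_mat A = 1\<^sub>m N \<and> Determinant.det A = 1"
  by (auto simp: SO_def)

lemma SO_carrier_mat: "A \<in> SOc N \<Longrightarrow> A \<in> carrier_mat N N"
  by (simp add: mem_SO)

lemma SO_transpose_mult: "A \<in> SOc N \<Longrightarrow> transpose_mat A * A = 1\<^sub>m N"
  unfolding mem_SO by (intro mat_mult_left_right_inverse[of A N]) auto

lemma SO_mult_transpose: "A \<in> SOc N \<Longrightarrow> A * transpose_mat A = 1\<^sub>m N"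
  unfolding mem_SO by simp

lemma SO_one: "1\<^sub>m N \<in> SOc N"
  by (simp add: mem_SO)

lemma SO_transpose: "A \<in> SOc N \<Longrightarrow> transpose_mat A \<in> SOc N"
  using SO_transpose_mult[of A N] det_transpose[of A N] by (simp add: mem_SO)

lemma SO_mult:
  assumes "A \<in> SOc N" "B \<in> SOc N"
  shows "A * B \<in> SOc N"
proof -
  have A: "A \<in> carrier_mat N N" "transpose_mat A \<in> carrier_mat N N"
    and B: "B \<in> carrier_mat N N" "transpose_mat B \<in> carrier_mat N N"
    using assms by (auto simp: mem_SO)
  have "A * B * transpose_mat (A * B) = A * B * (transpose_mat B * transpose_mat A)"
    using A B by (simp add: transpose_mult)
  also have "\<dots> = A * (B * (transpose_mat B * transpose_mat A))"
    using A B by (intro assoc_mult_mat) auto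
  also have "B * (transpose_mat B * transpose_mat A) = B * transpose_mat B * transpose_mat A"
    using A B by (intro assoc_mult_mat[symmetric]) auto
  also have "\<dots> = transpose_mat A" using A B assms by (simp add: mem_SO)
  finally have "A * B * transpose_mat (A * B) = 1\<^sub>m N" using assms by (simp add: mem_SO)
  moreover have "Determinant.det (A * B) = 1"
    using det_mult[of A N B] A B assms by (simp add: mem_SO)
  ultimately show ?thesis using A B by (simp add: mem_SO)
qed

lemma SO_group: "group (SO N)"
proof (rule groupI)
  fix A assume A: "A \<in> carrier (SO N)"
  show "\<exists>y\<in>carrier (SO N). y \<otimes>\<^bsub>SO N\<^esub> A = \<one>\<^bsub>SO N\<^esub>"
    by (rule bexI[of _ "transpose_mat A"]) (use SO_transpose[OF A] SO_transpose_mult[OF A] in \<open>auto simp: SO_def\<close>)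
  show "\<one>\<^bsub>SO N\<^esub> \<otimes>\<^bsub>SO N\<^esub> A = A" using SO_carrier_mat[OF A] by (simp add: SO_def)
next
  fix A B C assume "A \<in> carrier (SO N)" "B \<in> carrier (SO N)" "C \<in> carrier (SO N)"
  then have "A \<in> carrier_mat N N" "B \<in> carrier_mat N N" "C \<in> carrier_mat N N"
    by (auto intro: SO_carrier_mat)
  then show "A \<otimes>\<^bsub>SO N\<^esub> B \<otimes>\<^bsub>SO N\<^esub> C = A \<otimes>\<^bsub>SO N\<^esub> (B \<otimes>\<^bsub>SO N\<^esub> C)"
    by (simp add: SO_def assoc_mult_mat)
next
  fix A B assume "A \<in> carrier (SO N)" "B \<in> carrier (SO N)"
  then show "A \<otimes>\<^bsub>SO N\<^esub> B \<in> carrier (SO N)" using SO_mult[of A N B] by (simp add: SO_def)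
next
  show "\<one>\<^bsub>SO N\<^esub> \<in> carrier (SO N)" using SO_one[of N] by (simp add: SO_def)
qed

lemma SO_inv: "A \<in> SOc N \<Longrightarrow> m_inv (SO N) A = transpose_mat A"
  by (rule group.inv_equality[OF SO_group])
     (use SO_transpose_mult[of A N] SO_transpose[of A N] in \<open>auto simp: SO_def\<close>)

lemma mult_entry:
  assumes "A \<in> carrier_mat N N" "B \<in> carrier_mat N N" "i < N" "j < N"
  shows "(A * B) $$ (i, j) = (\<Sum>k<N. A $$ (i, k) * B $$ (k, j))"
  using assms by (simp add: scalar_prod_def lessThan_atLeast0)

lemma mat_trace_mult:
  assumes "A \<in> carrier_mat N N" "B \<in> carrier_mat N N"
  shows "mat_trace (A * B) = (\<Sum>i<N. \<Sum>j<N. A $$ (i, j) * B $$ (j, i))"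
  using assms by (simp add: mat_trace_def mult_entry[OF assms] del: index_mult_mat(1))

lemma mat_trace_comm:
  assumes "A \<in> carrier_mat N N" "B \<in> carrier_mat N N"
  shows "mat_trace (A * B) = mat_trace (B * A)"
  unfolding mat_trace_mult[OF assms] mat_trace_mult[OF assms(2,1)]
  by (subst sum.swap) (simp add: mult.commute)

lemma mat_trace_carrier: "A \<in> carrier_mat N N \<Longrightarrow> mat_trace A = (\<Sum>i<N. A $$ (i, i))"
  by (simp add: mat_trace_def)

lemma mat_trace_transpose: "A \<in> carrier_mat N N \<Longrightarrow> mat_trace (transpose_mat A) = mat_trace A"
  by (simp add: mat_trace_def)

lemma mat_trace_one: "mat_trace (1\<^sub>m N) = real N"
  by (simp add: mat_trace_def)

lemma SO_row_norm:
  assumes "A \<in> SOc N" "i < N"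
  shows "(\<Sum>k<N. (A $$ (i, k))\<^sup>2) = 1"
proof -
  have A: "A \<in> carrier_mat N N" using assms(1) by (rule SO_carrier_mat)
  have "(\<Sum>k<N. (A $$ (i, k))\<^sup>2) = (A * transpose_mat A) $$ (i, i)"
    using A assms(2) mult_entry[of A N "transpose_mat A" i i] by (simp add: power2_eq_square)
  then show ?thesis using SO_mult_transpose[OF assms(1)] assms(2) by simp
qed

lemma SO_col_norm:
  assumes "A \<in> SOc N" "i < N"
  shows "(\<Sum>k<N. (A $$ (k, i))\<^sup>2) = 1"
  using SO_row_norm[OF SO_transpose[OF assms(1)] assms(2)] SO_carrier_mat[OF assms(1)] assms(2) by simp

lemma SO_entry_bound:
  assumes "A \<in> SOc N" "i < N" "j < N"
  shows "\<bar>A $$ (i, j)\<bar> \<le> 1"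
proof -
  have "(A $$ (i, j))\<^sup>2 \<le> (\<Sum>k<N. (A $$ (i, k))\<^sup>2)"
    by (rule member_le_sum) (use assms in auto)
  then show ?thesis using SO_row_norm[OF assms(1,2)] by (simp add: abs_square_le_1)
qed

lemma SO_trace_bound:
  assumes "A \<in> SOc N"
  shows "\<bar>mat_trace A\<bar> \<le> real N"
proof -
  have "\<bar>mat_trace A\<bar> \<le> (\<Sum>i<N. \<bar>A $$ (i, i)\<bar>)"
    unfolding mat_trace_carrier[OF SO_carrier_mat[OF assms]] by (rule sum_abs)
  also have "\<dots> \<le> (\<Sum>i<N. 1)" by (rule sum_mono) (use SO_entry_bound[OF assms] in auto)
  finally show ?thesis by simp
qed

section \<open>Rotations in a coordinate plane\<close>

definition plane_rotation :: "nat \<Rightarrow> nat \<Rightarrow> nat \<Rightarrow> real \<Rightarrow> real mat" where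
  "plane_rotation N i j t = mat N N (\<lambda>(a, b).
     if a = i then (if b = i then cos t else if b = j then - sin t else 0)
     else if a = j then (if b = i then sin t else if b = j then cos t else 0)
     else if a = b then 1 else 0)"

lemma plane_rotation_carrier [simp]: "plane_rotation N i j t \<in> carrier_mat N N"
  by (simp add: plane_rotation_def)

lemma sum_two_deltas:
  fixes f :: "nat \<Rightarrow> real"
  assumes "i < N" "j < N" "i \<noteq> j"
  shows "(\<Sum>k<N. (if k = i then p else if k = j then q else 0) * f k) = p * f i + q * f j"
proof -
  have "(\<Sum>k<N. (if k = i then p else if k = j then q else 0) * f k) =
      (\<Sum>k<N. (if k = i then p * f k else 0) + (if k = j then q * f k else 0))"
    by (rule sum.cong) (use assms in auto)
  then show ?thesis using assms by (simp add: sum.distrib)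
qed

lemma plane_rotation_mult:
  assumes X: "X \<in> carrier_mat N N" and ij: "i < N" "j < N" "i \<noteq> j" and ab: "a < N" "b < N"
  shows "(plane_rotation N i j t * X) $$ (a, b) =
    (if a = i then cos t * X $$ (i, b) - sin t * X $$ (j, b)
     else if a = j then sin t * X $$ (i, b) + cos t * X $$ (j, b) else X $$ (a, b))"
proof -
  have "(plane_rotation N i j t * X) $$ (a, b) = (\<Sum>k<N. plane_rotation N i j t $$ (a, k) * X $$ (k, b))"
    by (rule mult_entry) (use X ab in auto)
  also have "\<dots> = (\<Sum>k<N. (if a = i then (if k = i then cos t else if k = j then - sin t else 0)
     else if a = j then (if k = i then sin t else if k = j then cos t else 0)
     else if a = k then 1 else 0) * X $$ (k, b))"
    by (rule sum.cong) (use ab in \<open>auto simp: plane_rotation_def\<close>)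
  also have "\<dots> = (if a = i then cos t * X $$ (i, b) - sin t * X $$ (j, b)
     else if a = j then sin t * X $$ (i, b) + cos t * X $$ (j, b) else X $$ (a, b))"
  proof -
    have "(\<Sum>k<N. (if a = k then 1 else 0) * X $$ (k, b)) = (\<Sum>k<N. if a = k then X $$ (k, b) else 0)"
      by (rule sum.cong) auto
    then show ?thesis using ab by (simp add: sum_two_deltas[OF ij])
  qed
  finally show ?thesis .
qed

lemma plane_rotation_entry:
  assumes "a < N" "b < N"
  shows "plane_rotation N i j t $$ (a, b) =
    (if a = i then (if b = i then cos t else if b = j then - sin t else 0)
     else if a = j then (if b = i then sin t else if b = j then cos t else 0)
     else if a = b then 1 else 0)"
  using assms by (simp add: plane_rotation_def)

text \<open>Orthogonality leaves determinant 1 or -1; since the rotation is the square of the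
  rotation by half the angle, its determinant is a square and thus 1.\<close>

lemma plane_rotation_SO:
  assumes ij: "i < N" "j < N" "i \<noteq> j"
  shows "plane_rotation N i j t \<in> SOc N"
proof -
  have orth: "plane_rotation N i j t * transpose_mat (plane_rotation N i j t) = 1\<^sub>m N" for t
  proof (rule eq_matI)
    fix a b assume "a < dim_row (1\<^sub>m N)" "b < dim_col (1\<^sub>m N :: real mat)"
    then have ab: "a < N" "b < N" by auto
    have tr: "transpose_mat (plane_rotation N i j t) $$ (c, d) = plane_rotation N i j t $$ (d, c)"
      if "c < N" "d < N" for c d
      using that ab by (simp add: plane_rotation_def)
    have sc: "(cos t)\<^sup>2 + (sin t)\<^sup>2 = 1" by (simp add: add.commute)
    show "(plane_rotation N i j t * transpose_mat (plane_rotation N i j t)) $$ (a, b) = 1\<^sub>m N $$ (a, b)"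
      using ab ij sc
      by (subst plane_rotation_mult) (auto simp: tr plane_rotation_entry power2_eq_square algebra_simps)
  qed (auto simp: plane_rotation_def)
  have double: "plane_rotation N i j t = plane_rotation N i j (t/2) * plane_rotation N i j (t/2)"
  proof (rule eq_matI)
    fix a b assume "a < dim_row (plane_rotation N i j (t/2) * plane_rotation N i j (t/2))"
      "b < dim_col (plane_rotation N i j (t/2) * plane_rotation N i j (t/2))"
    then have ab: "a < N" "b < N" by (auto simp: plane_rotation_def)
    have c: "cos t = cos (t/2) * cos (t/2) - sin (t/2) * sin (t/2)" using cos_add[of "t/2" "t/2"] by simp
    have s: "sin t = sin (t/2) * cos (t/2) + cos (t/2) * sin (t/2)" using sin_add[of "t/2" "t/2"] by simp
    show "plane_rotation N i j t $$ (a, b) = (plane_rotation N i j (t/2) * plane_rotation N i j (t/2)) $$ (a, b)"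
      using ab ij
      by (subst plane_rotation_mult) (auto simp: plane_rotation_entry c s algebra_simps)
  qed (auto simp: plane_rotation_def)
  have "Determinant.det (plane_rotation N i j (t/2)) * Determinant.det (plane_rotation N i j (t/2)) = 1"
    using arg_cong[OF orth[of "t/2"], of Determinant.det]
      det_mult[of "plane_rotation N i j (t/2)" N "transpose_mat (plane_rotation N i j (t/2))"]
      det_transpose[of "plane_rotation N i j (t/2)" N] by simp
  then have "Determinant.det (plane_rotation N i j t) = 1"
    unfolding double by (subst det_mult[of _ N]) auto
  then show ?thesis using orth by (simp add: mem_SO)
qed

section \<open>Measurability is tested on matrix entries\<close>

lemma measurable_into_SO:
  assumes "sets M = sets (SO_borel N)"
    and "\<And>x. x \<in> space L \<Longrightarrow> g x \<in> SOc N"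
    and "\<And>i j. i < N \<Longrightarrow> j < N \<Longrightarrow> (\<lambda>x. g x $$ (i, j)) \<in> borel_measurable L"
  shows "g \<in> measurable L M"
proof -
  have "g \<in> measurable L (SO_borel N)"
    unfolding SO_borel_def
    by (rule measurable_vimage_algebra2) (auto intro!: assms measurable_restrict)
  then show ?thesis using measurable_cong_sets[OF refl assms(1)] by blast
qed

lemma measurable_SO_entry:
  assumes "sets M = sets (SO_borel N)" "i < N" "j < N"
  shows "(\<lambda>A. A $$ (i, j)) \<in> borel_measurable M"
proof -
  let ?f = "\<lambda>A::real mat. restrict (\<lambda>ij. A $$ ij) ({..<N} \<times> {..<N})"
  have "?f \<in> measurable (SO_borel N) (PiM ({..<N} \<times> {..<N}) (\<lambda>_. borel))"
    unfolding SO_borel_def by (rule measurable_vimage_algebra1) (auto simp: space_PiM)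
  then have "(\<lambda>A. ?f A (i, j)) \<in> borel_measurable (SO_borel N)"
    by (rule measurable_compose[OF _ measurable_component_singleton]) (use assms in auto)
  then have "(\<lambda>A. A $$ (i, j)) \<in> borel_measurable (SO_borel N)" using assms by simp
  then show ?thesis using measurable_cong_sets[OF assms(1) refl] by blast
qed

section \<open>Haar measure\<close>

locale haar_SO =
  fixes N :: nat and M :: "real mat measure"
  assumes haar: "SO_haar N M"
begin

sublocale prob_space M
  using haar by (simp add: SO_haar_def)

lemma sets_M: "sets M = sets (SO_borel N)"
  using haar by (simp add: SO_haar_def)

lemma space_M: "space M = SOc N"
  using sets_eq_imp_space_eq[OF sets_M] by (simp add: SO_borel_def)

lemmas entry_measurable = measurable_SO_entry[OF sets_M]
lemmas into_measurable = measurable_into_SO[OF sets_M]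

lemma mult_measurable:
  assumes "g \<in> measurable L M" "h \<in> measurable L M"
  shows "(\<lambda>x. g x * h x) \<in> measurable L M"
proof (rule into_measurable)
  have gx: "g x \<in> SOc N" and hx: "h x \<in> SOc N" if "x \<in> space L" for x
    using that measurable_space[OF assms(1)] measurable_space[OF assms(2)] space_M by auto
  then show "g x * h x \<in> SOc N" if "x \<in> space L" for x using that SO_mult by blast
  fix i j assume ij: "i < N" "j < N"
  have "(\<lambda>x. \<Sum>k<N. g x $$ (i, k) * h x $$ (k, j)) \<in> borel_measurable L"
    using ij by (intro borel_measurable_sum borel_measurable_times
      measurable_compose[OF assms(1) entry_measurable] measurable_compose[OF assms(2) entry_measurable]) auto
  moreover have "(g x * h x) $$ (i, j) = (\<Sum>k<N. g x $$ (i, k) * h x $$ (k, j))" if "x \<in> space L" for x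
    using mult_entry[OF SO_carrier_mat[OF gx[OF that]] SO_carrier_mat[OF hx[OF that]] ij] .
  ultimately show "(\<lambda>x. (g x * h x) $$ (i, j)) \<in> borel_measurable L"
    by (subst measurable_cong)
qed

lemma transpose_measurable:
  assumes "g \<in> measurable L M"
  shows "(\<lambda>x. transpose_mat (g x)) \<in> measurable L M"
proof (rule into_measurable)
  have gx: "g x \<in> SOc N" if "x \<in> space L" for x
    using that measurable_space[OF assms(1)] space_M by auto
  then show "transpose_mat (g x) \<in> SOc N" if "x \<in> space L" for x using that SO_transpose by blast
  fix i j assume ij: "i < N" "j < N"
  have "(\<lambda>x. g x $$ (j, i)) \<in> borel_measurable L"
    using ij by (intro measurable_compose[OF assms(1) entry_measurable])
  moreover have "transpose_mat (g x) $$ (i, j) = g x $$ (j, i)" if "x \<in> space L" for x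
    using SO_carrier_mat[OF gx[OF that]] ij by simp
  ultimately show "(\<lambda>x. transpose_mat (g x) $$ (i, j)) \<in> borel_measurable L"
    by (subst measurable_cong)
qed

lemma trace_measurable:
  assumes "g \<in> measurable L M"
  shows "(\<lambda>x. mat_trace (g x)) \<in> borel_measurable L"
proof -
  have gx: "g x \<in> SOc N" if "x \<in> space L" for x
    using that measurable_space[OF assms(1)] space_M by auto
  have "(\<lambda>x. \<Sum>k<N. g x $$ (k, k)) \<in> borel_measurable L"
    by (intro borel_measurable_sum measurable_compose[OF assms(1) entry_measurable]) auto
  moreover have "mat_trace (g x) = (\<Sum>k<N. g x $$ (k, k))" if "x \<in> space L" for x
    using mat_trace_carrier[OF SO_carrier_mat[OF gx[OF that]]] .
  ultimately show ?thesis by (subst measurable_cong)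
qed

lemma const_measurable: "A \<in> SOc N \<Longrightarrow> (\<lambda>x. A) \<in> measurable L M"
  by (rule measurable_const) (simp add: space_M)

text \<open>All integrands are polynomials in the entries times exponentials of traces. They are
  bounded on \<open>SOc N\<close>, though not on all matrices, and this class is closed under the
  operations used, so integrability is automatic.\<close>

definition bdd_mb :: "(real mat \<Rightarrow> real) \<Rightarrow> bool" where
  "bdd_mb f \<longleftrightarrow> f \<in> borel_measurable M \<and> (\<exists>C. \<forall>A\<in>SOc N. \<bar>f A\<bar> \<le> C)"

lemma bdd_mbI: "f \<in> borel_measurable M \<Longrightarrow> (\<And>A. A \<in> SOc N \<Longrightarrow> \<bar>f A\<bar> \<le> C) \<Longrightarrow> bdd_mb f"
  by (auto simp: bdd_mb_def)

lemma bdd_mb_measurable: "bdd_mb f \<Longrightarrow> f \<in> borel_measurable M"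
  by (simp add: bdd_mb_def)

lemma bdd_mb_integrable:
  assumes "bdd_mb f"
  shows "integrable M f"
proof -
  obtain C where "\<forall>A\<in>SOc N. \<bar>f A\<bar> \<le> C" using assms by (auto simp: bdd_mb_def)
  then show ?thesis using assms
    by (intro integrable_const_bound[of _ C]) (auto simp: bdd_mb_def space_M)
qed

lemma bdd_mb_const: "bdd_mb (\<lambda>_. c)"
  by (rule bdd_mbI[of _ "\<bar>c\<bar>"]) auto

lemma bdd_mb_entry: "i < N \<Longrightarrow> j < N \<Longrightarrow> bdd_mb (\<lambda>A. A $$ (i, j))"
  by (rule bdd_mbI[of _ 1]) (auto intro: entry_measurable SO_entry_bound)

lemma bdd_mb_mult:
  assumes "bdd_mb f" "bdd_mb g"
  shows "bdd_mb (\<lambda>A. f A * g A)"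
proof -
  obtain C D where *: "\<forall>A\<in>SOc N. \<bar>f A\<bar> \<le> C" "\<forall>A\<in>SOc N. \<bar>g A\<bar> \<le> D"
    using assms by (auto simp: bdd_mb_def)
  show ?thesis
  proof (rule bdd_mbI[of _ "C * D"])
    show "(\<lambda>A. f A * g A) \<in> borel_measurable M" using assms by (auto simp: bdd_mb_def)
    fix A assume "A \<in> SOc N"
    then have "\<bar>f A\<bar> \<le> C" "\<bar>g A\<bar> \<le> D" using * by auto
    then show "\<bar>f A * g A\<bar> \<le> C * D" unfolding abs_mult by (intro mult_mono) auto
  qed
qed

lemma bdd_mb_add:
  assumes "bdd_mb f" "bdd_mb g"
  shows "bdd_mb (\<lambda>A. f A + g A)"
proof -
  obtain C D where *: "\<forall>A\<in>SOc N. \<bar>f A\<bar> \<le> C" "\<forall>A\<in>SOc N. \<bar>g A\<bar> \<le> D"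
    using assms by (auto simp: bdd_mb_def)
  show ?thesis
  proof (rule bdd_mbI[of _ "C + D"])
    show "(\<lambda>A. f A + g A) \<in> borel_measurable M" using assms by (auto simp: bdd_mb_def)
    fix A assume "A \<in> SOc N"
    then have "\<bar>f A\<bar> \<le> C" "\<bar>g A\<bar> \<le> D" using * by auto
    then show "\<bar>f A + g A\<bar> \<le> C + D" by linarith
  qed
qed

lemma bdd_mb_diff:
  assumes "bdd_mb f" "bdd_mb g"
  shows "bdd_mb (\<lambda>A. f A - g A)"
  using bdd_mb_add[OF assms(1) bdd_mb_mult[OF bdd_mb_const[of "-1"] assms(2)]] by simp

lemma bdd_mb_sum: "(\<And>i. i \<in> I \<Longrightarrow> bdd_mb (f i)) \<Longrightarrow> bdd_mb (\<lambda>A. \<Sum>i\<in>I. f i A)"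
proof (induction I rule: infinite_finite_induct)
  case (insert i I)
  then show ?case using bdd_mb_add[of "f i" "\<lambda>A. \<Sum>i\<in>I. f i A"] by simp
qed (auto intro: bdd_mb_const)

lemma bdd_mb_trace: "bdd_mb mat_trace"
  by (rule bdd_mbI[of _ "real N"]) (auto intro: trace_measurable SO_trace_bound)

lemma bdd_mb_exp_trace: "bdd_mb (\<lambda>A. exp (k * mat_trace A))"
proof (rule bdd_mbI[of _ "exp (\<bar>k\<bar> * real N)"])
  show "(\<lambda>A. exp (k * mat_trace A)) \<in> borel_measurable M"
    using bdd_mb_measurable[OF bdd_mb_trace] by measurable
  fix A assume "A \<in> SOc N"
  then have "\<bar>k * mat_trace A\<bar> \<le> \<bar>k\<bar> * real N"
    unfolding abs_mult by (intro mult_left_mono SO_trace_bound) auto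
  then show "\<bar>exp (k * mat_trace A)\<bar> \<le> exp (\<bar>k\<bar> * real N)" by simp
qed

lemma bdd_mb_comp:
  assumes "bdd_mb f" "g \<in> measurable M M"
  shows "bdd_mb (\<lambda>A. f (g A))"
proof -
  obtain C where *: "\<forall>A\<in>SOc N. \<bar>f A\<bar> \<le> C" using assms by (auto simp: bdd_mb_def)
  show ?thesis
  proof (rule bdd_mbI[of _ C])
    show "(\<lambda>A. f (g A)) \<in> borel_measurable M"
      by (rule measurable_compose[OF assms(2) bdd_mb_measurable[OF assms(1)]])
    show "\<bar>f (g A)\<bar> \<le> C" if "A \<in> SOc N" for A
      using that * measurable_space[OF assms(2)] space_M by auto
  qed
qed

section \<open>Invariance under translations and transposition\<close>

lemma integral_left_mult:
  fixes f :: "real mat \<Rightarrow> real"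
  assumes "f \<in> borel_measurable M" "A \<in> SOc N"
  shows "(\<integral>X. f (A * X) \<partial>M) = (\<integral>X. f X \<partial>M)"
proof -
  have "distr M M (\<lambda>X. A * X) = M"
    using haar assms(2) by (simp add: SO_haar_def) (simp add: SO_def)
  moreover have "(\<lambda>X. A * X) \<in> measurable M M"
    by (intro mult_measurable const_measurable assms) simp
  ultimately show ?thesis using integral_distr[of "\<lambda>X. A * X" M M f] assms(1) by simp
qed

text \<open>Both sides equal the integral of \<open>f (X\<^sup>T * Y)\<close> with respect to two independent Haar
  distributed matrices.\<close>

lemma integral_transpose:
  assumes "bdd_mb f"
  shows "(\<integral>X. f (transpose_mat X) \<partial>M) = (\<integral>X. f X \<partial>M)"
proof -
  interpret P: pair_prob_space M M ..
  have mb: "(\<lambda>p. transpose_mat (fst p) * snd p) \<in> measurable (M \<Otimes>\<^sub>M M) M"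
    by (intro mult_measurable transpose_measurable) auto
  obtain C where C: "\<forall>A\<in>SOc N. \<bar>f A\<bar> \<le> C" using assms by (auto simp: bdd_mb_def)
  have int: "integrable (M \<Otimes>\<^sub>M M) (\<lambda>(x, y). f (transpose_mat x * y))"
  proof (rule P.integrable_const_bound[of _ C])
    show "AE x in M \<Otimes>\<^sub>M M. norm (case x of (x, y) \<Rightarrow> f (transpose_mat x * y)) \<le> C"
      using C by (intro AE_I2) (auto simp: space_pair_measure space_M intro: SO_mult SO_transpose)
    show "(\<lambda>(x, y). f (transpose_mat x * y)) \<in> borel_measurable (M \<Otimes>\<^sub>M M)"
      using measurable_compose[OF mb bdd_mb_measurable[OF assms]] by (simp add: case_prod_beta)
  qed
  have 1: "(\<integral>y. f (transpose_mat x * y) \<partial>M) = (\<integral>X. f X \<partial>M)" if "x \<in> space M" for x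
    using integral_left_mult[OF bdd_mb_measurable[OF assms] SO_transpose[of x N]] that space_M by simp
  have 2: "(\<integral>x. f (transpose_mat x * y) \<partial>M) = (\<integral>X. f (transpose_mat X) \<partial>M)" if "y \<in> space M" for y
  proof -
    have y: "y \<in> SOc N" using that space_M by simp
    have "(\<integral>x. f (transpose_mat x * y) \<partial>M) = (\<integral>x. f (transpose_mat (transpose_mat y * x)) \<partial>M)"
    proof (rule Bochner_Integration.integral_cong[OF refl])
      fix x assume "x \<in> space M"
      then have "x \<in> carrier_mat N N" "y \<in> carrier_mat N N" using y space_M SO_carrier_mat by auto
      then show "f (transpose_mat x * y) = f (transpose_mat (transpose_mat y * x))"
        using transpose_mult[of "transpose_mat y" N N x N] by simp
    qed
    also have "\<dots> = (\<integral>X. f (transpose_mat X) \<partial>M)"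
      by (rule integral_left_mult)
         (auto intro!: SO_transpose y measurable_compose[OF _ bdd_mb_measurable[OF assms]] transpose_measurable)
    finally show ?thesis .
  qed
  have "(\<integral>y. \<integral>x. f (transpose_mat x * y) \<partial>M \<partial>M) = (\<integral>x. \<integral>y. f (transpose_mat x * y) \<partial>M \<partial>M)"
    by (rule P.Fubini_integral[OF int])
  moreover have "(\<integral>y. \<integral>x. f (transpose_mat x * y) \<partial>M \<partial>M) = (\<integral>y. (\<integral>X. f (transpose_mat X) \<partial>M) \<partial>M)"
    by (rule Bochner_Integration.integral_cong[OF refl 2])
  moreover have "(\<integral>x. \<integral>y. f (transpose_mat x * y) \<partial>M \<partial>M) = (\<integral>x. (\<integral>X. f X \<partial>M) \<partial>M)"
    by (rule Bochner_Integration.integral_cong[OF refl 1])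
  ultimately show ?thesis by (simp add: prob_space)
qed

text \<open>\<open>SO_haar\<close> asks for left invariance only. Transposition, which is inversion
  on the group, exchanges left and right translations.\<close>

lemma integral_right_mult:
  assumes "bdd_mb f" "A \<in> SOc N"
  shows "(\<integral>X. f (X * A) \<partial>M) = (\<integral>X. f X \<partial>M)"
proof -
  have m: "(\<lambda>X. X * A) \<in> measurable M M"
    by (intro mult_measurable const_measurable assms) simp
  have mt: "(\<lambda>X. transpose_mat X) \<in> measurable M M" by (intro transpose_measurable) simp
  have "(\<integral>X. f (X * A) \<partial>M) = (\<integral>X. f (transpose_mat X * A) \<partial>M)"
    by (rule integral_transpose[symmetric, of "\<lambda>X. f (X * A)"]) (rule bdd_mb_comp[OF assms(1) m])
  also have "\<dots> = (\<integral>X. f (transpose_mat (transpose_mat A * X)) \<partial>M)"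
  proof (rule Bochner_Integration.integral_cong[OF refl])
    fix X assume "X \<in> space M"
    then have "X \<in> carrier_mat N N" "A \<in> carrier_mat N N" using assms space_M SO_carrier_mat by auto
    then show "f (transpose_mat X * A) = f (transpose_mat (transpose_mat A * X))"
      using transpose_mult[of "transpose_mat A" N N X N] by simp
  qed
  also have "\<dots> = (\<integral>X. f (transpose_mat X) \<partial>M)"
    by (rule integral_left_mult[of "\<lambda>X. f (transpose_mat X)"])
       (auto intro!: SO_transpose assms bdd_mb_measurable bdd_mb_comp[OF assms(1) mt])
  also have "\<dots> = (\<integral>X. f X \<partial>M)" by (rule integral_transpose[OF assms(1)])
  finally show ?thesis .
qed

end

section \<open>The single-plaquette measure\<close>

context haar_SO
begin

definition Z :: "real \<Rightarrow> real" where "Z k = (\<integral>X. exp (k * mat_trace X) \<partial>M)"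

definition wt :: "real \<Rightarrow> real mat \<Rightarrow> real" where "wt k X = exp (k * mat_trace X) / Z k"

text \<open>With \<open>k\<close> equal to N \<beta> this is the factor gained for each square of
  \<open>B\<close>.\<close>

definition coef :: "real \<Rightarrow> real" where "coef k = (\<integral>X. mat_trace X * wt k X \<partial>M) / real N"

lemma Z_pos: "Z k > 0"
proof -
  have "Z k \<ge> (\<integral>X. exp (- \<bar>k\<bar> * real N) \<partial>M)"
    unfolding Z_def
  proof (rule integral_mono)
    fix X assume "X \<in> space M"
    then have "\<bar>k * mat_trace X\<bar> \<le> \<bar>k\<bar> * real N"
      unfolding abs_mult by (intro mult_left_mono SO_trace_bound) (auto simp: space_M)
    then show "exp (- \<bar>k\<bar> * real N) \<le> exp (k * mat_trace X)" by simp
  qed (auto intro: bdd_mb_integrable bdd_mb_exp_trace)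
  then show ?thesis by (simp add: prob_space) (smt (verit) exp_gt_zero)
qed

lemma wt_pos: "wt k X > 0"
  by (simp add: wt_def Z_pos)

lemma bdd_mb_wt: "bdd_mb (wt k)"
  using bdd_mb_mult[OF bdd_mb_exp_trace[of k] bdd_mb_const[of "1 / Z k"]] by (simp add: wt_def[abs_def])

lemma integral_wt: "(\<integral>X. wt k X \<partial>M) = 1"
  using Z_pos[of k] by (simp add: wt_def Z_def)

lemma wt_cong: "mat_trace A = mat_trace B \<Longrightarrow> wt k A = wt k B"
  by (simp add: wt_def)

lemma mult_const_measurable: "A \<in> SOc N \<Longrightarrow> (\<lambda>X. A * X) \<in> measurable M M"
  "A \<in> SOc N \<Longrightarrow> (\<lambda>X. X * A) \<in> measurable M M"
  by (intro mult_measurable const_measurable; simp)+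

text \<open>The weight depends on the trace only and is therefore a class function, and Haar measure
  is invariant under translation from both sides.\<close>

lemma integral_conj_wt:
  assumes f: "bdd_mb f" and A: "A \<in> SOc N"
  shows "(\<integral>X. f (A * X * transpose_mat A) * wt k X \<partial>M) = (\<integral>X. f X * wt k X \<partial>M)"
proof -
  let ?g = "\<lambda>X. f X * wt k X"
  have g: "bdd_mb ?g" by (intro bdd_mb_mult f bdd_mb_wt)
  have "(\<integral>X. f (A * X * transpose_mat A) * wt k X \<partial>M) = (\<integral>X. ?g (A * X * transpose_mat A) \<partial>M)"
  proof (rule Bochner_Integration.integral_cong[OF refl])
    fix X assume "X \<in> space M"
    then have X: "X \<in> carrier_mat N N" and A': "A \<in> carrier_mat N N"
      using A space_M SO_carrier_mat by auto
    have "mat_trace (A * X * transpose_mat A) = mat_trace (transpose_mat A * (A * X))"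
      using X A' by (intro mat_trace_comm[of _ N]) auto
    also have "transpose_mat A * (A * X) = transpose_mat A * A * X"
      using X A' by (intro assoc_mult_mat[symmetric]) auto
    finally have "mat_trace (A * X * transpose_mat A) = mat_trace X"
      using SO_transpose_mult[OF A] X by simp
    then show "f (A * X * transpose_mat A) * wt k X = ?g (A * X * transpose_mat A)"
      using wt_cong by metis
  qed
  also have "\<dots> = (\<integral>X. ?g (X * transpose_mat A) \<partial>M)"
    by (rule integral_left_mult[of "\<lambda>X. ?g (X * transpose_mat A)", OF _ A])
       (intro bdd_mb_measurable bdd_mb_comp[OF g] mult_const_measurable SO_transpose A)
  also have "\<dots> = (\<integral>X. ?g X \<partial>M)"
    by (rule integral_right_mult[OF g]) (intro SO_transpose A)
  finally show ?thesis .
qed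

lemma conj_plane_rotation:
  assumes X: "X \<in> carrier_mat N N" and ij: "i < N" "j < N" "i \<noteq> j" and b: "b < N"
  shows "(plane_rotation N i j t * X * transpose_mat (plane_rotation N i j t)) $$ (i, b) =
    cos t * (X * transpose_mat (plane_rotation N i j t)) $$ (i, b)
    - sin t * (X * transpose_mat (plane_rotation N i j t)) $$ (j, b)"
proof -
  have "plane_rotation N i j t * X * transpose_mat (plane_rotation N i j t) =
      plane_rotation N i j t * (X * transpose_mat (plane_rotation N i j t))"
    using X by (intro assoc_mult_mat[of _ N N _ N _ N]) auto
  then show ?thesis using plane_rotation_mult[OF _ ij, of "X * transpose_mat (plane_rotation N i j t)" i b t] X ij b
    by simp
qed

lemma mult_transpose_plane_rotation:
  assumes X: "X \<in> carrier_mat N N" and ij: "i < N" "j < N" "i \<noteq> j" and ab: "a < N" "b < N"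
  shows "(X * transpose_mat (plane_rotation N i j t)) $$ (a, b) =
    (if b = i then cos t * X $$ (a, i) - sin t * X $$ (a, j)
     else if b = j then sin t * X $$ (a, i) + cos t * X $$ (a, j) else X $$ (a, b))"
proof -
  have "X * transpose_mat (plane_rotation N i j t) = transpose_mat (plane_rotation N i j t * transpose_mat X)"
    using transpose_mult[of "plane_rotation N i j t" N N "transpose_mat X" N] X by simp
  moreover have "\<dots> $$ (a, b) = (plane_rotation N i j t * transpose_mat X) $$ (b, a)"
    using ab X plane_rotation_carrier[of N i j t]
    by (intro index_transpose_mat(1)) (auto simp del: plane_rotation_carrier)
  ultimately show ?thesis
    using plane_rotation_mult[OF _ ij ab(2,1), of "transpose_mat X" t] X ij ab by simp
qed

text \<open>A hands-on instance of Schur's lemma: the mean of \<open>X\<close> under a conjugation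
  invariant law is a multiple of the identity. Half turns cancel the off-diagonal entries, and
  quarter turns show that the diagonal ones agree, so each is the N-th part of the mean
  trace.\<close>

lemma integral_entry_wt:
  assumes N: "N \<ge> 3" and ij: "i < N" "j < N"
  shows "(\<integral>X. X $$ (i, j) * wt k X \<partial>M) = (if i = j then coef k else 0)"
proof (cases "i = j")
  case False
  have "\<exists>l. l < N \<and> l \<noteq> i \<and> l \<noteq> j"
  proof -
    have "\<not> {..<N} \<subseteq> {i, j}" using N card_mono[of "{i, j}" "{..<N}"] False by auto
    then show ?thesis by auto
  qed
  then obtain l where l: "l < N" "i \<noteq> l" "l \<noteq> j" by auto
  \<comment> \<open>The half turn changes the sign of the coordinates \<open>i\<close> and
    \<open>l\<close> and of no other. As \<open>l\<close> differs from \<open>j\<close>, the entry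
    (i, j) changes sign under conjugation.\<close>
  let ?R = "plane_rotation N i l pi"
  have "(\<integral>X. X $$ (i, j) * wt k X \<partial>M) = (\<integral>X. (?R * X * transpose_mat ?R) $$ (i, j) * wt k X \<partial>M)"
    by (rule integral_conj_wt[symmetric, OF bdd_mb_entry plane_rotation_SO]) (use ij l in auto)
  also have "\<dots> = (\<integral>X. - (X $$ (i, j) * wt k X) \<partial>M)"
  proof (rule Bochner_Integration.integral_cong[OF refl])
    fix X assume "X \<in> space M"
    then have X: "X \<in> carrier_mat N N" using space_M SO_carrier_mat by auto
    show "(?R * X * transpose_mat ?R) $$ (i, j) * wt k X = - (X $$ (i, j) * wt k X)"
      using conj_plane_rotation[OF X ij(1) l(1,2) ij(2), of pi]
        mult_transpose_plane_rotation[OF X ij(1) l(1,2) ij, of pi] False l by simp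
  qed
  also have "\<dots> = - (\<integral>X. X $$ (i, j) * wt k X \<partial>M)" by simp
  finally show ?thesis using False by simp
next
  case True
  have diag: "(\<integral>X. X $$ (a, a) * wt k X \<partial>M) = (\<integral>X. X $$ (b, b) * wt k X \<partial>M)"
    if ab: "a < N" "b < N" "a \<noteq> b" for a b
  proof -
    let ?R = "plane_rotation N a b (pi / 2)"
    have "(\<integral>X. X $$ (a, a) * wt k X \<partial>M) = (\<integral>X. (?R * X * transpose_mat ?R) $$ (a, a) * wt k X \<partial>M)"
      by (rule integral_conj_wt[symmetric, OF bdd_mb_entry plane_rotation_SO]) (use ab in auto)
    also have "\<dots> = (\<integral>X. X $$ (b, b) * wt k X \<partial>M)"
    proof (rule Bochner_Integration.integral_cong[OF refl])
      fix X assume "X \<in> space M"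
      then have X: "X \<in> carrier_mat N N" using space_M SO_carrier_mat by auto
      show "(?R * X * transpose_mat ?R) $$ (a, a) * wt k X = X $$ (b, b) * wt k X"
        using conj_plane_rotation[OF X ab ab(1), of "pi/2"]
          mult_transpose_plane_rotation[OF X ab ab(2,1), of "pi/2"] by simp
    qed
    finally show ?thesis .
  qed
  have "(\<integral>X. mat_trace X * wt k X \<partial>M) = (\<integral>X. (\<Sum>a<N. X $$ (a, a) * wt k X) \<partial>M)"
    by (rule Bochner_Integration.integral_cong[OF refl])
       (auto simp: space_M mat_trace_carrier[OF SO_carrier_mat] sum_distrib_right)
  also have "\<dots> = (\<Sum>a<N. (\<integral>X. X $$ (a, a) * wt k X \<partial>M))"
    by (rule Bochner_Integration.integral_sum) (auto intro!: bdd_mb_integrable bdd_mb_mult bdd_mb_entry bdd_mb_wt)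
  also have "\<dots> = (\<Sum>a<N. (\<integral>X. X $$ (i, i) * wt k X \<partial>M))"
  proof (rule sum.cong[OF refl])
    fix a assume "a \<in> {..<N}"
    then show "(\<integral>X. X $$ (a, a) * wt k X \<partial>M) = (\<integral>X. X $$ (i, i) * wt k X \<partial>M)"
      using diag[of a i] ij by (cases "a = i") auto
  qed
  finally show ?thesis using True N by (simp add: coef_def)
qed

lemma bdd_mb_trace_mult:
  assumes "A \<in> SOc N" "B \<in> SOc N"
  shows "bdd_mb (\<lambda>X. mat_trace (A * X * B))"
  using bdd_mb_comp[OF bdd_mb_comp[OF bdd_mb_trace mult_const_measurable(2)[OF assms(2)]]
    mult_const_measurable(1)[OF assms(1)]] .

text \<open>This is one flip of the loop: \<open>X\<close> belongs to the edge being integrated,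
  \<open>A\<close> and \<open>B\<close> to the parts of the loop before and after it, and
  \<open>G\<close> to the other three sides of the square. Translation by \<open>G\<close> turns the
  weight into \<open>wt k X\<close>, under which \<open>X\<close> has mean \<open>coef k\<close>
  times the identity.\<close>

lemma integral_trace_wt:
  assumes N: "N \<ge> 3" and ABG: "A \<in> SOc N" "B \<in> SOc N" "G \<in> SOc N"
  shows "(\<integral>X. mat_trace (A * X * B) * wt k (X * transpose_mat G) \<partial>M) = coef k * mat_trace (A * G * B)"
proof -
  have c: "A \<in> carrier_mat N N" "B \<in> carrier_mat N N" "G \<in> carrier_mat N N"
    using ABG SO_carrier_mat by auto
  define K where "K = G * B * A"
  have K: "K \<in> carrier_mat N N" using c by (simp add: K_def)
  let ?f = "\<lambda>X. mat_trace (A * X * B) * wt k (X * transpose_mat G)"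
  have bf: "bdd_mb ?f"
    by (intro bdd_mb_mult bdd_mb_trace_mult ABG bdd_mb_comp[OF bdd_mb_wt] mult_const_measurable SO_transpose)
  have "(\<integral>X. ?f X \<partial>M) = (\<integral>X. ?f (X * G) \<partial>M)"
    by (rule integral_right_mult[symmetric, OF bf ABG(3)])
  also have "\<dots> = (\<integral>X. (\<Sum>i<N. \<Sum>j<N. K $$ (j, i) * (X $$ (i, j) * wt k X)) \<partial>M)"
  proof (rule Bochner_Integration.integral_cong[OF refl])
    fix X assume "X \<in> space M"
    then have X: "X \<in> carrier_mat N N" using space_M SO_carrier_mat by auto
    have 1: "X * G * transpose_mat G = X"
      using assoc_mult_mat[of X N N G N "transpose_mat G" N] X c SO_mult_transpose[OF ABG(3)] by simp
    have "A * (X * G) * B = A * (X * G * B)" using X c by (intro assoc_mult_mat) auto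
    then have "mat_trace (A * (X * G) * B) = mat_trace (X * G * B * A)"
      using mat_trace_comm[of A N "X * G * B"] X c by simp
    also have "X * G * B * A = X * K"
      using X c by (simp add: K_def assoc_mult_mat[of _ N N _ N _ N])
    finally have 2: "mat_trace (A * (X * G) * B) = (\<Sum>i<N. \<Sum>j<N. X $$ (i, j) * K $$ (j, i))"
      using mat_trace_mult[OF X K] by simp
    show "?f (X * G) = (\<Sum>i<N. \<Sum>j<N. K $$ (j, i) * (X $$ (i, j) * wt k X))"
      unfolding 1 2 by (simp add: sum_distrib_left mult_ac)
  qed
  also have "\<dots> = (\<Sum>i<N. \<Sum>j<N. K $$ (j, i) * (\<integral>X. X $$ (i, j) * wt k X \<partial>M))"
    by (subst Bochner_Integration.integral_sum,
        fastforce intro!: bdd_mb_integrable bdd_mb_sum bdd_mb_mult bdd_mb_const bdd_mb_entry bdd_mb_wt,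
        rule sum.cong[OF refl], subst Bochner_Integration.integral_sum,
        fastforce intro!: bdd_mb_integrable bdd_mb_sum bdd_mb_mult bdd_mb_const bdd_mb_entry bdd_mb_wt, simp)
  also have "\<dots> = (\<Sum>i<N. \<Sum>j<N. K $$ (j, i) * (if i = j then coef k else 0))"
    by (intro sum.cong refl arg_cong2[where f = "(*)"] integral_entry_wt N) auto
  also have "\<dots> = (\<Sum>i<N. K $$ (i, i) * coef k)" by (simp add: if_distrib cong: if_cong)
  also have "\<dots> = coef k * mat_trace K" by (simp add: mat_trace_carrier[OF K] sum_distrib_left mult.commute)
  also have "mat_trace K = mat_trace (A * G * B)"
    using mat_trace_comm[of "G * B" N A] c by (simp add: K_def assoc_mult_mat[of A N N G N B N])
  finally show ?thesis .
qed

text \<open>The flip across an edge that the loop traverses against its positive direction.\<close>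

lemma integral_trace_transpose_wt:
  assumes N: "N \<ge> 3" and ABG: "A \<in> SOc N" "B \<in> SOc N" "G \<in> SOc N"
  shows "(\<integral>X. mat_trace (A * transpose_mat X * B) * wt k (transpose_mat X * transpose_mat G) \<partial>M)
     = coef k * mat_trace (A * G * B)"
proof -
  have "bdd_mb (\<lambda>X. mat_trace (A * X * B) * wt k (X * transpose_mat G))"
    by (intro bdd_mb_mult bdd_mb_trace_mult ABG bdd_mb_comp[OF bdd_mb_wt] mult_const_measurable SO_transpose)
  from integral_transpose[OF this] show ?thesis using integral_trace_wt[OF assms] by simp
qed

text \<open>The derivative in \<open>k\<close> would be a variance; here is the version without
  derivatives. Raising \<open>k\<close> to \<open>k'\<close> multiplies the density by a constant
  times \<open>E\<close>, which is increasing in the trace. As (tr X - m) * (E X - exp ((k' - k) *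
  m)) \<ge> 0 and tr X - m has mean 0 at \<open>k\<close>, the mean of the trace at
  \<open>k'\<close> is at least \<open>m\<close>.\<close>

lemma coef_mono:
  assumes "k \<le> k'"
  shows "coef k \<le> coef k'"
proof -
  define m where "m = (\<integral>X. mat_trace X * wt k X \<partial>M)"
  define E where "E X = exp ((k' - k) * mat_trace X)" for X :: "real mat"
  have wE: "wt k X * E X * Z k = wt k' X * Z k'" for X
    using Z_pos[of k] Z_pos[of k'] by (simp add: wt_def E_def exp_add[symmetric] algebra_simps)
  have E: "bdd_mb E" unfolding E_def by (rule bdd_mb_exp_trace)
  note intg = bdd_mb_integrable bdd_mb_diff bdd_mb_mult bdd_mb_trace bdd_mb_const bdd_mb_wt E
  let ?D = "(\<integral>X. (mat_trace X - m) * wt k X * E X \<partial>M)"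
  have "0 = (\<integral>X. (mat_trace X - m) * wt k X * exp ((k' - k) * m) \<partial>M)"
    unfolding left_diff_distrib
    by (simp add: intg integral_wt m_def[symmetric] left_diff_distrib[symmetric])
       (simp add: intg integral_wt m_def[symmetric] left_diff_distrib)
  also have "\<dots> \<le> ?D"
  proof (rule integral_mono)
    fix X assume "X \<in> space M"
    have "(mat_trace X - m) * exp ((k' - k) * m) \<le> (mat_trace X - m) * E X"
    proof (cases "mat_trace X \<ge> m")
      case True
      then show ?thesis using assms unfolding E_def by (intro mult_left_mono) (auto intro: mult_left_mono)
    next
      case False
      then show ?thesis using assms unfolding E_def by (intro mult_left_mono_neg) (auto intro: mult_left_mono)
    qed
    from mult_right_mono[OF this less_imp_le[OF wt_pos[of k X]]]
    show "(mat_trace X - m) * wt k X * exp ((k' - k) * m) \<le> (mat_trace X - m) * wt k X * E X"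
      by (simp only: mult_ac)
  qed (intro intg)+
  finally have "0 \<le> ?D * Z k" using Z_pos[of k] by simp
  also have "?D * Z k = (\<integral>X. (mat_trace X - m) * (wt k X * E X * Z k) \<partial>M)"
    by (simp add: mult.assoc[symmetric])
  also have "\<dots> = (\<integral>X. (mat_trace X * wt k' X) * Z k' - m * wt k' X * Z k' \<partial>M)"
    unfolding wE by (simp add: algebra_simps)
  also have "\<dots> = (\<integral>X. mat_trace X * wt k' X \<partial>M) * Z k' - m * Z k'"
    by (subst Bochner_Integration.integral_diff) (auto intro!: intg simp: integral_wt)
  finally have "m \<le> (\<integral>X. mat_trace X * wt k' X \<partial>M)"
    using Z_pos[of k'] by (simp add: left_diff_distrib[symmetric] zero_le_mult_iff)
  then show ?thesis unfolding coef_def m_def by (intro divide_right_mono) auto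
qed

section \<open>Infinitesimal rotations and the Schwinger-Dyson equation\<close>

lemma trace_plane_rotation_mult:
  assumes X: "X \<in> carrier_mat N N" and ij: "i < N" "j < N" "i \<noteq> j"
  shows "mat_trace (plane_rotation N i j t * X) = mat_trace X
    + (cos t - 1) * (X $$ (i, i) + X $$ (j, j)) + sin t * (X $$ (i, j) - X $$ (j, i))"
proof -
  have "mat_trace (plane_rotation N i j t * X) = (\<Sum>a<N. X $$ (a, a)
      + (if a = i then (cos t - 1) * X $$ (i, i) - sin t * X $$ (j, i) else 0)
      + (if a = j then (cos t - 1) * X $$ (j, j) + sin t * X $$ (i, j) else 0))"
    unfolding mat_trace_carrier[OF mult_carrier_mat[OF plane_rotation_carrier X]]
    by (rule sum.cong) (use plane_rotation_mult[OF X ij] ij in \<open>auto simp: algebra_simps\<close>)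
  then show ?thesis using ij
    by (simp add: sum.distrib mat_trace_carrier[OF X] algebra_simps)
qed

text \<open>The derivative at \<open>t = 0\<close> of the integral of \<open>(X\<^sub>i\<^sub>j - X\<^sub>j\<^sub>i) * exp (k * tr X)\<close>, rotated by the
  angle \<open>t\<close> in the plane of the coordinates \<open>i\<close>, \<open>j\<close>, vanishes by invariance.\<close>

lemma integral_rotation_generator:
  assumes ij: "i < N" "j < N" "i \<noteq> j"
  shows "(\<integral>X. ((X $$ (i, i) + X $$ (j, j)) - k * (X $$ (i, j) - X $$ (j, i))\<^sup>2) * wt k X \<partial>M) = 0"
proof -
  define u v where "u X = X $$ (i, j) - X $$ (j, i)" and "v X = X $$ (i, i) + X $$ (j, j)" for X :: "real mat"
  define h where "h t X = (cos t * u X - sin t * v X) *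
    exp (k * (mat_trace X + (cos t - 1) * v X + sin t * u X))" for t X
  define h' where "h' t X = (- sin t * u X - cos t * v X) *
      exp (k * (mat_trace X + (cos t - 1) * v X + sin t * u X))
    + (cos t * u X - sin t * v X) * (exp (k * (mat_trace X + (cos t - 1) * v X + sin t * u X)) *
      (k * (- sin t * v X + cos t * u X)))" for t X
  \<comment> \<open>On SO(N) both \<open>u X\<close> and \<open>v X\<close> are bounded by 2 in
    absolute value, hence each trigonometric combination in \<open>h'\<close> by 4; this gives 4 + 4
    * 4 * \<bar>k\<bar>. The exponent is \<open>k\<close> times the trace of a rotated
    matrix.\<close>
  define K where "K = (4 + 16 * \<bar>k\<bar>) * exp (\<bar>k\<bar> * real N)"
  define q where "q n X = (h (1 / real (Suc n)) X - h 0 X) / (1 / real (Suc n))" for n X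
  \<comment> \<open>Rotating a matrix rotates the pair (u, v) by the same angle, so
    \<open>h t\<close> is \<open>h 0\<close> after a left translation and its integral does not
    depend on \<open>t\<close>.\<close>
  have h_rot: "h t X = h 0 (plane_rotation N i j t * X)" if "X \<in> carrier_mat N N" for t X
    unfolding h_def u_def v_def trace_plane_rotation_mult[OF that ij]
    using plane_rotation_mult[OF that ij] ij by (simp add: algebra_simps)
  have h_bdd: "bdd_mb (h 0)"
    unfolding h_def u_def v_def using bdd_mb_exp_trace[of k] ij
    by (auto intro!: bdd_mb_mult bdd_mb_diff bdd_mb_entry)
  have h_rot_fun: "bdd_mb (\<lambda>X. h 0 (plane_rotation N i j t * X))" for t
    by (rule bdd_mb_comp[OF h_bdd mult_const_measurable(1)[OF plane_rotation_SO[OF ij]]])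
  have h_mb: "h t \<in> borel_measurable M" for t
    using bdd_mb_measurable[OF h_rot_fun[of t]]
    by (subst measurable_cong[OF h_rot]) (auto simp: space_M SO_carrier_mat)
  have h_int: "integrable M (h t)" for t
    using bdd_mb_integrable[OF h_rot_fun[of t]]
    by (subst Bochner_Integration.integrable_cong[OF refl h_rot]) (auto simp: space_M SO_carrier_mat)
  have h_const: "(\<integral>X. h t X \<partial>M) = (\<integral>X. h 0 X \<partial>M)" for t
  proof -
    have "(\<integral>X. h t X \<partial>M) = (\<integral>X. h 0 (plane_rotation N i j t * X) \<partial>M)"
      by (rule Bochner_Integration.integral_cong[OF refl h_rot]) (auto simp: space_M SO_carrier_mat)
    also have "\<dots> = (\<integral>X. h 0 X \<partial>M)"
      by (rule integral_left_mult[OF bdd_mb_measurable[OF h_bdd] plane_rotation_SO[OF ij]])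
    finally show ?thesis .
  qed
  have deriv: "((\<lambda>t. h t X) has_real_derivative h' t X) (at t)" for t X
    unfolding h_def h'_def by (auto intro!: derivative_eq_intros simp: algebra_simps)
  have bound: "\<bar>h' t X\<bar> \<le> K" if X: "X \<in> SOc N" for t X
  proof -
    have uv: "\<bar>u X\<bar> \<le> 2" "\<bar>v X\<bar> \<le> 2"
      using SO_entry_bound[OF X, of i j] SO_entry_bound[OF X, of j i] SO_entry_bound[OF X, of i i]
        SO_entry_bound[OF X, of j j] ij unfolding u_def v_def by auto
    have sc: "\<bar>sin t * a\<bar> \<le> 2" "\<bar>cos t * a\<bar> \<le> 2" if "\<bar>a\<bar> \<le> 2" for a
      using that mult_mono[of "\<bar>sin t\<bar>" 1 "\<bar>a\<bar>" 2] mult_mono[of "\<bar>cos t\<bar>" 1 "\<bar>a\<bar>" 2]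
      by (auto simp: abs_mult)
    have 4: "\<bar>- sin t * u X - cos t * v X\<bar> \<le> 4" "\<bar>cos t * u X - sin t * v X\<bar> \<le> 4"
      "\<bar>- sin t * v X + cos t * u X\<bar> \<le> 4"
      using sc[OF uv(1)] sc[OF uv(2)] by auto
    define e where "e = exp (k * (mat_trace X + (cos t - 1) * v X + sin t * u X))"
    have "e = exp (k * mat_trace (plane_rotation N i j t * X))"
      unfolding e_def trace_plane_rotation_mult[OF SO_carrier_mat[OF X] ij] u_def v_def ..
    moreover have "\<bar>k * mat_trace (plane_rotation N i j t * X)\<bar> \<le> \<bar>k\<bar> * real N"
      unfolding abs_mult by (intro mult_left_mono SO_trace_bound SO_mult plane_rotation_SO ij X) auto
    ultimately have e: "0 \<le> e" "e \<le> exp (\<bar>k\<bar> * real N)" by auto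
    have "h' t X = ((- sin t * u X - cos t * v X) + (cos t * u X - sin t * v X) * (k * (- sin t * v X + cos t * u X))) * e"
      unfolding h'_def e_def by (simp add: algebra_simps)
    also have "\<bar>\<dots>\<bar> \<le> (4 + 16 * \<bar>k\<bar>) * exp (\<bar>k\<bar> * real N)"
      unfolding abs_mult
    proof (rule mult_mono)
      have "\<bar>(cos t * u X - sin t * v X) * (k * (- sin t * v X + cos t * u X))\<bar> \<le> 4 * (\<bar>k\<bar> * 4)"
        unfolding abs_mult by (intro mult_mono 4) auto
      then show "\<bar>(- sin t * u X - cos t * v X) + (cos t * u X - sin t * v X) * (k * (- sin t * v X + cos t * u X))\<bar> \<le> 4 + 16 * \<bar>k\<bar>"
        using 4(1) by linarith
    qed (use e in auto)
    finally show ?thesis by (simp add: K_def)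
  qed
  \<comment> \<open>The difference quotients \<open>q n\<close> integrate to 0 by invariance. By the
    mean value theorem they are values of \<open>h'\<close> at intermediate angles, hence dominated
    by \<open>K\<close>, and the integral of \<open>h' 0\<close> is 0 as well.\<close>
  have "(\<lambda>n. \<integral>X. q n X \<partial>M) \<longlonglongrightarrow> (\<integral>X. h' 0 X \<partial>M)"
  proof (rule integral_dominated_convergence[where w = "\<lambda>_. K"])
    have "h' 0 = (\<lambda>X. ((k * (X $$ (i, j) - X $$ (j, i)) * (X $$ (i, j) - X $$ (j, i))) - (X $$ (i, i) + X $$ (j, j))) * exp (k * mat_trace X))"
      by (rule ext) (simp add: h'_def u_def v_def algebra_simps)
    then show "h' 0 \<in> borel_measurable M"
      using ij by (auto intro!: bdd_mb_measurable bdd_mb_mult bdd_mb_diff bdd_mb_add bdd_mb_const bdd_mb_entry bdd_mb_exp_trace)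
    show "q n \<in> borel_measurable M" for n
      unfolding q_def using h_mb by measurable
    show "integrable M (\<lambda>_. K)" by simp
    show "AE X in M. (\<lambda>n. q n X) \<longlonglongrightarrow> h' 0 X"
    proof (rule AE_I2)
      fix X
      have "(\<lambda>t. (h t X - h 0 X) / t) \<midarrow>0\<rightarrow> h' 0 X"
        using deriv[of X 0] by (simp add: has_field_derivative_iff)
      moreover have "filterlim (\<lambda>n. 1 / real (Suc n)) (at 0) sequentially"
        unfolding filterlim_at using LIMSEQ_inverse_real_of_nat by (auto simp: inverse_eq_divide)
      ultimately show "(\<lambda>n. q n X) \<longlonglongrightarrow> h' 0 X"
        unfolding q_def by (rule filterlim_compose)
    qed
    show "AE X in M. norm (q n X) \<le> K" for n
    proof (rule AE_I2)
      fix X assume "X \<in> space M"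
      then have X: "X \<in> SOc N" by (simp add: space_M)
      obtain z where "h (1 / real (Suc n)) X - h 0 X = (1 / real (Suc n) - 0) * h' z X"
        using MVT2[of 0 "1 / real (Suc n)" "\<lambda>t. h t X" "\<lambda>t. h' t X"] deriv by auto
      then have "q n X = h' z X" by (simp add: q_def)
      then show "norm (q n X) \<le> K" using bound[OF X] by simp
    qed
  qed
  moreover have "(\<integral>X. q n X \<partial>M) = 0" for n
    unfolding q_def by (simp add: h_int h_const[of "1 / real (Suc n)"] del: of_nat_Suc)
  ultimately have "(\<integral>X. h' 0 X \<partial>M) = 0" by (simp add: LIMSEQ_const_iff)
  moreover have "(v X - k * (u X)\<^sup>2) * wt k X = h' 0 X * (- 1 / Z k)" for X
    using Z_pos[of k] by (simp add: h'_def wt_def field_simps power2_eq_square)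
  ultimately show ?thesis by (simp add: u_def[symmetric] v_def[symmetric])
qed

lemma bdd_mb_trace_square: "bdd_mb (\<lambda>X. mat_trace (X * X))"
proof (rule bdd_mbI[of _ "real N"])
  show "(\<lambda>X. mat_trace (X * X)) \<in> borel_measurable M"
    by (intro trace_measurable mult_measurable) auto
qed (auto intro: SO_trace_bound SO_mult)

text \<open>The rotation identities are summed over all ordered pairs of indices. Rows and columns
  have norm 1, which gives 2 N - 2 tr (X X) for the sum of the squared differences. Pairs with
  \<open>i = j\<close> admit no rotation; they leave twice the trace on the other side, which turns
  N into N - 1.\<close>

lemma schwinger_dyson:
  "(real N - 1) * (\<integral>X. mat_trace X * wt k X \<partial>M) = k * (\<integral>X. (real N - mat_trace (X * X)) * wt k X \<partial>M)"
proof -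
  define g where "g i j X = ((X $$ (i, i) + X $$ (j, j)) - k * (X $$ (i, j) - X $$ (j, i))\<^sup>2) * wt k X" for i j X
  note intg = bdd_mb_integrable bdd_mb_sum bdd_mb_diff bdd_mb_mult bdd_mb_const bdd_mb_trace bdd_mb_trace_square bdd_mb_entry bdd_mb_wt
  have g_bdd: "bdd_mb (g i j)" if "i < N" "j < N" for i j
    unfolding g_def power2_eq_square by (intro intg bdd_mb_add that)
  have "(\<integral>X. (\<Sum>i<N. \<Sum>j<N. g i j X) \<partial>M) = (\<Sum>i<N. \<Sum>j<N. (\<integral>X. g i j X \<partial>M))"
    by (subst Bochner_Integration.integral_sum, force intro!: bdd_mb_integrable bdd_mb_sum g_bdd,
        rule sum.cong[OF refl], subst Bochner_Integration.integral_sum,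
        auto intro!: bdd_mb_integrable g_bdd)
  also have "\<dots> = (\<Sum>i<N. \<Sum>j<N. if j = i then 2 * (\<integral>X. X $$ (i, i) * wt k X \<partial>M) else 0)"
  proof (intro sum.cong refl)
    fix i j assume ij: "i \<in> {..<N}" "j \<in> {..<N}"
    show "(\<integral>X. g i j X \<partial>M) = (if j = i then 2 * (\<integral>X. X $$ (i, i) * wt k X \<partial>M) else 0)"
    proof (cases "j = i")
      case True
      then have "g i j X = 2 * (X $$ (i, i) * wt k X)" for X by (simp add: g_def)
      then show ?thesis using True by simp
    next
      case False
      then show ?thesis unfolding g_def using integral_rotation_generator[of i j k] ij by simp
    qed
  qed
  also have "\<dots> = 2 * (\<Sum>i<N. (\<integral>X. X $$ (i, i) * wt k X \<partial>M))"
    by (simp add: sum_distrib_left)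
  also have "(\<Sum>i<N. (\<integral>X. X $$ (i, i) * wt k X \<partial>M)) = (\<integral>X. (\<Sum>i<N. X $$ (i, i) * wt k X) \<partial>M)"
    by (rule Bochner_Integration.integral_sum[symmetric]) (auto intro!: intg)
  also have "\<dots> = (\<integral>X. mat_trace X * wt k X \<partial>M)"
    by (rule Bochner_Integration.integral_cong[OF refl])
       (auto simp: space_M mat_trace_carrier[OF SO_carrier_mat] sum_distrib_right)
  also have "(\<integral>X. (\<Sum>i<N. \<Sum>j<N. g i j X) \<partial>M) =
      (\<integral>X. 2 * real N * (mat_trace X * wt k X) - 2 * k * ((real N - mat_trace (X * X)) * wt k X) \<partial>M)"
  proof (rule Bochner_Integration.integral_cong[OF refl])
    fix X assume "X \<in> space M"
    then have X: "X \<in> SOc N" by (simp add: space_M)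
    have 1: "(\<Sum>i<N. \<Sum>j<N. X $$ (i, i) + X $$ (j, j)) = 2 * real N * mat_trace X"
      by (simp add: mat_trace_carrier[OF SO_carrier_mat[OF X]] sum.distrib sum_distrib_left[symmetric])
    have "(\<Sum>i<N. \<Sum>j<N. (X $$ (i, j) - X $$ (j, i))\<^sup>2) =
        (\<Sum>i<N. \<Sum>j<N. (X $$ (i, j))\<^sup>2 + (X $$ (j, i))\<^sup>2 - 2 * (X $$ (i, j) * X $$ (j, i)))"
      by (intro sum.cong refl) (simp add: power2_diff)
    also have "\<dots> = (\<Sum>i<N. \<Sum>j<N. (X $$ (i, j))\<^sup>2) + (\<Sum>i<N. \<Sum>j<N. (X $$ (j, i))\<^sup>2)
        - 2 * (\<Sum>i<N. \<Sum>j<N. X $$ (i, j) * X $$ (j, i))"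
      by (simp add: sum.distrib sum_subtractf sum_distrib_left)
    also have "\<dots> = 2 * real N - 2 * mat_trace (X * X)"
      using SO_row_norm[OF X] SO_col_norm[OF X] mat_trace_mult[OF SO_carrier_mat[OF X] SO_carrier_mat[OF X]] by simp
    finally have 2: "(\<Sum>i<N. \<Sum>j<N. (X $$ (i, j) - X $$ (j, i))\<^sup>2) = 2 * real N - 2 * mat_trace (X * X)" .
    have "(\<Sum>i<N. \<Sum>j<N. g i j X) = ((\<Sum>i<N. \<Sum>j<N. X $$ (i, i) + X $$ (j, j))
        - k * (\<Sum>i<N. \<Sum>j<N. (X $$ (i, j) - X $$ (j, i))\<^sup>2)) * wt k X"
      unfolding g_def by (simp only: sum_subtractf sum_distrib_left sum_distrib_right left_diff_distrib)
    then show "(\<Sum>i<N. \<Sum>j<N. g i j X) = 2 * real N * (mat_trace X * wt k X) - 2 * k * ((real N - mat_trace (X * X)) * wt k X)"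
      unfolding 1 2 by (simp add: algebra_simps)
  qed
  also have "\<dots> = 2 * real N * (\<integral>X. mat_trace X * wt k X \<partial>M) - 2 * k * (\<integral>X. (real N - mat_trace (X * X)) * wt k X \<partial>M)"
    by (subst Bochner_Integration.integral_diff) (auto intro!: intg)
  finally show ?thesis by (simp add: algebra_simps)
qed

section \<open>The plaquette traversed twice\<close>

definition coef2 :: "real \<Rightarrow> real" where "coef2 k = (\<integral>X. mat_trace (X * X) * wt k X \<partial>M) / real N"

lemma schwinger_dyson_coef:
  assumes "N > 0"
  shows "(real N - 1) * coef k = k * (1 - coef2 k)"
proof -
  have "(\<integral>X. (real N - mat_trace (X * X)) * wt k X \<partial>M) = real N - (\<integral>X. mat_trace (X * X) * wt k X \<partial>M)"
    unfolding left_diff_distrib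
    by (subst Bochner_Integration.integral_diff)
       (auto intro!: bdd_mb_integrable bdd_mb_mult bdd_mb_trace_square bdd_mb_const bdd_mb_wt simp: integral_wt)
  from schwinger_dyson[of k, unfolded this] show ?thesis
    using assms by (simp add: coef_def coef2_def field_simps)
qed

text \<open>At \<open>k = 0\<close> the law is Haar measure, and the expectation of tr (X X) is 1. A
  half turn applied from the left reverses one of two factors in different rows, so mixed moments
  vanish; a quarter turn moves one row to another, so the squared entries of a column have equal
  means, and these sum to 1.\<close>

lemma coef2_0:
  assumes N: "N \<ge> 3"
  shows "coef2 0 = 1 / real N"
proof -
  define m where "m i j = (\<integral>X. X $$ (i, j) * X $$ (j, i) \<partial>M)" for i j
  have bdd: "bdd_mb (\<lambda>X. X $$ (a, b) * X $$ (c, d))" if "a < N" "b < N" "c < N" "d < N" for a b c d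
    by (intro bdd_mb_mult bdd_mb_entry that)
  have off: "m i j = 0" if ij: "i < N" "j < N" "i \<noteq> j" for i j
  proof -
    have "\<not> {..<N} \<subseteq> {i, j}" using N card_mono[of "{i, j}" "{..<N}"] ij by auto
    then obtain l where l: "l < N" "i \<noteq> l" "l \<noteq> j" by auto
    let ?R = "plane_rotation N i l pi"
    have "m i j = (\<integral>X. (?R * X) $$ (i, j) * (?R * X) $$ (j, i) \<partial>M)"
      unfolding m_def
      by (rule integral_left_mult[symmetric]) (use ij l in \<open>auto intro!: bdd_mb_measurable bdd plane_rotation_SO\<close>)
    also have "\<dots> = (\<integral>X. - (X $$ (i, j) * X $$ (j, i)) \<partial>M)"
    proof (rule Bochner_Integration.integral_cong[OF refl])
      fix X assume "X \<in> space M"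
      then have X: "X \<in> carrier_mat N N" using space_M SO_carrier_mat by auto
      show "(?R * X) $$ (i, j) * (?R * X) $$ (j, i) = - (X $$ (i, j) * X $$ (j, i))"
        using plane_rotation_mult[OF X ij(1) l(1,2), of _ _ pi] ij l by simp
    qed
    also have "\<dots> = - m i j" by (simp add: m_def)
    finally show ?thesis by simp
  qed
  have col: "m i i = (\<integral>X. (X $$ (l, i))\<^sup>2 \<partial>M)" if il: "i < N" "l < N" for i l
  proof (cases "i = l")
    case False
    let ?R = "plane_rotation N i l (pi / 2)"
    have "m i i = (\<integral>X. (?R * X) $$ (i, i) * (?R * X) $$ (i, i) \<partial>M)"
      unfolding m_def
      by (rule integral_left_mult[symmetric]) (use il False in \<open>auto intro!: bdd_mb_measurable bdd plane_rotation_SO\<close>)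
    also have "\<dots> = (\<integral>X. (X $$ (l, i))\<^sup>2 \<partial>M)"
    proof (rule Bochner_Integration.integral_cong[OF refl])
      fix X assume "X \<in> space M"
      then have X: "X \<in> carrier_mat N N" using space_M SO_carrier_mat by auto
      show "(?R * X) $$ (i, i) * (?R * X) $$ (i, i) = (X $$ (l, i))\<^sup>2"
        using plane_rotation_mult[OF X il False il(1) il(1), of "pi/2"] by (simp add: power2_eq_square)
    qed
    finally show ?thesis .
  qed (simp add: m_def power2_eq_square)
  have diag: "m i i = 1 / real N" if i: "i < N" for i
  proof -
    have "real N * m i i = (\<Sum>l<N. m i i)" by simp
    also have "\<dots> = (\<Sum>l<N. (\<integral>X. (X $$ (l, i))\<^sup>2 \<partial>M))"
      by (rule sum.cong) (use col[OF i] in auto)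
    also have "\<dots> = (\<integral>X. (\<Sum>l<N. (X $$ (l, i))\<^sup>2) \<partial>M)"
      unfolding power2_eq_square
      by (rule Bochner_Integration.integral_sum[symmetric]) (use i in \<open>auto intro!: bdd_mb_integrable bdd\<close>)
    also have "\<dots> = (\<integral>X. 1 \<partial>M)"
      by (rule Bochner_Integration.integral_cong[OF refl]) (use i SO_col_norm space_M in auto)
    finally show ?thesis using N by (simp add: prob_space field_simps)
  qed
  have "Z 0 = 1" by (simp add: Z_def prob_space)
  then have "(\<integral>X. mat_trace (X * X) * wt 0 X \<partial>M) = (\<integral>X. (\<Sum>i<N. \<Sum>j<N. X $$ (i, j) * X $$ (j, i)) \<partial>M)"
    by (intro Bochner_Integration.integral_cong refl)
       (auto simp: wt_def space_M mat_trace_mult[OF SO_carrier_mat SO_carrier_mat])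
  also have "\<dots> = (\<Sum>i<N. \<Sum>j<N. m i j)"
    unfolding m_def
    by (subst Bochner_Integration.integral_sum, force intro!: bdd_mb_integrable bdd_mb_sum bdd,
        rule sum.cong[OF refl], subst Bochner_Integration.integral_sum,
        auto intro!: bdd_mb_integrable bdd)
  also have "\<dots> = (\<Sum>i<N. \<Sum>j<N. if j = i then 1 / real N else 0)"
    by (intro sum.cong refl) (use off diag in auto)
  also have "\<dots> = 1" using N by simp
  finally show ?thesis by (simp add: coef2_def)
qed

end

section \<open>Plaquettes and parallel transport\<close>

text \<open>In the lexicographic order (x, y + 1) precedes (x + 1, y), so the positive orientation
  leaves the lower left corner upwards.\<close>

fun square_walk :: "site \<Rightarrow> edge list" where
  "square_walk (x, y) = [vedge (x, y), hedge (x, y + 1), prod.swap (vedge (x + 1, y)), prod.swap (hedge (x, y))]"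

definition square_edges :: "site \<Rightarrow> edge set" where
  "square_edges s = pos_edge ` set (square_walk s)"

definition squares :: "site set \<Rightarrow> site set" where
  "squares \<Lambda> = {(x, y). {(x, y), (x + 1, y), (x, y + 1), (x + 1, y + 1)} \<subseteq> \<Lambda>}"

lemma square_edges_iff:
  assumes "positive_edge e"
  shows "e \<in> square_edges s \<longleftrightarrow> side1 e = s \<or> side2 e = s"
proof (cases s)
  case (Pair x y)
  have "hedge t \<in> square_edges s \<longleftrightarrow> t = (x, y + 1) \<or> t = (x, y)"
    "vedge t \<in> square_edges s \<longleftrightarrow> t = (x + 1, y) \<or> t = (x, y)" for t
    by (auto simp: square_edges_def Pair)
  then have "hedge t \<in> square_edges s \<longleftrightarrow> side1 (hedge t) = s \<or> side2 (hedge t) = s"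
    "vedge t \<in> square_edges s \<longleftrightarrow> side1 (vedge t) = s \<or> side2 (vedge t) = s" for t
    by (cases t; auto simp: Pair)+
  then show ?thesis using assms unfolding positive_edge_cases by blast
qed

lemma square_edges_positive: "e \<in> square_edges s \<Longrightarrow> positive_edge e"
  by (cases s) (auto simp: square_edges_def)

lemma bd_square: "bd {s} = square_edges s"
proof -
  have "side1 (hedge t) \<noteq> side2 (hedge t)" "side1 (vedge t) \<noteq> side2 (vedge t)" for t
    by (simp_all add: prod_eq_iff)
  then have "side1 e \<noteq> side2 e" if "positive_edge e" for e
    using that unfolding positive_edge_cases by metis
  then show ?thesis
    using square_edges_iff square_edges_positive unfolding bd_def by (auto; metis)
qed

lemma walk_square_walk: "walk s (square_walk s) s"
  by (cases s) simp

lemma distinct_square_walk: "distinct (map pos_edge (square_walk s))"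
  by (cases s) simp

lemma simple_loop_square_walk: "simple_lattice_loop (square_walk s)"
  by (rule simple_lattice_loopI; cases s) (use walk_square_walk[of s] in \<open>auto simp: closed_walk_iff\<close>)

lemma square_walk_inj: "inj square_walk"
  by (rule injI) (metis edge_eqs(2) list.inject prod.collapse square_walk.simps)

text \<open>The walk must start at the lower left corner and go to the upper left one, the two
  smallest corners. The next vertex is a neighbour of the second other than the first, and one
  corner remains for the fourth.\<close>

lemma plaquette_unique:
  assumes p: "plaquette p" and l0: "lex_less (fst (p ! 0)) (fst (p ! 1))"
    and l2: "lex_less (fst (p ! 1)) (fst (p ! 2))" and l3: "lex_less (fst (p ! 1)) (fst (p ! 3))"
  shows "p = square_walk (fst (p ! 0))"
proof -
  obtain v0 w0 v1 w1 v2 w2 v3 w3 where pe: "p = [(v0, w0), (v1, w1), (v2, w2), (v3, w3)]"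
  proof -
    have "length p = 4" using p by (simp add: plaquette_def)
    then obtain a b c d where "p = [a, b, c, d]" by (auto simp: eval_nat_numeral length_Suc_conv)
    then show ?thesis using that by (metis prod.collapse)
  qed
  have w: "w0 = v1" "w1 = v2" "w2 = v3" "w3 = v0" and lat: "lattice_edge (v1, v2)"
    using p unfolding plaquette_def closed_walk_iff pe by auto
  obtain x y where xy: "{v0, v1, v2, v3} = {(x, y), (x + 1, y), (x, y + 1), (x + 1, y + 1)}"
    using p unfolding plaquette_def pe by auto
  have less: "lex_less v0 v1" "lex_less v1 v2" "lex_less v1 v3"
    using l0 l2 l3 by (simp_all add: pe)
  have mem: "v \<in> {(x, y), (x + 1, y), (x, y + 1), (x + 1, y + 1)}" if "v \<in> {v0, v1, v2, v3}" for v
    using that xy by simp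
  have ge: "\<not> lex_less v (x, y)" if "v \<in> {v0, v1, v2, v3}" for v
    using mem[OF that] by (auto simp: lex_less_def)
  have "(x, y) \<in> {v0, v1, v2, v3}" using xy by simp
  moreover have "\<not> lex_less v0 (x, y)" by (rule ge) simp
  moreover have "lex_less v0 v2" "lex_less v0 v3" using less by (auto simp: lex_less_def)
  ultimately have v0: "v0 = (x, y)" using less(1) by blast
  have ne: "v1 \<noteq> v0" "v2 \<noteq> v0" "v2 \<noteq> v1" "v3 \<noteq> v1"
    using less by (auto simp: lex_less_def)
  have "(x, y + 1) \<in> {v0, v1, v2, v3}" using xy by simp
  then have v1: "v1 = (x, y + 1)"
    using less mem[of v1] ne(1) v0 by (auto simp: lex_less_def)
  have v2: "v2 = (x + 1, y + 1)"
    using mem[of v2] ne lat v0 v1 by (auto simp: lattice_edge_def)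
  have "(x + 1, y) \<in> {v0, v1, v2, v3}" using xy by simp
  then have v3: "v3 = (x + 1, y)" using v0 v1 v2 by auto
  show ?thesis unfolding pe w v0 v1 v2 v3 by (simp add: hedge_def vedge_def)
qed

lemma positive_plaquettes_eq: "positive_plaquettes \<Lambda> = square_walk ` squares \<Lambda>"
proof (intro subset_antisym subsetI)
  fix p assume p: "p \<in> positive_plaquettes \<Lambda>"
  then have *: "p = square_walk (fst (p ! 0))"
    by (intro plaquette_unique) (auto simp: positive_plaquettes_def)
  obtain x y where xy: "fst (p ! 0) = (x, y)" by fastforce
  have "\<forall>e\<in>set p. fst e \<in> \<Lambda> \<and> snd e \<in> \<Lambda>" using p by (simp add: positive_plaquettes_def)
  moreover have p_eq: "p = square_walk (x, y)" using *[unfolded xy] .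
  ultimately have "(x, y) \<in> squares \<Lambda>" by (auto simp: squares_def)
  then show "p \<in> square_walk ` squares \<Lambda>" using p_eq by blast
next
  fix p assume "p \<in> square_walk ` squares \<Lambda>"
  then obtain x y where p: "p = square_walk (x, y)" and xy: "(x, y) \<in> squares \<Lambda>" by auto
  have "closed_walk p" unfolding p closed_walk_iff using walk_square_walk[of "(x, y)"] by auto
  moreover have "distinct p" using distinct_square_walk[of "(x, y)"] unfolding p distinct_map by blast
  moreover have "fst ` set p = {(x, y), (x + 1, y), (x, y + 1), (x + 1, y + 1)}"
    unfolding p by auto
  ultimately have "plaquette p" unfolding plaquette_def by (auto simp: p)
  then show "p \<in> positive_plaquettes \<Lambda>"
    using xy by (auto simp: positive_plaquettes_def p squares_def lex_less_def)
qed

section \<open>Matrices of paths\<close>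

definition rev_path :: "edge list \<Rightarrow> edge list" where
  "rev_path es = map prod.swap (rev es)"

lemma walk_rev_path: "walk u es v \<Longrightarrow> walk v (rev_path es) u"
  by (induction es arbitrary: u) (auto simp: rev_path_def walk_append)

lemma map_pos_edge_rev_path:
  "\<forall>d\<in>set es. lattice_edge d \<Longrightarrow> map pos_edge (rev_path es) = rev (map pos_edge es)"
  by (induction es) (auto simp: rev_path_def)

locale lattice_haar = haar_SO +
  fixes E :: "edge set"
  assumes finite_E: "finite E" and E_positive: "\<And>e. e \<in> E \<Longrightarrow> positive_edge e"
begin

definition P :: "(edge \<Rightarrow> real mat) measure" where "P = PiM E (\<lambda>_. M)"

text \<open>Points of the product space are \<open>undefined\<close> off \<open>E\<close>, so only
  such lists have matrices known to lie in SO(N).\<close>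

definition edges_ok :: "edge list \<Rightarrow> bool" where
  "edges_ok es \<longleftrightarrow> (\<forall>d\<in>set es. lattice_edge d \<and> pos_edge d \<in> E)"

lemma edges_ok_simps [simp]: "edges_ok []" "edges_ok (d # es) \<longleftrightarrow> lattice_edge d \<and> pos_edge d \<in> E \<and> edges_ok es"
  "edges_ok (a @ b) \<longleftrightarrow> edges_ok a \<and> edges_ok b"
  by (auto simp: edges_ok_def)

lemma edges_ok_iff: "walk u es v \<Longrightarrow> edges_ok es \<longleftrightarrow> pos_edge ` set es \<subseteq> E"
  using walk_lattice by (auto simp: edges_ok_def)

lemma edges_ok_rev_path [simp]: "edges_ok (rev_path es) \<longleftrightarrow> edges_ok es"
  unfolding edges_ok_def rev_path_def by (simp cong: conj_cong)

sublocale Prod: product_prob_space "\<lambda>_::edge. M" E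
  by unfold_locales

sublocale P: prob_space P
  unfolding P_def by (rule Prod.prob_space_axioms)

lemma space_P: "Q \<in> space P \<Longrightarrow> e \<in> E \<Longrightarrow> Q e \<in> SOc N"
  by (auto simp: P_def space_PiM space_M)

lemma edge_matrix_eq:
  assumes "Q \<in> space P" "lattice_edge d" "pos_edge d \<in> E"
  shows "edge_matrix N Q d = (if positive_edge d then Q (pos_edge d) else transpose_mat (Q (pos_edge d)))"
  using assms space_P[OF assms(1,3)] by (simp add: edge_matrix_def pos_edge_def SO_inv split: if_splits)

lemma edge_matrix_SO:
  assumes "Q \<in> space P" "lattice_edge d" "pos_edge d \<in> E"
  shows "edge_matrix N Q d \<in> SOc N"
  using space_P[OF assms(1,3)] SO_transpose[OF space_P[OF assms(1,3)]] unfolding edge_matrix_eq[OF assms]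
  by (cases "positive_edge d") (simp_all only: if_True if_False)

lemma edge_matrix_swap:
  assumes "Q \<in> space P" "lattice_edge d" "pos_edge d \<in> E"
  shows "edge_matrix N Q (prod.swap d) = transpose_mat (edge_matrix N Q d)"
proof -
  have "edge_matrix N Q (prod.swap d) = (if \<not> positive_edge d then Q (pos_edge d) else transpose_mat (Q (pos_edge d)))"
    using edge_matrix_eq[of Q "prod.swap d"] assms by (simp only: lattice_edge_swap positive_edge_swap pos_edge_swap)
  then show ?thesis unfolding edge_matrix_eq[OF assms]
    by (cases "positive_edge d") (simp_all only: if_True if_False not_True_eq_False not_False_eq_True transpose_transpose)
qed

lemma path_matrix_simps [simp]:
  "path_matrix N Q [] = 1\<^sub>m N" "path_matrix N Q (d # es) = edge_matrix N Q d * path_matrix N Q es"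
  by (simp_all add: path_matrix_def)

lemma path_matrix_SO: "Q \<in> space P \<Longrightarrow> edges_ok es \<Longrightarrow> path_matrix N Q es \<in> SOc N"
  by (induction es) (auto intro: SO_one SO_mult edge_matrix_SO)

lemma path_matrix_carrier: "Q \<in> space P \<Longrightarrow> edges_ok es \<Longrightarrow> path_matrix N Q es \<in> carrier_mat N N"
  by (intro SO_carrier_mat path_matrix_SO)

lemma path_matrix_append:
  assumes "Q \<in> space P" "edges_ok a" "edges_ok b"
  shows "path_matrix N Q (a @ b) = path_matrix N Q a * path_matrix N Q b"
  using assms(2)
proof (induction a)
  case Nil
  then show ?case using path_matrix_carrier[OF assms(1,3)] by simp
next
  case (Cons d a)
  then have "edge_matrix N Q d \<in> carrier_mat N N" "path_matrix N Q a \<in> carrier_mat N N"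
    using assms(1) by (auto intro: SO_carrier_mat edge_matrix_SO path_matrix_carrier)
  then show ?case using Cons path_matrix_carrier[OF assms(1,3)] by simp
qed

lemma path_matrix_single: "Q \<in> space P \<Longrightarrow> edges_ok [d] \<Longrightarrow> path_matrix N Q [d] = edge_matrix N Q d"
  by (simp add: right_mult_one_mat[of _ N N] SO_carrier_mat edge_matrix_SO)

lemma path_matrix_rev:
  assumes "Q \<in> space P" "edges_ok es"
  shows "path_matrix N Q (rev_path es) = transpose_mat (path_matrix N Q es)"
  using assms(2)
proof (induction es)
  case (Cons d es)
  then have d: "lattice_edge d" "pos_edge d \<in> E" "edges_ok es" by auto
  have "rev_path (d # es) = rev_path es @ [prod.swap d]" by (simp add: rev_path_def)
  then have "path_matrix N Q (rev_path (d # es)) = path_matrix N Q (rev_path es) * path_matrix N Q [prod.swap d]"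
    using assms(1) d by (simp del: path_matrix_simps add: path_matrix_append)
  also have "\<dots> = transpose_mat (path_matrix N Q es) * transpose_mat (edge_matrix N Q d)"
    using Cons.IH d assms(1) path_matrix_single[of Q "prod.swap d"] edge_matrix_swap[of Q d]
    by (simp del: path_matrix_simps)
  also have "\<dots> = transpose_mat (edge_matrix N Q d * path_matrix N Q es)"
    using transpose_mult[of "edge_matrix N Q d" N N "path_matrix N Q es" N] assms(1) d
    by (simp add: SO_carrier_mat edge_matrix_SO path_matrix_carrier)
  finally show ?case by simp
qed (simp add: rev_path_def)

lemma path_matrix_cong:
  assumes "\<And>d. d \<in> set es \<Longrightarrow> Q (pos_edge d) = Q' (pos_edge d)"
  shows "path_matrix N Q es = path_matrix N Q' es"
  using assms
proof (induction es)
  case (Cons d es)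
  have "Q (pos_edge d) = Q' (pos_edge d)" by (rule Cons.prems) simp
  then have "edge_matrix N Q d = edge_matrix N Q' d"
    unfolding edge_matrix_def pos_edge_def by (simp split: if_splits)
  moreover have "path_matrix N Q es = path_matrix N Q' es" by (rule Cons.IH, rule Cons.prems) simp
  ultimately show ?case by simp
qed simp

lemma path_matrix_upd:
  assumes "e \<notin> pos_edge ` set es"
  shows "path_matrix N (Q(e := q)) es = path_matrix N Q es"
  by (rule path_matrix_cong) (use assms in auto)

lemma upd_space: "Q \<in> space P \<Longrightarrow> e \<in> E \<Longrightarrow> q \<in> SOc N \<Longrightarrow> Q(e := q) \<in> space P"
  by (auto simp: P_def space_PiM space_M PiE_def extensional_def)

lemma path_matrix_measurable:
  assumes "edges_ok es"
  shows "(\<lambda>Q. path_matrix N Q es) \<in> measurable P M"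
  using assms
proof (induction es)
  case Nil
  then show ?case by (simp add: const_measurable SO_one)
next
  case (Cons d es)
  then have d: "lattice_edge d" "pos_edge d \<in> E" by auto
  have Qm: "(\<lambda>Q. Q (pos_edge d)) \<in> measurable P M"
    unfolding P_def using d(2) by measurable
  have "(\<lambda>Q. if positive_edge d then Q (pos_edge d) else transpose_mat (Q (pos_edge d))) \<in> measurable P M"
    using Qm transpose_measurable[OF Qm] by (cases "positive_edge d") auto
  then have "(\<lambda>Q. edge_matrix N Q d) \<in> measurable P M"
    by (subst measurable_cong[OF edge_matrix_eq]) (use d in auto)
  then show ?case using Cons by (auto intro: mult_measurable)
qed

lemma mat_trace_rotate:
  assumes "Q \<in> space P" "edges_ok a" "edges_ok b"
  shows "mat_trace (path_matrix N Q (a @ b)) = mat_trace (path_matrix N Q (b @ a))"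
  unfolding path_matrix_append[OF assms] path_matrix_append[OF assms(1,3,2)]
  by (intro mat_trace_comm[of _ N] path_matrix_carrier assms)

text \<open>The bypass \<open>r\<close> runs from the start to the end of \<open>d\<close> along the
  other three sides. The square walk may pass \<open>d\<close> in either direction; the formula is
  the same in both cases, because a matrix and its transpose, here the inverse, have equal
  trace.\<close>

lemma square_bypass:
  assumes e: "e \<in> square_edges s" and d: "pos_edge d = e" "lattice_edge d"
  obtains r where "walk (fst d) r (snd d)" "distinct (map pos_edge r)"
    "pos_edge ` set r = square_edges s - {e}"
    "\<forall>Q\<in>space P. square_edges s \<subseteq> E \<longrightarrow>
       mat_trace (path_matrix N Q (square_walk s)) = mat_trace (edge_matrix N Q d * transpose_mat (path_matrix N Q r))"
proof -
  obtain d0 where d0: "d0 \<in> set (square_walk s)" "pos_edge d0 = e"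
    using e by (auto simp: square_edges_def)
  obtain a b where ab: "square_walk s = a @ d0 # b" using split_list[OF d0(1)] by blast
  have w: "walk s (a @ d0 # b) s" using walk_square_walk[of s] by (simp add: ab)
  have ld0: "lattice_edge d0" and "walk s a (fst d0)" "walk (snd d0) b s"
    using w unfolding walk_append by auto
  then have wr: "walk (snd d0) (b @ a) (fst d0)" unfolding walk_append by blast
  have dist: "distinct (map pos_edge (b @ a))" "e \<notin> pos_edge ` set (b @ a)"
    using distinct_square_walk[of s] d0(2) by (auto simp: ab)
  have set: "pos_edge ` set (b @ a) = square_edges s - {e}"
    using dist(2) d0(2) unfolding square_edges_def ab by auto
  have lat: "\<forall>d\<in>set (b @ a). lattice_edge d" using walk_lattice[OF wr] by blast
  have tr: "mat_trace (path_matrix N Q (square_walk s)) = mat_trace (edge_matrix N Q d0 * path_matrix N Q (b @ a))"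
    and edges_ok: "edges_ok (b @ a)" "edges_ok [d0]" if Q: "Q \<in> space P" "square_edges s \<subseteq> E" for Q
  proof -
    have "edges_ok (square_walk s)" using edges_ok_iff[OF walk_square_walk] that by (simp add: square_edges_def)
    then have o: "edges_ok a" "edges_ok (d0 # b)" by (auto simp: ab)
    then show "edges_ok (b @ a)" "edges_ok [d0]" by auto
    show "mat_trace (path_matrix N Q (square_walk s)) = mat_trace (edge_matrix N Q d0 * path_matrix N Q (b @ a))"
      unfolding ab mat_trace_rotate[OF Q(1) o] by simp
  qed
  have "d0 = d \<or> d = prod.swap d0"
    using d d0(2) by (metis pos_edge_eq_iff swap_swap)
  then show thesis
  proof
    assume "d0 = d"
    show thesis
    proof (rule that[of "rev_path (b @ a)"])
      show "walk (fst d) (rev_path (b @ a)) (snd d)" using walk_rev_path[OF wr] \<open>d0 = d\<close> by simp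
      show "distinct (map pos_edge (rev_path (b @ a)))"
        unfolding map_pos_edge_rev_path[OF lat] distinct_rev by (rule dist(1))
      have "set (map pos_edge (rev_path (b @ a))) = set (map pos_edge (b @ a))"
        unfolding map_pos_edge_rev_path[OF lat] by (simp only: set_rev)
      then show "pos_edge ` set (rev_path (b @ a)) = square_edges s - {e}"
        using set by (simp only: set_map)
      show "\<forall>Q\<in>space P. square_edges s \<subseteq> E \<longrightarrow> mat_trace (path_matrix N Q (square_walk s)) =
          mat_trace (edge_matrix N Q d * transpose_mat (path_matrix N Q (rev_path (b @ a))))"
        using tr path_matrix_rev edges_ok(1) \<open>d0 = d\<close> by simp
    qed
  next
    assume sw: "d = prod.swap d0"
    show thesis
    proof (rule that[of "b @ a"])
      show "walk (fst d) (b @ a) (snd d)" using wr sw by simp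
      have "mat_trace (path_matrix N Q (square_walk s)) =
          mat_trace (edge_matrix N Q d * transpose_mat (path_matrix N Q (b @ a)))"
        if Q: "Q \<in> space P" "square_edges s \<subseteq> E" for Q
      proof -
        have c: "edge_matrix N Q d0 \<in> carrier_mat N N" "path_matrix N Q (b @ a) \<in> carrier_mat N N"
          using edges_ok[OF Q] Q(1) by (auto intro: SO_carrier_mat edge_matrix_SO path_matrix_carrier)
        have "mat_trace (edge_matrix N Q d0 * path_matrix N Q (b @ a)) =
            mat_trace (transpose_mat (edge_matrix N Q d0 * path_matrix N Q (b @ a)))"
          using c by (intro mat_trace_transpose[symmetric, of _ N]) auto
        also have "\<dots> = mat_trace (transpose_mat (path_matrix N Q (b @ a)) * edge_matrix N Q d)"
          using transpose_mult[OF c] edge_matrix_swap[OF Q(1), of d0] edges_ok[OF Q] by (simp add: sw)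
        also have "\<dots> = mat_trace (edge_matrix N Q d * transpose_mat (path_matrix N Q (b @ a)))"
          using c edge_matrix_swap[OF Q(1), of d0] edges_ok[OF Q] by (intro mat_trace_comm[of _ N]) (auto simp: sw)
        finally show ?thesis using tr[OF Q] by simp
      qed
      then show "\<forall>Q\<in>space P. square_edges s \<subseteq> E \<longrightarrow> mat_trace (path_matrix N Q (square_walk s)) =
          mat_trace (edge_matrix N Q d * transpose_mat (path_matrix N Q (b @ a)))"
        by blast
    qed (rule dist(1) set)+
  qed
qed

end

section \<open>Integrating out edge variables\<close>

context lattice_haar
begin

definition bdd_P :: "((edge \<Rightarrow> real mat) \<Rightarrow> real) \<Rightarrow> bool" where
  "bdd_P F \<longleftrightarrow> F \<in> borel_measurable P \<and> (\<exists>C. \<forall>Q\<in>space P. \<bar>F Q\<bar> \<le> C)"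

lemma bdd_P_integrable: "bdd_P F \<Longrightarrow> integrable P F"
proof -
  assume F: "bdd_P F"
  then obtain C where "\<forall>Q\<in>space P. \<bar>F Q\<bar> \<le> C" by (auto simp: bdd_P_def)
  then show ?thesis using F
    by (intro P.integrable_const_bound[of _ C]) (auto simp: bdd_P_def)
qed

lemma bdd_P_const: "bdd_P (\<lambda>_. c)"
  by (auto simp: bdd_P_def)

lemma bdd_P_mult:
  assumes "bdd_P F" "bdd_P G"
  shows "bdd_P (\<lambda>Q. F Q * G Q)"
proof -
  obtain C D where *: "\<forall>Q\<in>space P. \<bar>F Q\<bar> \<le> C" "\<forall>Q\<in>space P. \<bar>G Q\<bar> \<le> D"
    using assms by (auto simp: bdd_P_def)
  have "\<bar>F Q * G Q\<bar> \<le> C * D" if "Q \<in> space P" for Q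
  proof -
    have "\<bar>F Q\<bar> \<le> C" "\<bar>G Q\<bar> \<le> D" using * that by auto
    then show ?thesis unfolding abs_mult by (intro mult_mono) auto
  qed
  moreover have "(\<lambda>Q. F Q * G Q) \<in> borel_measurable P" using assms by (auto simp: bdd_P_def)
  ultimately show ?thesis by (auto simp: bdd_P_def)
qed

lemma bdd_P_prod: "(\<And>s. s \<in> R \<Longrightarrow> bdd_P (F s)) \<Longrightarrow> bdd_P (\<lambda>Q. \<Prod>s\<in>R. F s Q)"
  by (induction R rule: infinite_finite_induct) (auto intro: bdd_P_const bdd_P_mult)

lemma bdd_P_path:
  assumes "bdd_mb f" "edges_ok es"
  shows "bdd_P (\<lambda>Q. f (path_matrix N Q es))"
proof -
  obtain C where "\<forall>A\<in>SOc N. \<bar>f A\<bar> \<le> C" using assms by (auto simp: bdd_mb_def)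
  then show ?thesis
    unfolding bdd_P_def
    using measurable_compose[OF path_matrix_measurable[OF assms(2)] bdd_mb_measurable[OF assms(1)]]
      path_matrix_SO[OF _ assms(2)] by blast
qed

text \<open>The inner integral no longer depends on the coordinate \<open>e\<close>, so by Fubini
  both sides are integrals over the remaining coordinates. Keeping the full product \<open>P\<close>
  on the right lets successive integrations be chained over one fixed edge set.\<close>

lemma resample:
  assumes e: "e \<in> E" and F: "bdd_P F"
  shows "(\<integral>Q. F Q \<partial>P) = (\<integral>Q. (\<integral>q. F (Q(e := q)) \<partial>M) \<partial>P)"
proof -
  define J where "J = E - {e}"
  have J: "finite J" "e \<notin> J" "E = insert e J" using finite_E e by (auto simp: J_def)
  define G where "G Q = (\<integral>q. F (Q(e := q)) \<partial>M)" for Q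
  obtain C where C: "\<forall>Q\<in>space P. \<bar>F Q\<bar> \<le> C" using F by (auto simp: bdd_P_def)
  have upd: "(\<lambda>p. (fst p)(e := snd p)) \<in> measurable (P \<Otimes>\<^sub>M M) P"
    unfolding P_def by (rule measurable_fun_upd[where J = E]) (use e in auto)
  have Gm: "G \<in> borel_measurable P"
    unfolding G_def
  proof (rule borel_measurable_lebesgue_integral)
    show "(\<lambda>(Q, q). F (Q(e := q))) \<in> borel_measurable (P \<Otimes>\<^sub>M M)"
      using measurable_compose[OF upd, of F borel] F by (simp add: bdd_P_def case_prod_beta)
  qed
  have Fint: "integrable M (\<lambda>q. F (Q(e := q)))" if Q: "Q \<in> space P" for Q
  proof (rule integrable_const_bound[of _ C])
    show "AE q in M. norm (F (Q(e := q))) \<le> C"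
      using C upd_space[OF Q e] by (auto simp: space_M)
    have "(\<lambda>q. (Q, q)) \<in> measurable M (P \<Otimes>\<^sub>M M)" using Q by measurable
    from measurable_compose[OF measurable_compose[OF this upd], of F borel]
    show "(\<lambda>q. F (Q(e := q))) \<in> borel_measurable M" using F by (simp add: bdd_P_def)
  qed
  have "\<bar>G Q\<bar> \<le> C" if Q: "Q \<in> space P" for Q
  proof -
    have "\<bar>G Q\<bar> \<le> (\<integral>q. \<bar>F (Q(e := q))\<bar> \<partial>M)"
      unfolding G_def by (rule integral_abs_bound)
    also have "\<dots> \<le> (\<integral>q. C \<partial>M)"
      using Fint[OF Q] C upd_space[OF Q e] by (intro integral_mono) (auto simp: space_M)
    finally show ?thesis by (simp add: prob_space)
  qed
  with Gm have G: "bdd_P G" by (auto simp: bdd_P_def)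
  have PE: "P = PiM (insert e J) (\<lambda>_. M)" unfolding P_def J(3)[symmetric] by (rule refl)
  have "(\<integral>Q. G Q \<partial>P) = (\<integral>Q. (\<integral>q. G (Q(e := q)) \<partial>M) \<partial>PiM J (\<lambda>_. M))"
    using Prod.product_integral_insert[OF J(1,2), of G] bdd_P_integrable[OF G] unfolding PE by simp
  also have "\<dots> = (\<integral>Q. (\<integral>q. F (Q(e := q)) \<partial>M) \<partial>PiM J (\<lambda>_. M))"
    by (simp add: G_def prob_space)
  also have "\<dots> = (\<integral>Q. F Q \<partial>P)"
    using Prod.product_integral_insert[OF J(1,2), of F] bdd_P_integrable[OF F] unfolding PE by simp
  finally show ?thesis by (simp add: G_def)
qed

text \<open>The factors are normalized separately: a square that is integrated out then leaves no
  constant, and over all squares of a box this is the Gibbs density itself.\<close>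

definition W :: "real \<Rightarrow> site set \<Rightarrow> (edge \<Rightarrow> real mat) \<Rightarrow> real" where
  "W k R Q = (\<Prod>s\<in>R. wt k (path_matrix N Q (square_walk s)))"

lemma edges_ok_square_walk: "square_edges s \<subseteq> E \<Longrightarrow> edges_ok (square_walk s)"
  using edges_ok_iff[OF walk_square_walk] by (simp add: square_edges_def)

lemma bdd_P_W: "(\<And>s. s \<in> R \<Longrightarrow> square_edges s \<subseteq> E) \<Longrightarrow> bdd_P (W k R)"
  unfolding W_def by (intro bdd_P_prod bdd_P_path bdd_mb_wt edges_ok_square_walk)

lemma W_upd:
  assumes "\<And>t. t \<in> R \<Longrightarrow> e \<notin> square_edges t"
  shows "W k R (Q(e := q)) = W k R Q"
  unfolding W_def
  by (rule prod.cong[OF refl], subst path_matrix_upd) (use assms in \<open>auto simp: square_edges_def\<close>)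

lemma W_remove: "finite R \<Longrightarrow> s \<in> R \<Longrightarrow> W k R Q = wt k (path_matrix N Q (square_walk s)) * W k (R - {s}) Q"
  unfolding W_def by (rule prod.remove)

lemma edge_matrix_upd:
  assumes "Q \<in> space P" "q \<in> SOc N" "lattice_edge d" "pos_edge d \<in> E"
  shows "edge_matrix N (Q(pos_edge d := q)) d = (if positive_edge d then q else transpose_mat q)"
  using edge_matrix_eq[OF upd_space[OF assms(1,4,2)] assms(3,4)] by simp

text \<open>The edge variable occurs in the weight of \<open>s\<close> alone, where it is multiplied
  by a matrix of the other sides. By right invariance its integral is that of \<open>wt\<close>,
  namely 1.\<close>

lemma drop_square:
  assumes R: "finite R" "\<And>t. t \<in> R \<Longrightarrow> square_edges t \<subseteq> E" and s: "s \<in> R" "e \<in> square_edges s"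
    and other: "\<And>t. t \<in> R - {s} \<Longrightarrow> e \<notin> square_edges t"
    and F: "bdd_P F" "\<And>Q q. Q \<in> space P \<Longrightarrow> q \<in> SOc N \<Longrightarrow> F (Q(e := q)) = F Q"
  shows "(\<integral>Q. F Q * W k R Q \<partial>P) = (\<integral>Q. F Q * W k (R - {s}) Q \<partial>P)"
proof -
  have e: "e \<in> E" "positive_edge e" using R(2)[OF s(1)] s(2) square_edges_positive by auto
  have pe: "pos_edge e = e" "lattice_edge e" using e(2) positive_imp_lattice by auto
  obtain r where r: "walk (fst e) r (snd e)" "distinct (map pos_edge r)"
    "pos_edge ` set r = square_edges s - {e}"
    "\<forall>Q\<in>space P. square_edges s \<subseteq> E \<longrightarrow>
       mat_trace (path_matrix N Q (square_walk s)) = mat_trace (edge_matrix N Q e * transpose_mat (path_matrix N Q r))"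
    using square_bypass[OF s(2) pe] by blast
  have okr: "edges_ok r" using edges_ok_iff[OF r(1)] r(3) R(2)[OF s(1)] by auto
  have inner: "(\<integral>q. F (Q(e := q)) * W k R (Q(e := q)) \<partial>M) = F Q * W k (R - {s}) Q" if Q: "Q \<in> space P" for Q
  proof -
    have G: "transpose_mat (path_matrix N Q r) \<in> SOc N"
      by (intro SO_transpose path_matrix_SO Q okr)
    have "(\<integral>q. F (Q(e := q)) * W k R (Q(e := q)) \<partial>M) =
        (\<integral>q. F Q * W k (R - {s}) Q * wt k (q * transpose_mat (path_matrix N Q r)) \<partial>M)"
    proof (rule Bochner_Integration.integral_cong[OF refl])
      fix q assume "q \<in> space M"
      then have q: "q \<in> SOc N" by (simp add: space_M)
      have "wt k (path_matrix N (Q(e := q)) (square_walk s)) = wt k (q * transpose_mat (path_matrix N Q r))"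
        using r(4)[rule_format, OF upd_space[OF Q e(1) q] R(2)[OF s(1)]] edge_matrix_upd[OF Q q, of e] e
          path_matrix_upd[of e r Q q] r(3) pe
        by (intro wt_cong) simp
      moreover have "W k (R - {s}) (Q(e := q)) = W k (R - {s}) Q" by (rule W_upd[OF other])
      ultimately show "F (Q(e := q)) * W k R (Q(e := q)) =
          F Q * W k (R - {s}) Q * wt k (q * transpose_mat (path_matrix N Q r))"
        using F(2)[OF Q q] W_remove[OF R(1) s(1)] by simp
    qed
    also have "\<dots> = F Q * W k (R - {s}) Q * (\<integral>q. wt k (q * transpose_mat (path_matrix N Q r)) \<partial>M)"
      by simp
    also have "(\<integral>q. wt k (q * transpose_mat (path_matrix N Q r)) \<partial>M) = 1"
      using integral_right_mult[OF bdd_mb_wt G] integral_wt by simp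
    finally show ?thesis unfolding mult_1_right .
  qed
  have "(\<integral>Q. F Q * W k R Q \<partial>P) = (\<integral>Q. (\<integral>q. F (Q(e := q)) * W k R (Q(e := q)) \<partial>M) \<partial>P)"
    by (rule resample[OF e(1)]) (intro bdd_P_mult F(1) bdd_P_W R(2))
  also have "\<dots> = (\<integral>Q. F Q * W k (R - {s}) Q \<partial>P)"
    by (rule Bochner_Integration.integral_cong[OF refl inner])
  finally show ?thesis .
qed

text \<open>With the other variables fixed, the integrated matrix occurs once in the Wilson loop and
  in one weight only, as in \<open>integral_trace_wt\<close>, or transposed if \<open>d\<close> is
  not positive. The outcome is the loop with \<open>d\<close> replaced by the bypass
  \<open>r\<close>.\<close>

lemma flip_square:
  assumes N: "N \<ge> 3" and R: "finite R" "\<And>t. t \<in> R \<Longrightarrow> square_edges t \<subseteq> E"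
    and s: "s \<in> R" "pos_edge d \<in> square_edges s"
    and other: "\<And>t. t \<in> R - {s} \<Longrightarrow> pos_edge d \<notin> square_edges t"
    and edges_ok: "edges_ok (a @ d # b)" and once: "pos_edge d \<notin> pos_edge ` set a" "pos_edge d \<notin> pos_edge ` set b"
  obtains r where "walk (fst d) r (snd d)" "distinct (map pos_edge r)"
    "pos_edge ` set r = square_edges s - {pos_edge d}"
    "(\<integral>Q. wilson N (a @ d # b) Q * W k R Q \<partial>P) = coef k * (\<integral>Q. wilson N (a @ r @ b) Q * W k (R - {s}) Q \<partial>P)"
proof -
  define e where "e = pos_edge d"
  have ld: "lattice_edge d" and e: "e \<in> E" and okab: "edges_ok a" "edges_ok b" using edges_ok by (auto simp: e_def)
  obtain r where r: "walk (fst d) r (snd d)" "distinct (map pos_edge r)"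
    "pos_edge ` set r = square_edges s - {e}"
    "\<forall>Q\<in>space P. square_edges s \<subseteq> E \<longrightarrow>
       mat_trace (path_matrix N Q (square_walk s)) = mat_trace (edge_matrix N Q d * transpose_mat (path_matrix N Q r))"
    using square_bypass[OF s(2) refl ld] unfolding e_def by blast
  have okr: "edges_ok r" using edges_ok_iff[OF r(1)] r(3) R(2)[OF s(1)] by auto
  have W_eq: "wilson N (a @ c @ b) Q = mat_trace (path_matrix N Q a * path_matrix N Q c * path_matrix N Q b)"
    if "Q \<in> space P" "edges_ok c" for c Q
    using that okab path_matrix_append[of Q a "c @ b"] path_matrix_append[of Q c b]
      assoc_mult_mat[OF path_matrix_carrier[of Q a] path_matrix_carrier[of Q c] path_matrix_carrier[of Q b]]
    by (simp add: wilson_def)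
  have inner: "(\<integral>q. wilson N (a @ d # b) (Q(e := q)) * W k R (Q(e := q)) \<partial>M) =
      coef k * (wilson N (a @ r @ b) Q * W k (R - {s}) Q)" if Q: "Q \<in> space P" for Q
  proof -
    let ?A = "path_matrix N Q a" and ?B = "path_matrix N Q b" and ?G = "path_matrix N Q r"
    let ?t = "\<lambda>q. if positive_edge d then q else transpose_mat q"
    have ABG: "?A \<in> SOc N" "?B \<in> SOc N" "?G \<in> SOc N"
      by (intro path_matrix_SO Q okab okr)+
    have "(\<integral>q. wilson N (a @ d # b) (Q(e := q)) * W k R (Q(e := q)) \<partial>M) =
        (\<integral>q. W k (R - {s}) Q * (mat_trace (?A * ?t q * ?B) * wt k (?t q * transpose_mat ?G)) \<partial>M)"
    proof (rule Bochner_Integration.integral_cong[OF refl])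
      fix q assume "q \<in> space M"
      then have q: "q \<in> SOc N" by (simp add: space_M)
      have u: "Q(e := q) \<in> space P" by (rule upd_space[OF Q e q])
      have em: "edge_matrix N (Q(e := q)) d = ?t q"
        using edge_matrix_upd[OF Q q ld] e by (simp add: e_def)
      have "wilson N (a @ [d] @ b) (Q(e := q)) = mat_trace (?A * ?t q * ?B)"
        unfolding W_eq[OF u, of "[d]", simplified] using W_eq[OF u, of "[d]"] ld e
          path_matrix_upd[of e a Q q] path_matrix_upd[of e b Q q] once path_matrix_single[OF u, of d] em
        by (simp add: e_def del: path_matrix_simps)
      moreover have "wt k (path_matrix N (Q(e := q)) (square_walk s)) = wt k (?t q * transpose_mat ?G)"
        using r(4)[rule_format, OF u R(2)[OF s(1)]] em path_matrix_upd[of e r Q q] r(3)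
        by (intro wt_cong) simp
      moreover have "W k (R - {s}) (Q(e := q)) = W k (R - {s}) Q"
        unfolding e_def by (rule W_upd[OF other])
      ultimately show "wilson N (a @ d # b) (Q(e := q)) * W k R (Q(e := q)) =
          W k (R - {s}) Q * (mat_trace (?A * ?t q * ?B) * wt k (?t q * transpose_mat ?G))"
        using W_remove[OF R(1) s(1)] by simp
    qed
    also have "\<dots> = W k (R - {s}) Q * (\<integral>q. mat_trace (?A * ?t q * ?B) * wt k (?t q * transpose_mat ?G) \<partial>M)"
      by simp
    also have "(\<integral>q. mat_trace (?A * ?t q * ?B) * wt k (?t q * transpose_mat ?G) \<partial>M) = coef k * mat_trace (?A * ?G * ?B)"
      using integral_trace_wt[OF N ABG] integral_trace_transpose_wt[OF N ABG] by (cases "positive_edge d") auto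
    finally show ?thesis by (simp only: W_eq[OF Q okr] mult_ac)
  qed
  have bP: "bdd_P (\<lambda>Q. wilson N (a @ d # b) Q)"
    unfolding wilson_def by (rule bdd_P_path[OF bdd_mb_trace edges_ok])
  have "(\<integral>Q. wilson N (a @ d # b) Q * W k R Q \<partial>P) =
      (\<integral>Q. (\<integral>q. wilson N (a @ d # b) (Q(e := q)) * W k R (Q(e := q)) \<partial>M) \<partial>P)"
    by (rule resample[OF e]) (intro bdd_P_mult bP bdd_P_W R(2))
  also have "\<dots> = (\<integral>Q. coef k * (wilson N (a @ r @ b) Q * W k (R - {s}) Q) \<partial>P)"
    by (rule Bochner_Integration.integral_cong[OF refl inner])
  finally show thesis using that[OF r(1,2)] r(3) by (simp add: e_def)
qed

end

section \<open>Contracting a simple loop\<close>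

context lattice_haar
begin

lemma drop_squares:
  assumes S: "finite S" "B \<subseteq> S" "\<And>t. t \<in> S \<Longrightarrow> square_edges t \<subseteq> E"
    and F: "bdd_P F" "\<And>e Q q. e \<in> E - D \<Longrightarrow> Q \<in> space P \<Longrightarrow> q \<in> SOc N \<Longrightarrow> F (Q(e := q)) = F Q"
    and B: "bd B \<subseteq> D" and D: "\<And>U. finite U \<Longrightarrow> U \<inter> B = {} \<Longrightarrow> bd U \<subseteq> D \<Longrightarrow> U = {}"
  shows "(\<integral>Q. F Q * W k S Q \<partial>P) = (\<integral>Q. F Q * W k B Q \<partial>P)"
  using S
proof (induction "card (S - B)" arbitrary: S)
  case 0
  then have "S = B" by auto
  then show ?case by simp
next
  case (Suc n)
  have fin: "finite (S - B)" using Suc.prems by auto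
  have "S - B \<noteq> {}" using Suc.hyps(2) by (metis card.empty nat.distinct(1))
  then have "\<not> bd (S - B) \<subseteq> D" using D[OF fin] by auto
  then obtain e where e: "e \<in> bd (S - B)" "e \<notin> D" by auto
  have pe: "positive_edge e" using bd_positive[OF e(1)] .
  have "e \<notin> bd B" using e(2) B by auto
  then obtain s where s: "s \<in> S - B" "e \<in> square_edges s" "\<And>t. t \<in> S - {s} \<Longrightarrow> e \<notin> square_edges t"
    using e(1) pe unfolding bd_def square_edges_iff[OF pe] by blast
  have eE: "e \<in> E" using Suc.prems(3)[of s] s by auto
  have "(\<integral>Q. F Q * W k S Q \<partial>P) = (\<integral>Q. F Q * W k (S - {s}) Q \<partial>P)"
    by (rule drop_square[where e = e]) (use Suc.prems s F e(2) eE in auto)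
  also have "\<dots> = (\<integral>Q. F Q * W k B Q \<partial>P)"
  proof (rule Suc.hyps(1))
    have "S - {s} - B = (S - B) - {s}" by auto
    then show "n = card (S - {s} - B)" using Suc.hyps(2) s(1) fin by simp
  qed (use Suc.prems s(1) in auto)
  finally show ?case .
qed

text \<open>A nonempty closed walk in a forest contains a step followed directly by its reversal.
  That pair contributes the identity matrix and can be deleted.\<close>

lemma path_matrix_forest:
  assumes Q: "Q \<in> space P"
  shows "walk u es u \<Longrightarrow> edges_ok es \<Longrightarrow> (\<And>U. finite U \<Longrightarrow> bd U \<subseteq> pos_edge ` set es \<Longrightarrow> U = {}) \<Longrightarrow>
    path_matrix N Q es = 1\<^sub>m N"
proof (induction es rule: length_induct)
  case (1 es)
  show ?case
  proof (cases "es = []")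
    case False
    have "snd (last es) = u" using 1(2) False by (simp add: walk_iff_nth last_conv_nth)
    then have "u \<in> snd ` set es" using last_in_set[OF False] by blast
    then have "\<not> distinct (u # map snd es)" by simp
    then obtain a m b z where d: "es = a @ m @ b" "walk u a z" "walk z m z" "walk z b u" "m \<noteq> []"
      "distinct (map snd m)" by (rule walk_closed_subwalk[OF 1(2)])
    have "U = {}" if "finite U" "bd U \<subseteq> pos_edge ` set m" for U
      by (rule 1(4)) (use that d(1) in auto)
    then obtain e where m: "m = [e, prod.swap e]" by (rule closed_subwalk_in_forest[OF d(3,5,6)])
    have edges_ok: "edges_ok a" "edges_ok m" "edges_ok b" using 1(3) d(1) by auto
    have e: "lattice_edge e" "pos_edge e \<in> E" using edges_ok(2) m by auto
    have "path_matrix N Q m = edge_matrix N Q e * transpose_mat (edge_matrix N Q e)"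
      using path_matrix_append[OF Q, of "[e]" "[prod.swap e]"] path_matrix_single[OF Q] edge_matrix_swap[OF Q e] e
      by (simp add: m del: path_matrix_simps)
    then have "path_matrix N Q m = 1\<^sub>m N" using SO_mult_transpose[OF edge_matrix_SO[OF Q e]] by simp
    then have "path_matrix N Q es = path_matrix N Q (a @ b)"
      using path_matrix_append[OF Q, of a "m @ b"] path_matrix_append[OF Q, of m b] path_matrix_append[OF Q, of a b]
        path_matrix_carrier[OF Q edges_ok(3)] edges_ok by (simp add: d(1))
    also have "\<dots> = 1\<^sub>m N"
    proof (rule 1(1)[rule_format])
      show "length (a @ b) < length es" using d by simp
      show "walk u (a @ b) u" using d(2,4) walk_append by blast
      show "edges_ok (a @ b)" using edges_ok by simp
      show "U = {}" if "finite U" "bd U \<subseteq> pos_edge ` set (a @ b)" for U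
        by (rule 1(4)) (use that d(1) in auto)
    qed
    finally show ?thesis .
  qed simp
qed

text \<open>The loop is contracted by flipping it over the remaining squares one after the other. Each
  flip removes an edge for good; the last hypothesis says that the edges still in use carry no
  cycle beyond those bounding remaining squares, so that the walk left at the end runs in a
  forest.\<close>

lemma contract_loop:
  assumes N: "N \<ge> 3"
  shows "finite R \<Longrightarrow> (\<And>t. t \<in> R \<Longrightarrow> square_edges t \<subseteq> E) \<Longrightarrow> walk u l u \<Longrightarrow> edges_ok l \<Longrightarrow>
    (\<And>e. e \<in> bd R \<Longrightarrow> count_list (map pos_edge l) e = 1) \<Longrightarrow>
    (\<And>e. positive_edge e \<Longrightarrow> side1 e \<in> R \<Longrightarrow> side2 e \<in> R \<Longrightarrow> count_list (map pos_edge l) e = 0) \<Longrightarrow>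
    (\<And>U. finite U \<Longrightarrow> bd U \<subseteq> pos_edge ` set l \<union> (\<Union>t\<in>R. square_edges t) \<Longrightarrow> U \<subseteq> R) \<Longrightarrow>
    (\<integral>Q. wilson N l Q * W k R Q \<partial>P) = coef k ^ card R * real N"
proof (induction "card R" arbitrary: R l)
  case 0
  then have R: "R = {}" by simp
  have "path_matrix N Q l = 1\<^sub>m N" if Q: "Q \<in> space P" for Q
    by (rule path_matrix_forest[OF Q 0(4,5)]) (use 0(8) R in auto)
  then have "(\<integral>Q. wilson N l Q * W k R Q \<partial>P) = (\<integral>Q. real N \<partial>P)"
    by (intro Bochner_Integration.integral_cong refl) (simp add: wilson_def R W_def mat_trace_one)
  then show ?case by (simp add: R P.prob_space)
next
  case (Suc n)
  note R = Suc.prems(1,2) and l = Suc.prems(3,4) and once = Suc.prems(5) and never = Suc.prems(6)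
    and U = Suc.prems(7)
  have "R \<noteq> {}" using Suc.hyps(2) by auto
  \<comment> \<open>Such an edge separates a square \<open>s\<close> in \<open>R\<close> from a
    square \<open>t\<close> outside, and the loop passes it exactly once, as a flip
    requires.\<close>
  then obtain e where e: "e \<in> bd R" using bd_nonempty[OF R(1)] by auto
  have pe: "positive_edge e" using bd_positive[OF e] .
  have "\<exists>s t. s \<in> R \<and> t \<notin> R \<and> {side1 e, side2 e} = {s, t}"
  proof (cases "side1 e \<in> R")
    case True
    then show ?thesis using e unfolding bd_def by (intro exI[of _ "side1 e"] exI[of _ "side2 e"]) simp
  next
    case False
    then show ?thesis using e unfolding bd_def
      by (intro exI[of _ "side2 e"] exI[of _ "side1 e"]) (simp add: insert_commute)
  qed
  then obtain s t where st: "s \<in> R" "t \<notin> R" "{side1 e, side2 e} = {s, t}" by blast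
  have "s \<in> {side1 e, side2 e}" unfolding st(3) by simp
  then have es: "e \<in> square_edges s" using square_edges_iff[OF pe] by auto
  have eother: "e \<notin> square_edges t'" if "t' \<in> R - {s}" for t'
    using st that square_edges_iff[OF pe, of t'] by auto
  have "e \<in> set (map pos_edge l)" using once[OF e] by (metis count_notin zero_neq_one)
  then obtain d where d: "d \<in> set l" "pos_edge d = e" by auto
  obtain a b where ab: "l = a @ d # b" using split_list[OF d(1)] by blast
  have "count_list (map pos_edge a) e = 0" "count_list (map pos_edge b) e = 0"
    using once[OF e] d(2) by (auto simp: ab)
  then have nab: "e \<notin> pos_edge ` set a" "e \<notin> pos_edge ` set b"
    by (simp_all add: count_list_0_iff)
  obtain r where r: "walk (fst d) r (snd d)" "distinct (map pos_edge r)"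
    "pos_edge ` set r = square_edges s - {e}"
    "(\<integral>Q. wilson N (a @ d # b) Q * W k R Q \<partial>P) = coef k * (\<integral>Q. wilson N (a @ r @ b) Q * W k (R - {s}) Q \<partial>P)"
    by (rule flip_square[OF N R(1,2) st(1), of d a b k]) (use es eother l(2) ab nab d(2) in auto)
  define R' where "R' = R - {s}"
  define l' where "l' = a @ r @ b"
  have okr: "edges_ok r" using edges_ok_iff[OF r(1)] r(3) R(2)[OF st(1)] by auto
  \<comment> \<open>Bookkeeping of a flip: one passage through \<open>e\<close> is lost, and one
    through each of the other three sides of \<open>s\<close> is gained.\<close>
  have count: "count_list (map pos_edge l') f + (if f = e then 1 else 0) =
      count_list (map pos_edge l) f + (if f \<in> square_edges s \<and> f \<noteq> e then 1 else 0)" for f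
    using count_list_distinct[OF r(2), of f] r(3) d(2) by (simp add: l'_def ab)
  have "(\<integral>Q. wilson N l' Q * W k R' Q \<partial>P) = coef k ^ card R' * real N"
  proof (rule Suc.hyps(1))
    show "n = card R'" using Suc.hyps(2) st(1) R(1) by (simp add: R'_def)
    show "finite R'" "\<And>t. t \<in> R' \<Longrightarrow> square_edges t \<subseteq> E" using R by (auto simp: R'_def)
    have "walk u a (fst d)" "walk (snd d) b u" using l(1) unfolding ab walk_append by auto
    then show "walk u l' u" using r(1) unfolding l'_def walk_append by blast
    show "edges_ok l'" using l(2) okr by (simp add: l'_def ab)
  next
    fix f assume f: "f \<in> bd R'"
    then have pf: "positive_edge f" by (rule bd_positive)
    have "f \<noteq> e" using f st unfolding R'_def bd_def by auto
    show "count_list (map pos_edge l') f = 1"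
    proof (cases "f \<in> square_edges s")
      case True
      then have "side1 f \<in> R" "side2 f \<in> R"
        using f st(1) unfolding square_edges_iff[OF pf] R'_def bd_def by auto
      then show ?thesis using never[OF pf] count[of f] True \<open>f \<noteq> e\<close> by simp
    next
      case False
      then have "f \<in> bd R" using f unfolding square_edges_iff[OF pf] R'_def bd_def by auto
      then show ?thesis using once count[of f] False \<open>f \<noteq> e\<close> by simp
    qed
  next
    fix f assume f: "positive_edge f" "side1 f \<in> R'" "side2 f \<in> R'"
    then have "f \<notin> square_edges s" unfolding square_edges_iff[OF f(1)] by (auto simp: R'_def)
    moreover have "f \<noteq> e" using \<open>f \<notin> square_edges s\<close> es by auto
    ultimately show "count_list (map pos_edge l') f = 0"
      using never[OF f(1)] f count[of f] by (simp add: R'_def)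
  next
    fix V assume V: "finite V" "bd V \<subseteq> pos_edge ` set l' \<union> (\<Union>t\<in>R'. square_edges t)"
    have "pos_edge ` set l' \<union> (\<Union>t\<in>R'. square_edges t) \<subseteq> pos_edge ` set l \<union> (\<Union>t\<in>R. square_edges t)"
      using r(3) st(1) by (auto simp: l'_def ab R'_def)
    then have VR: "V \<subseteq> R" by (intro U[OF V(1)] subset_trans[OF V(2)])
    have "e \<notin> pos_edge ` set l'" using nab r(3) by (auto simp: l'_def)
    moreover have "e \<notin> (\<Union>t\<in>R'. square_edges t)" using eother by (auto simp: R'_def)
    \<comment> \<open>Since \<open>e\<close> is no longer available, \<open>V\<close> contains both
      or neither of the squares \<open>s\<close> and \<open>t\<close>. As \<open>t\<close> is
      outside \<open>R\<close>, also \<open>s\<close> is not in \<open>V\<close>, which restores the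
      invariant for \<open>R'\<close>.\<close>
    ultimately have "e \<notin> bd V" using V(2) by blast
    then have "side1 e \<in> V \<longleftrightarrow> side2 e \<in> V" using pe by (simp add: bd_def)
    moreover have "t \<notin> V" using VR st(2) by blast
    ultimately have "s \<notin> V" using st(3) unfolding doubleton_eq_iff by blast
    then show "V \<subseteq> R'" using VR by (auto simp: R'_def)
  qed
  then show ?case
    using r(4) Suc.hyps(2)[symmetric] card.remove[OF R(1) st(1)] by (simp add: ab l'_def R'_def)
qed

lemma wilson_simple_loop:
  assumes N: "N \<ge> 3" and l: "simple_lattice_loop l" and B: "finite B" "bd B = pos_edge ` set l"
    and S: "finite S" "B \<subseteq> S" "\<And>t. t \<in> S \<Longrightarrow> square_edges t \<subseteq> E"
  shows "(\<integral>Q. wilson N l Q * W k S Q \<partial>P) = coef k ^ card B * real N"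
proof -
  have cw: "closed_walk l" using l by (simp add: simple_lattice_loop_def lattice_loop_def)
  then have w: "walk (fst (l ! 0)) l (fst (l ! 0))" by (simp add: closed_walk_iff)
  have "bd B \<subseteq> E"
  proof
    fix e assume e: "e \<in> bd B"
    then obtain s where "s \<in> B" "e \<in> square_edges s"
      using square_edges_iff[OF bd_positive[OF e]] unfolding bd_def by blast
    then show "e \<in> E" using S by blast
  qed
  then have edges_ok: "edges_ok l" using edges_ok_iff[OF w] B(2) by simp
  have nc: "U = {}" if "finite U" "U \<inter> B = {}" "bd U \<subseteq> pos_edge ` set l" for U
    by (rule no_cycle_outside[OF l B that])
  have "(\<integral>Q. wilson N l Q * W k S Q \<partial>P) = (\<integral>Q. wilson N l Q * W k B Q \<partial>P)"
  proof (rule drop_squares[where D = "pos_edge ` set l"])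
    show "bdd_P (wilson N l)" using bdd_P_path[OF bdd_mb_trace edges_ok] by (simp add: wilson_def[abs_def])
    show "wilson N l (Q(e := q)) = wilson N l Q" if "e \<in> E - pos_edge ` set l" for e Q q
      unfolding wilson_def by (subst path_matrix_upd) (use that in auto)
  qed (use S B nc in auto)
  also have "\<dots> = coef k ^ card B * real N"
  proof (rule contract_loop[OF N B(1) _ w edges_ok])
    show "square_edges t \<subseteq> E" if "t \<in> B" for t using S(2,3) that by blast
    show "count_list (map pos_edge l) e = 1" if "e \<in> bd B" for e
      using count_list_distinct[OF simple_loop_distinct_edges[OF l], of e] that B(2) by simp
    show "count_list (map pos_edge l) e = 0" if "positive_edge e" "side1 e \<in> B" "side2 e \<in> B" for e
    proof -
      have "e \<notin> bd B" using that by (simp add: bd_def)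
      then show ?thesis using count_list_distinct[OF simple_loop_distinct_edges[OF l], of e] B(2) by simp
    qed
    fix U assume U: "finite U" "bd U \<subseteq> pos_edge ` set l \<union> (\<Union>t\<in>B. square_edges t)"
    \<comment> \<open>An edge off the loop is not in \<open>bd B\<close>, so its two squares are
      both in \<open>B\<close> or both outside. Being in bd (U - B) excludes the first case; in the
      second it is in \<open>bd U\<close> but on no square of \<open>B\<close>, against the choice
      of \<open>U\<close>.\<close>
    have "bd (U - B) \<subseteq> pos_edge ` set l"
    proof
      fix e assume e: "e \<in> bd (U - B)"
      then have pe: "positive_edge e" by (rule bd_positive)
      show "e \<in> pos_edge ` set l"
      proof (rule ccontr)
        assume ne: "e \<notin> pos_edge ` set l"
        then have "e \<notin> bd B" using B(2) by simp
        then have sides: "e \<in> bd U" "side1 e \<notin> B" "side2 e \<notin> B" using e pe by (auto simp: bd_def)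
        then have "e \<in> (\<Union>t\<in>B. square_edges t)" using U(2) ne by blast
        then obtain t where t: "t \<in> B" "e \<in> square_edges t" by (rule UN_E)
        have "side1 e = t \<or> side2 e = t" using t(2) by (simp only: square_edges_iff[OF pe])
        then show False using sides t(1) by blast
      qed
    qed
    moreover have "finite (U - B)" "(U - B) \<inter> B = {}" using U(1) by (simp, blast)
    ultimately have "U - B = {}" by (intro nc[of "U - B"])
    then show "U \<subseteq> B" by auto
  qed
  finally show ?thesis .
qed

lemma integral_W:
  assumes "finite S" "\<And>t. t \<in> S \<Longrightarrow> square_edges t \<subseteq> E"
  shows "(\<integral>Q. W k S Q \<partial>P) = 1"
proof -
  have "(\<integral>Q. 1 * W k S Q \<partial>P) = (\<integral>Q. 1 * W k {} Q \<partial>P)"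
  proof (rule drop_squares[where D = "{}"])
    show "U = {}" if "finite U" "bd U \<subseteq> {}" for U using bd_nonempty[OF that(1)] that(2) by blast
  qed (use assms in \<open>auto intro: bdd_P_const\<close>)
  then show ?thesis by (simp add: W_def P.prob_space)
qed

text \<open>The plaquette matrix has density \<open>wt k\<close> with respect to Haar measure. Once
  the other squares are dropped, the first edge of the square walk is resampled, and the product of
  the other three matrices is absorbed by right invariance. As \<open>f\<close> need not be the
  trace, this also serves the doubled plaquette.\<close>

lemma integral_square:
  assumes f: "bdd_mb f" and S: "finite S" "s \<in> S" "\<And>t. t \<in> S \<Longrightarrow> square_edges t \<subseteq> E"
  shows "(\<integral>Q. f (path_matrix N Q (square_walk s)) * W k S Q \<partial>P) = (\<integral>X. f X * wt k X \<partial>M)"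
proof -
  have edges_ok: "edges_ok (square_walk s)" using edges_ok_square_walk S by simp
  have "(\<integral>Q. f (path_matrix N Q (square_walk s)) * W k S Q \<partial>P) =
      (\<integral>Q. f (path_matrix N Q (square_walk s)) * W k {s} Q \<partial>P)"
  proof (rule drop_squares[where D = "square_edges s"])
    show "bdd_P (\<lambda>Q. f (path_matrix N Q (square_walk s)))" by (rule bdd_P_path[OF f edges_ok])
    show "f (path_matrix N (Q(e := q)) (square_walk s)) = f (path_matrix N Q (square_walk s))"
      if "e \<in> E - square_edges s" for e Q q
      by (subst path_matrix_upd) (use that in \<open>auto simp: square_edges_def\<close>)
    show "U = {}" if "finite U" "U \<inter> {s} = {}" "bd U \<subseteq> square_edges s" for U
      by (rule no_cycle_outside[OF simple_loop_square_walk[of s], of "{s}"])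
         (use that bd_square[of s] in \<open>auto simp: square_edges_def\<close>)
  qed (use S bd_square[of s] in auto)
  also have "\<dots> = (\<integral>Q. f (path_matrix N Q (square_walk s)) * wt k (path_matrix N Q (square_walk s)) \<partial>P)"
    by (simp add: W_def)
  also have "\<dots> = (\<integral>Q. (\<integral>q. f (path_matrix N (Q(vedge s := q)) (square_walk s)) *
      wt k (path_matrix N (Q(vedge s := q)) (square_walk s)) \<partial>M) \<partial>P)"
  proof (rule resample)
    have "vedge s \<in> square_edges s" by (simp add: square_edges_iff)
    then show "vedge s \<in> E" using S(3)[OF S(2)] by blast
  qed (intro bdd_P_mult bdd_P_path f bdd_mb_wt edges_ok)
  also have "\<dots> = (\<integral>Q. (\<integral>X. f X * wt k X \<partial>M) \<partial>P)"
  proof (rule Bochner_Integration.integral_cong[OF refl])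
    fix Q assume Q: "Q \<in> space P"
    obtain r where r: "square_walk s = vedge s # r" by (cases s) auto
    have dist: "vedge s \<notin> pos_edge ` set r" using distinct_square_walk[of s] by (simp add: r)
    have okr: "edges_ok r" and vE: "vedge s \<in> E" using edges_ok by (auto simp: r)
    have "(\<integral>q. f (path_matrix N (Q(vedge s := q)) (square_walk s)) *
        wt k (path_matrix N (Q(vedge s := q)) (square_walk s)) \<partial>M) =
        (\<integral>q. f (q * path_matrix N Q r) * wt k (q * path_matrix N Q r) \<partial>M)"
    proof (rule Bochner_Integration.integral_cong[OF refl])
      fix q assume "q \<in> space M"
      then have q: "q \<in> SOc N" by (simp add: space_M)
      have "path_matrix N (Q(vedge s := q)) (square_walk s) = q * path_matrix N Q r"
        using edge_matrix_upd[OF Q q, of "vedge s"] vE path_matrix_upd[OF dist] by (simp add: r)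
      then show "f (path_matrix N (Q(vedge s := q)) (square_walk s)) *
          wt k (path_matrix N (Q(vedge s := q)) (square_walk s)) =
          f (q * path_matrix N Q r) * wt k (q * path_matrix N Q r)" by simp
    qed
    also have "\<dots> = (\<integral>X. f X * wt k X \<partial>M)"
      using integral_right_mult[OF bdd_mb_mult[OF f bdd_mb_wt] path_matrix_SO[OF Q okr]] by simp
    finally show "(\<integral>q. f (path_matrix N (Q(vedge s := q)) (square_walk s)) *
        wt k (path_matrix N (Q(vedge s := q)) (square_walk s)) \<partial>M) = (\<integral>X. f X * wt k X \<partial>M)" .
  qed
  also have "\<dots> = (\<integral>X. f X * wt k X \<partial>M)" by (simp add: P.prob_space)
  finally show ?thesis .
qed

end

section \<open>Large N limit\<close>

lemma finite_positive_edges: "finite \<Lambda> \<Longrightarrow> finite (positive_edges \<Lambda>)"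
  by (rule finite_subset[of _ "\<Lambda> \<times> \<Lambda>"]) (auto simp: positive_edges_def)

lemma finite_squares: "finite \<Lambda> \<Longrightarrow> finite (squares \<Lambda>)"
  by (rule finite_subset[of _ \<Lambda>]) (auto simp: squares_def)

lemma square_edges_subset: "s \<in> squares \<Lambda> \<Longrightarrow> square_edges s \<subseteq> positive_edges \<Lambda>"
  by (cases s) (auto simp: squares_def square_edges_def positive_edges_def)

context lattice_haar
begin

text \<open>Each Boltzmann factor is \<open>Z k\<close> times \<open>wt k\<close>, and the product
  of the constants is exactly the partition function.\<close>

lemma gibbs_expectation_eq:
  assumes H: "H N = M" and E: "E = positive_edges \<Lambda>" and \<Lambda>: "finite \<Lambda>" and f: "f \<in> borel_measurable P"
  shows "gibbs_expectation H \<Lambda> N \<beta> f = (\<integral>Q. f Q * W (real N * \<beta>) (squares \<Lambda>) Q \<partial>P)"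
proof -
  define k where "k = real N * \<beta>"
  let ?S = "squares \<Lambda>"
  have S: "finite ?S" "\<And>t. t \<in> ?S \<Longrightarrow> square_edges t \<subseteq> E"
    using finite_squares[OF \<Lambda>] square_edges_subset E by auto
  have weight: "gibbs_weight \<Lambda> N \<beta> Q = Z k ^ card ?S * W k ?S Q" for Q
  proof -
    have "gibbs_weight \<Lambda> N \<beta> Q = exp (\<Sum>s\<in>?S. k * wilson N (square_walk s) Q)"
      unfolding gibbs_weight_def positive_plaquettes_eq k_def
      by (subst sum.reindex) (auto intro: inj_on_subset[OF square_walk_inj] simp: sum_distrib_left)
    also have "\<dots> = (\<Prod>s\<in>?S. Z k * wt k (path_matrix N Q (square_walk s)))"
      using Z_pos[of k] by (simp add: exp_sum[OF S(1)] wt_def wilson_def)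
    also have "\<dots> = Z k ^ card ?S * W k ?S Q" by (simp add: prod.distrib W_def)
    finally show ?thesis .
  qed
  have PH: "product_haar H \<Lambda> N = P" unfolding P_def unfolding product_haar_def H E ..
  have "partition_function H \<Lambda> N \<beta> = Z k ^ card ?S"
    unfolding partition_function_def PH weight using integral_W[OF S] by simp
  then have "gibbs_measure H \<Lambda> N \<beta> = density P (\<lambda>Q. ennreal (W k ?S Q))"
    unfolding gibbs_measure_def PH weight using Z_pos[of k] by simp
  moreover have "0 \<le> W k ?S Q" for Q
    unfolding W_def by (intro prod_nonneg less_imp_le wt_pos)
  ultimately have "gibbs_expectation H \<Lambda> N \<beta> f = (\<integral>Q. W k ?S Q *\<^sub>R f Q \<partial>P)"
    unfolding gibbs_expectation_def using bdd_P_W[OF S(2), of ?S k] f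
    by (subst integral_density[symmetric])
       (simp_all add: bdd_P_def)
  then show ?thesis by (simp add: k_def mult.commute)
qed

end

text \<open>Only loops are known to have a limit and a power series, so the doubled plaquette has to
  qualify as one; no backtrack arises at the seam because cyclic backtracks are already
  excluded.\<close>

lemma lattice_loop_double:
  assumes "lattice_loop l"
  shows "lattice_loop (l @ l)"
proof -
  define n where "n = length l"
  have cw: "closed_walk l" and nb: "\<And>i. i < n \<Longrightarrow> l ! (Suc i mod n) \<noteq> prod.swap (l ! i)"
    using assms by (auto simp: lattice_loop_def n_def)
  have n: "n > 0" using closed_walkD(1)[OF cw] by (simp add: n_def)
  have w: "walk (fst (l ! 0)) l (fst (l ! 0))" using cw by (simp add: closed_walk_iff)
  then have "walk (fst (l ! 0)) (l @ l) (fst (l ! 0))" using walk_append by blast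
  then have "closed_walk (l @ l)"
    using closed_walkD(1)[OF cw] by (simp add: closed_walk_iff nth_append)
  moreover have "(l @ l) ! (Suc i mod (n + n)) \<noteq> prod.swap ((l @ l) ! i)" if i: "i < n + n" for i
  proof -
    have nth: "(l @ l) ! j = l ! (j mod n)" if "j < n + n" for j
    proof (cases "j < n")
      case False
      then have "j mod n = j - n" using that by (simp add: mod_if)
      then show ?thesis using False by (simp add: nth_append n_def)
    qed (simp add: nth_append n_def)
    have "Suc i mod (n + n) mod n = Suc i mod n" by (rule mod_mod_cancel) simp
    also have "\<dots> = Suc (i mod n) mod n" by (simp add: mod_Suc_eq)
    finally have "(l @ l) ! (Suc i mod (n + n)) = l ! (Suc (i mod n) mod n)"
      using nth[of "Suc i mod (n + n)"] n by simp
    moreover have "i mod n < n" using n by simp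
    ultimately show ?thesis using nb[of "i mod n"] nth[OF i] by simp
  qed
  ultimately show ?thesis by (simp add: lattice_loop_def n_def)
qed

definition lattice_square :: "nat \<Rightarrow> site set" where
  "lattice_square n = {- int n..int n} \<times> {- int n..int n}"

lemma lattice_square_covers:
  assumes "finite B"
  shows "\<exists>n0. \<forall>n\<ge>n0. B \<subseteq> squares (lattice_square n)"
proof -
  have "\<exists>m. \<forall>s\<in>B. nat \<bar>fst s\<bar> + nat \<bar>snd s\<bar> \<le> m"
    using finite_imageI[OF assms, of "\<lambda>s. nat \<bar>fst s\<bar> + nat \<bar>snd s\<bar>"]
    by (auto simp: finite_nat_set_iff_bounded_le)
  then obtain m where m: "\<And>s. s \<in> B \<Longrightarrow> nat \<bar>fst s\<bar> + nat \<bar>snd s\<bar> \<le> m" by blast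
  have "B \<subseteq> squares (lattice_square n)" if "n \<ge> m + 1" for n
  proof
    fix s assume "s \<in> B"
    then have "nat \<bar>fst s\<bar> + nat \<bar>snd s\<bar> \<le> m" by (rule m)
    then show "s \<in> squares (lattice_square n)" using that
      by (cases s) (auto simp: squares_def lattice_square_def)
  qed
  then show ?thesis by blast
qed

lemma exhausting_lattice_square: "exhausting lattice_square"
proof -
  have "s \<in> (\<Union>N\<in>{1..}. lattice_square N)" for s
  proof -
    obtain n0 where "\<forall>n\<ge>n0. {s} \<subseteq> squares (lattice_square n)" using lattice_square_covers[of "{s}"] by auto
    then have "s \<in> squares (lattice_square (Suc n0))" by auto
    then have "s \<in> lattice_square (Suc n0)" by (auto simp: squares_def)
    then show ?thesis by auto
  qed
  then show ?thesis by (auto simp: exhausting_def lattice_square_def)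
qed

section \<open>Plaquette means at coupling N \<beta> and their limits\<close>

locale haar_family =
  fixes H :: "nat \<Rightarrow> real mat measure"
  assumes haar: "\<And>N. N \<ge> 1 \<Longrightarrow> SO_haar N (H N)"
begin

definition plaquette_mean :: "nat \<Rightarrow> real \<Rightarrow> real" where "plaquette_mean N \<beta> = haar_SO.coef N (H N) (real N * \<beta>)"
definition plaquette_square_mean :: "nat \<Rightarrow> real \<Rightarrow> real" where "plaquette_square_mean N \<beta> = haar_SO.coef2 N (H N) (real N * \<beta>)"

lemma haar_SO: "N \<ge> 1 \<Longrightarrow> haar_SO N (H N)"
  by (simp add: haar_SO_def haar)

lemma lattice_haar:
  assumes "N \<ge> 1"
  shows "lattice_haar N (H N) (positive_edges (lattice_square N))"
  using haar_SO[OF assms] finite_positive_edges[of "lattice_square N"]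
  by (auto simp: lattice_haar_def lattice_haar_axioms_def lattice_square_def positive_edges_def)

lemma expectation_simple_loop:
  assumes N: "N \<ge> 3" and l: "simple_lattice_loop l" and B: "finite B" "bd B = pos_edge ` set l"
    and BN: "B \<subseteq> squares (lattice_square N)"
  shows "gibbs_expectation H (lattice_square N) N \<beta> (wilson N l) / real N = plaquette_mean N \<beta> ^ card B"
proof -
  interpret lattice_haar N "H N" "positive_edges (lattice_square N)"
    by (rule lattice_haar) (use N in simp)
  have fin: "finite (lattice_square N)" by (simp add: lattice_square_def)
  have cw: "closed_walk l" using l by (simp add: simple_lattice_loop_def lattice_loop_def)
  then have w: "walk (fst (l ! 0)) l (fst (l ! 0))" by (simp add: closed_walk_iff)
  have "bd B \<subseteq> positive_edges (lattice_square N)"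
  proof
    fix e assume e: "e \<in> bd B"
    then obtain s where "s \<in> B" "e \<in> square_edges s"
      using square_edges_iff[OF bd_positive[OF e]] unfolding bd_def by blast
    then show "e \<in> positive_edges (lattice_square N)" using BN square_edges_subset by blast
  qed
  then have edges_ok: "edges_ok l" using edges_ok_iff[OF w] B(2) by simp
  have "gibbs_expectation H (lattice_square N) N \<beta> (wilson N l) =
      (\<integral>Q. wilson N l Q * W (real N * \<beta>) (squares (lattice_square N)) Q \<partial>P)"
    using bdd_P_path[OF bdd_mb_trace edges_ok]
    by (intro gibbs_expectation_eq[where H = H and \<Lambda> = "lattice_square N", OF refl refl fin]) (simp add: bdd_P_def wilson_def[abs_def])
  also have "\<dots> = plaquette_mean N \<beta> ^ card B * real N"
    unfolding plaquette_mean_def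
    by (rule wilson_simple_loop[OF N l B finite_squares[OF fin] BN square_edges_subset])
  finally show ?thesis using N by simp
qed

lemma expectation_plaquette:
  assumes N: "N \<ge> 1" and s: "s \<in> squares (lattice_square N)"
  shows "gibbs_expectation H (lattice_square N) N \<beta> (wilson N (square_walk s)) / real N = plaquette_mean N \<beta>"
    and "gibbs_expectation H (lattice_square N) N \<beta> (wilson N (square_walk s @ square_walk s)) / real N = plaquette_square_mean N \<beta>"
proof -
  interpret lattice_haar N "H N" "positive_edges (lattice_square N)"
    by (rule lattice_haar[OF N])
  have fin: "finite (lattice_square N)" by (simp add: lattice_square_def)
  have S: "finite (squares (lattice_square N))"
    "\<And>t. t \<in> squares (lattice_square N) \<Longrightarrow> square_edges t \<subseteq> positive_edges (lattice_square N)"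
    using finite_squares[OF fin] square_edges_subset by auto
  have edges_ok: "edges_ok (square_walk s)" by (rule edges_ok_square_walk[OF S(2)[OF s]])
  have "gibbs_expectation H (lattice_square N) N \<beta> (wilson N (square_walk s)) =
      (\<integral>Q. mat_trace (path_matrix N Q (square_walk s)) * W (real N * \<beta>) (squares (lattice_square N)) Q \<partial>P)"
    using bdd_P_path[OF bdd_mb_trace edges_ok]
    by (subst gibbs_expectation_eq[where H = H and \<Lambda> = "lattice_square N", OF refl refl fin])
      (simp_all add: bdd_P_def wilson_def[abs_def])
  also have "\<dots> = (\<integral>X. mat_trace X * wt (real N * \<beta>) X \<partial>H N)"
    by (rule integral_square[OF bdd_mb_trace S(1) s S(2)])
  finally show "gibbs_expectation H (lattice_square N) N \<beta> (wilson N (square_walk s)) / real N = plaquette_mean N \<beta>"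
    by (simp add: plaquette_mean_def coef_def)
  have double: "path_matrix N Q (square_walk s @ square_walk s) =
      path_matrix N Q (square_walk s) * path_matrix N Q (square_walk s)" if "Q \<in> space P" for Q
    by (rule path_matrix_append[OF that edges_ok edges_ok])
  have "gibbs_expectation H (lattice_square N) N \<beta> (wilson N (square_walk s @ square_walk s)) =
      (\<integral>Q. wilson N (square_walk s @ square_walk s) Q * W (real N * \<beta>) (squares (lattice_square N)) Q \<partial>P)"
  proof (rule gibbs_expectation_eq[where H = H and \<Lambda> = "lattice_square N", OF refl refl fin])
    have "edges_ok (square_walk s @ square_walk s)" using edges_ok by simp
    from bdd_P_path[OF bdd_mb_trace this] show "wilson N (square_walk s @ square_walk s) \<in> borel_measurable P"
      by (simp add: bdd_P_def wilson_def[abs_def])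
  qed
  also have "\<dots> = (\<integral>Q. mat_trace (path_matrix N Q (square_walk s) * path_matrix N Q (square_walk s)) *
      W (real N * \<beta>) (squares (lattice_square N)) Q \<partial>P)"
    by (rule Bochner_Integration.integral_cong[OF refl]) (simp only: wilson_def double)
  also have "\<dots> = (\<integral>X. mat_trace (X * X) * wt (real N * \<beta>) X \<partial>H N)"
    by (rule integral_square[OF bdd_mb_trace_square S(1) s S(2)])
  finally show "gibbs_expectation H (lattice_square N) N \<beta> (wilson N (square_walk s @ square_walk s)) / real N = plaquette_square_mean N \<beta>"
    by (simp add: plaquette_square_mean_def coef2_def)
qed

lemma plaquette_mean_mono: "N \<ge> 1 \<Longrightarrow> x \<le> y \<Longrightarrow> plaquette_mean N x \<le> plaquette_mean N y"
  unfolding plaquette_mean_def by (intro haar_SO.coef_mono haar_SO mult_left_mono) auto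

text \<open>The equation at k = N \<beta>, divided by N; the prefactor tends to 1.\<close>

lemma plaquette_mean_schwinger_dyson: "N \<ge> 1 \<Longrightarrow> (1 - 1 / real N) * plaquette_mean N \<beta> = \<beta> * (1 - plaquette_square_mean N \<beta>)"
  using haar_SO.schwinger_dyson_coef[OF haar_SO, of N "real N * \<beta>"]
  unfolding plaquette_mean_def plaquette_square_mean_def by (simp add: field_simps)

lemma plaquette_square_mean_0: "N \<ge> 3 \<Longrightarrow> plaquette_square_mean N 0 = 1 / real N"
  using haar_SO.coef2_0[OF haar_SO, of N] by (simp add: plaquette_square_mean_def)

lemma plaquette_limit_nonzero:
  assumes lim1: "\<And>x. \<bar>x\<bar> < \<beta>\<^sub>0 \<Longrightarrow> (\<lambda>N. plaquette_mean N x) \<longlonglongrightarrow> w1 x"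
    and lim2: "\<And>x. \<bar>x\<bar> < \<beta>\<^sub>0 \<Longrightarrow> (\<lambda>N. plaquette_square_mean N x) \<longlonglongrightarrow> w2 x"
    and powser: "\<And>x. \<bar>x\<bar> < \<beta>\<^sub>0 \<Longrightarrow> summable (\<lambda>k. \<bar>a k * x ^ k\<bar>) \<and> w2 x = (\<Sum>k. a k * x ^ k)"
    and \<beta>: "0 < \<bar>\<beta>\<bar>" "\<bar>\<beta>\<bar> < \<beta>\<^sub>0"
  shows "w1 \<beta> \<noteq> 0"
proof
  assume zero: "w1 \<beta> = 0"
  have eq: "w1 x = x * (1 - w2 x)" if x: "\<bar>x\<bar> < \<beta>\<^sub>0" for x
  proof -
    have "(\<lambda>N. (1 - 1 / real N) * plaquette_mean N x) \<longlonglongrightarrow> (1 - 0) * w1 x"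
      by (intro tendsto_intros lim1[OF x] lim_1_over_n)
    moreover have "(\<lambda>N. x * (1 - plaquette_square_mean N x)) \<longlonglongrightarrow> x * (1 - w2 x)"
      by (intro tendsto_intros lim2[OF x])
    moreover have "\<forall>\<^sub>F N in sequentially. (1 - 1 / real N) * plaquette_mean N x = x * (1 - plaquette_square_mean N x)"
      using eventually_ge_at_top[of 1] by eventually_elim (rule plaquette_mean_schwinger_dyson)
    ultimately have "(1 - 0) * w1 x = x * (1 - w2 x)"
      by (intro LIMSEQ_unique[OF Lim_transform_eventually])
    then show ?thesis by simp
  qed
  have mono: "w1 x \<le> w1 y" if "x \<le> y" "\<bar>x\<bar> < \<beta>\<^sub>0" "\<bar>y\<bar> < \<beta>\<^sub>0" for x y
    by (rule LIMSEQ_le[OF lim1[OF that(2)] lim1[OF that(3)]]) (use plaquette_mean_mono that(1) in blast)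
  have w10: "w1 0 = 0" using eq[of 0] \<beta> by simp
  \<comment> \<open>Nonzero points between 0 and \<beta> that tend to 0. Monotonicity squeezes
    \<open>w1\<close> to 0 at each of them, and the factor \<open>x n\<close> can be cancelled from
    the limit equation.\<close>
  define x where "x n = \<beta> / real (Suc n)" for n
  have x_small: "\<bar>x n\<bar> \<le> \<bar>\<beta>\<bar>" for n
    by (simp add: x_def divide_le_eq mult_le_cancel_left1)
  have one: "w2 (x n) = 1" for n
  proof -
    have xn: "\<bar>x n\<bar> < \<beta>\<^sub>0" using x_small[of n] \<beta> by simp
    have "w1 (x n) = 0"
    proof (cases "\<beta> > 0")
      case True
      then have "0 \<le> x n" "x n \<le> \<beta>" using x_small[of n] by (auto simp: x_def)
      then show ?thesis using mono[of 0 "x n"] mono[of "x n" \<beta>] xn \<beta> zero w10 by simp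
    next
      case False
      then have "x n \<le> 0" "\<beta> \<le> x n" using x_small[of n] by (auto simp: x_def divide_le_0_iff)
      then show ?thesis using mono[of "x n" 0] mono[of \<beta> "x n"] xn \<beta> zero w10 by simp
    qed
    moreover have "x n \<noteq> 0" using \<beta> by (simp add: x_def)
    ultimately show ?thesis using eq[OF xn] by simp
  qed
  have "w2 0 = 0"
  proof (rule LIMSEQ_unique[OF lim2])
    have "\<forall>\<^sub>F N in sequentially. 1 / real N = plaquette_square_mean N 0"
      using eventually_ge_at_top[of 3] by eventually_elim (simp add: plaquette_square_mean_0)
    with lim_1_over_n show "(\<lambda>N. plaquette_square_mean N 0) \<longlonglongrightarrow> 0" by (rule Lim_transform_eventually)
  qed (use \<beta> in simp)
  have "isCont (\<lambda>x. \<Sum>k. a k * x ^ k) 0"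
  proof (rule isCont_powser)
    show "summable (\<lambda>k. a k * \<beta> ^ k)" by (rule summable_rabs_cancel[OF conjunct1[OF powser[OF \<beta>(2)]]])
  qed (use \<beta> in simp)
  moreover have "x \<longlonglongrightarrow> 0" unfolding x_def
    using tendsto_mult_left[OF LIMSEQ_inverse_real_of_nat, of \<beta>] by (simp add: divide_inverse)
  ultimately have "(\<lambda>n. \<Sum>k. a k * x n ^ k) \<longlonglongrightarrow> (\<Sum>k. a k * 0 ^ k)"
    by (rule isCont_tendsto_compose)
  moreover have "(\<Sum>k. a k * x n ^ k) = 1" for n
  proof -
    have "\<bar>x n\<bar> < \<beta>\<^sub>0" using x_small[of n] \<beta> by linarith
    from conjunct2[OF powser[OF this]] show ?thesis unfolding one by (rule sym)
  qed
  moreover have "(\<Sum>k. a k * 0 ^ k) = 0"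
  proof -
    have "\<bar>0\<bar> < \<beta>\<^sub>0" using \<beta> by linarith
    from conjunct2[OF powser[OF this]] show ?thesis unfolding \<open>w2 0 = 0\<close> by (rule sym)
  qed
  ultimately have "(\<lambda>n::nat. 1) \<longlonglongrightarrow> (0::real)" by (simp only:)
  then show False by (simp add: LIMSEQ_const_iff)
qed

end

theorem corollary2p9:
  fixes H :: "nat \<Rightarrow> real mat measure" and \<Lambda> :: "nat \<Rightarrow> site set" and \<beta>\<^sub>0 :: real
  assumes haar: "\<And>N. N \<ge> 1 \<Longrightarrow> SO_haar N (H N)"
    and exhausting: "exhausting \<Lambda>"
    and strong_coupling: "strong_coupling_constant H \<beta>\<^sub>0"
  shows "\<forall>\<beta>::real. 0 < \<bar>\<beta>\<bar> \<and> \<bar>\<beta>\<bar> < \<beta>\<^sub>0 \<longrightarrow>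
    (\<exists>C\<^sub>1>0. \<exists>C\<^sub>2>0. \<forall>l. simple_lattice_loop l \<longrightarrow>
       convergent (\<lambda>N. \<bar>gibbs_expectation H (\<Lambda> N) N \<beta> (wilson N l)\<bar> / real N) \<and>
       lim (\<lambda>N. \<bar>gibbs_expectation H (\<Lambda> N) N \<beta> (wilson N l)\<bar> / real N)
         \<ge> C\<^sub>1 * exp (- C\<^sub>2 * real (loop_area l)))"
proof (intro allI impI)
  fix \<beta> :: real assume \<beta>: "0 < \<bar>\<beta>\<bar> \<and> \<bar>\<beta>\<bar> < \<beta>\<^sub>0"
  interpret haar_family H by unfold_locales (rule haar)
  obtain w a where wa: "\<forall>x. \<bar>x\<bar> < \<beta>\<^sub>0 \<longrightarrow>
      (\<forall>\<Lambda> l. exhausting \<Lambda> \<and> lattice_loop l \<longrightarrow>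
        (\<lambda>N. gibbs_expectation H (\<Lambda> N) N x (wilson N l) / real N) \<longlonglongrightarrow> w l x) \<and>
      (\<forall>\<Lambda> ls. exhausting \<Lambda> \<and> (\<forall>l\<in>set ls. lattice_loop l) \<longrightarrow>
        (\<lambda>N. gibbs_expectation H (\<Lambda> N) N x (\<lambda>Q. \<Prod>l\<leftarrow>ls. wilson N l Q)
               / real N ^ length ls) \<longlonglongrightarrow> (\<Prod>l\<leftarrow>ls. w l x)) \<and>
      (\<forall>l. lattice_loop l \<longrightarrow>
        summable (\<lambda>k. \<bar>a l k * x ^ k\<bar>) \<and> w l x = (\<Sum>k. a l k * x ^ k))"
    using strong_coupling unfolding strong_coupling_constant_def by (elim conjE exE) (rule that)
  have lim: "(\<lambda>N. gibbs_expectation H (L N) N x (wilson N l) / real N) \<longlonglongrightarrow> w l x"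
    if "\<bar>x\<bar> < \<beta>\<^sub>0" "exhausting L" "lattice_loop l" for x L l
    using wa[rule_format, OF that(1), THEN conjunct1, rule_format, OF conjI[OF that(2,3)]] .
  have powser: "summable (\<lambda>k. \<bar>a l k * x ^ k\<bar>) \<and> w l x = (\<Sum>k. a l k * x ^ k)"
    if "\<bar>x\<bar> < \<beta>\<^sub>0" "lattice_loop l" for x l
    using wa[rule_format, OF that(1), THEN conjunct2, THEN conjunct2, rule_format, OF that(2)] .
  define p where "p = square_walk (0, 0)"
  have p: "lattice_loop p" "lattice_loop (p @ p)"
    using simple_loop_square_walk[of "(0, 0)"] lattice_loop_double[of p] unfolding p_def simple_lattice_loop_def
    by blast+
  have p_in: "(0, 0) \<in> squares (lattice_square N)" if "N \<ge> 1" for N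
    using that by (auto simp: squares_def lattice_square_def)
  have lim1: "(\<lambda>N. plaquette_mean N x) \<longlonglongrightarrow> w p x" if "\<bar>x\<bar> < \<beta>\<^sub>0" for x
  proof (rule Lim_transform_eventually[OF lim[OF that exhausting_lattice_square p(1)]])
    show "\<forall>\<^sub>F N in sequentially. gibbs_expectation H (lattice_square N) N x (wilson N p) / real N = plaquette_mean N x"
      using eventually_ge_at_top[of 1]
      by eventually_elim (simp only: p_def expectation_plaquette(1)[OF _ p_in])
  qed
  have lim2: "(\<lambda>N. plaquette_square_mean N x) \<longlonglongrightarrow> w (p @ p) x" if "\<bar>x\<bar> < \<beta>\<^sub>0" for x
  proof (rule Lim_transform_eventually[OF lim[OF that exhausting_lattice_square p(2)]])
    show "\<forall>\<^sub>F N in sequentially. gibbs_expectation H (lattice_square N) N x (wilson N (p @ p)) / real N = plaquette_square_mean N x"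
      using eventually_ge_at_top[of 1]
      by eventually_elim (simp only: p_def expectation_plaquette(2)[OF _ p_in])
  qed
  define v where "v = \<bar>w p \<beta>\<bar>"
  have "w p \<beta> \<noteq> 0"
    using \<beta> by (intro plaquette_limit_nonzero[OF lim1 lim2 powser[OF _ p(2)]]) auto
  then have v: "v > 0" by (simp add: v_def)
  \<comment> \<open>The exact rate is - ln v; the maximum with 1 ensures a positive constant and
    only weakens the bound.\<close>
  define C where "C = max 1 (- ln v)"
  have C: "C > 0" "exp (- C) \<le> v"
  proof -
    have "- C \<le> ln v" by (simp add: C_def)
    then have "exp (- C) \<le> exp (ln v)" by (simp only: exp_le_cancel_iff)
    then show "exp (- C) \<le> v" using v by simp
  qed (simp add: C_def)
  have bound: "convergent (\<lambda>N. \<bar>gibbs_expectation H (\<Lambda> N) N \<beta> (wilson N l)\<bar> / real N) \<and>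
       lim (\<lambda>N. \<bar>gibbs_expectation H (\<Lambda> N) N \<beta> (wilson N l)\<bar> / real N)
         \<ge> 1 * exp (- C * real (loop_area l))" if l: "simple_lattice_loop l" for l
  proof
    have ll: "lattice_loop l" using l by (simp add: simple_lattice_loop_def)
    obtain B where B: "finite B" "bd B = pos_edge ` set l" by (rule ex_bd_simple[OF l])
    have "(\<lambda>N. gibbs_expectation H (\<Lambda> N) N \<beta> (wilson N l) / real N) \<longlonglongrightarrow> w l \<beta>"
      using \<beta> by (intro lim exhausting ll) simp
    then have "(\<lambda>N. \<bar>gibbs_expectation H (\<Lambda> N) N \<beta> (wilson N l) / real N\<bar>) \<longlonglongrightarrow> \<bar>w l \<beta>\<bar>"
      by (rule tendsto_rabs)
    then have abs_lim: "(\<lambda>N. \<bar>gibbs_expectation H (\<Lambda> N) N \<beta> (wilson N l)\<bar> / real N) \<longlonglongrightarrow> \<bar>w l \<beta>\<bar>"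
      by (simp add: abs_divide)
    then show "convergent (\<lambda>N. \<bar>gibbs_expectation H (\<Lambda> N) N \<beta> (wilson N l)\<bar> / real N)"
      by (rule convergentI)
    obtain n0 where n0: "\<And>n. n \<ge> n0 \<Longrightarrow> B \<subseteq> squares (lattice_square n)"
      using lattice_square_covers[OF B(1)] by blast
    have "(\<lambda>N. plaquette_mean N \<beta> ^ card B) \<longlonglongrightarrow> w l \<beta>"
    proof (rule Lim_transform_eventually[OF lim[OF _ exhausting_lattice_square ll]])
      show "\<forall>\<^sub>F N in sequentially. gibbs_expectation H (lattice_square N) N \<beta> (wilson N l) / real N = plaquette_mean N \<beta> ^ card B"
        \<comment> \<open>3 for the formula with third coordinates, \<open>n0\<close> so that the
          box contains all squares of \<open>B\<close>.\<close>
        using eventually_ge_at_top[of "max 3 n0"]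
        by eventually_elim (intro expectation_simple_loop l B n0, auto)
    qed (use \<beta> in simp)
    moreover have "(\<lambda>N. plaquette_mean N \<beta> ^ card B) \<longlonglongrightarrow> w p \<beta> ^ card B"
      using \<beta> by (intro tendsto_power lim1) simp
    ultimately have "w l \<beta> = w p \<beta> ^ card B" by (rule LIMSEQ_unique)
    then have wl: "\<bar>w l \<beta>\<bar> = v ^ card B" by (simp add: v_def power_abs)
    have "closed_walk l" using ll by (simp add: lattice_loop_def)
    then have area: "card B \<le> loop_area l" using B by (intro card_le_loop_area) auto
    have "1 * exp (- C * real (loop_area l)) \<le> exp (- C * real (card B))"
      using area C(1) by simp
    also have "\<dots> = exp (- C) ^ card B" by (simp add: exp_of_nat_mult[symmetric] mult.commute)
    also have "\<dots> \<le> v ^ card B" by (rule power_mono[OF C(2)]) simp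
    finally show "lim (\<lambda>N. \<bar>gibbs_expectation H (\<Lambda> N) N \<beta> (wilson N l)\<bar> / real N)
        \<ge> 1 * exp (- C * real (loop_area l))"
      using limI[OF abs_lim] wl by simp
  qed
  show "\<exists>C\<^sub>1>0. \<exists>C\<^sub>2>0. \<forall>l. simple_lattice_loop l \<longrightarrow>
       convergent (\<lambda>N. \<bar>gibbs_expectation H (\<Lambda> N) N \<beta> (wilson N l)\<bar> / real N) \<and>
       lim (\<lambda>N. \<bar>gibbs_expectation H (\<Lambda> N) N \<beta> (wilson N l)\<bar> / real N)
         \<ge> C\<^sub>1 * exp (- C\<^sub>2 * real (loop_area l))"
    by (rule exI[of _ "1::real"], rule conjI, simp, rule exI[of _ C], rule conjI, rule C(1), intro allI impI, rule bound)
qed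

end
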